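(* For every sufficiently small $\Delta>0$ there exists $\epsilon>0$ such that the following holds for all sufficiently large $N$ divisible by $3$. Let $G=(V_1,V_2,V_3;E)$ be a balanced tripartite graph on $3N$ vertices such that each vertex is adjacent to at least $(2/3-\epsilon)N$ vertices in each of the other two vertex classes. Then either $G$ contains $N$ vertex-disjoint triangles (covering all vertices), or $G$ has three sets $X_1\subseteq V_1$, $X_2\subseteq V_2$, $X_3\subseteq V_3$, each of size $N/3$, with $d(X_i,X_j)\leq\Delta$ for all $i\neq j$.
   Context: For disjoint nonempty vertex sets $A,B$, $e(A,B)$ is the number of edges with one endpoint in $A$ and the other in $B$, and $d(A,B)=e(A,B)/(|A||B|)$ is the density. *)

theory Defs
  imports Complex_Main "HOL-Library.Disjoint_Sets"
begin

text \<open>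
  An undirected edge is the two-element set of its endpoints. Only the values of
  \<open>V\<close> at 1, 2, 3 matter. Disjointness of the classes makes every edge a
  two-element set, so loops are excluded.
\<close>

definition tripartite_graph :: "(nat \<Rightarrow> 'a set) \<Rightarrow> 'a set set \<Rightarrow> bool" where
  "tripartite_graph V E \<longleftrightarrow>
     (\<forall>i\<in>{1,2,3}. finite (V i)) \<and>
     disjoint_family_on V {1,2,3} \<and>
     E \<subseteq> {{x, y} | x y. \<exists>i\<in>{1,2,3}. \<exists>j\<in>{1,2,3}. i \<noteq> j \<and> x \<in> V i \<and> y \<in> V j}"

definition balanced_tripartite_graph :: "nat \<Rightarrow> (nat \<Rightarrow> 'a set) \<Rightarrow> 'a set set \<Rightarrow> bool" where
  "balanced_tripartite_graph N V E \<longleftrightarrow>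
     tripartite_graph V E \<and> (\<forall>i\<in>{1,2,3}. card (V i) = N)"

definition nbrs_in :: "'a set set \<Rightarrow> 'a \<Rightarrow> 'a set \<Rightarrow> 'a set" where
  "nbrs_in E v A = {u \<in> A. {v, u} \<in> E}"

definition edges_between :: "'a set set \<Rightarrow> 'a set \<Rightarrow> 'a set \<Rightarrow> 'a set set" where
  "edges_between E A B = {e \<in> E. \<exists>a\<in>A. \<exists>b\<in>B. e = {a, b}}"

definition density :: "'a set set \<Rightarrow> 'a set \<Rightarrow> 'a set \<Rightarrow> real" where
  "density E A B = real (card (edges_between E A B)) / (real (card A) * real (card B))"

definition triangle :: "'a set set \<Rightarrow> 'a set \<Rightarrow> bool" where
  "triangle E T \<longleftrightarrow> card T = 3 \<and> (\<forall>x\<in>T. \<forall>y\<in>T. x \<noteq> y \<longrightarrow> {x, y} \<in> E)"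

end

theory Submission
  imports Defs "HOL-Real_Asymp.Real_Asymp"
begin

text \<open>
  The proof uses absorption in place of the regularity and blow-up lemmas. Call a triple of sets of
  almost a third of each class with few edges between them sparse, and suppose there is none.

  Any two vertices of a class are exchangeable: either they have many common opposite edges, or linearly
  many vertices of the class share many opposite edges with each of them; otherwise their common
  neighbourhoods and a third set form a sparse triple. Hence there is a small set \<open>A\<close> of
  triangles which stays tileable after adding any bounded balanced set of vertices.

  A maximum tiling of the rest misses only boundedly many vertices per class. Otherwise one
  first swaps leftover vertices into tiles until the leftover contains two disjoint edges between each pair
  of classes. By maximality the tiles whose vertex of class \<open>m\<close> completes the edges missing
  class \<open>m\<close> form three disjoint thirds of the tiling. Every vertex of another class in such
  a tile can be set free, so the free vertices, two thirds of each class, span essentially no triangle,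
  and triangle-freeness at this density again forces a sparse triple.
\<close>

section \<open>Tripartite graphs of high minimum degree\<close>

text \<open>The degree bound leaves no slack: two vertices of a class are only sure to have about a
  third of each other class in common, and such thirds may have no edge between them. So counts are
  exact up to terms of order \<open>\<epsilon> N\<close>, and an argument must end in progress or in
  three thirds. A small set cannot hold an absorber for each of the \<open>N ^ 3\<close> triples.
  Domination settles this without random choice: each of \<open>m\<close> rounds serves a tenth of
  the vertices still unserved, after which at most \<open>m ^ 3\<close> triples matter, and
  \<open>m\<close> near the fourth root of \<open>N\<close> is long enough for the first and cheap
  enough for the second. Twelve absorbing sets are prepared, one for each vertex that a class may
  have left over. Twelve is also the number of endpoints of the six edges kept apart while the
  tiling is improved: more leftover vertices than that guarantee unreserved ones. Two edges are kept
  for each pair of classes because a triangle of free vertices can draw on the same pair twice, but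
  never three times. Absorption compares \<open>\<epsilon>\<close> with products of two degrees of
  order \<open>\<eta> N\<close>, hence \<open>\<epsilon>\<close> of order
  \<open>\<eta> ^ 2\<close>.\<close>

definition pair_count :: "('a \<Rightarrow> 'b \<Rightarrow> bool) \<Rightarrow> 'a set \<Rightarrow> 'b set \<Rightarrow> nat" where
  "pair_count adj A B = card {(a, b). a \<in> A \<and> b \<in> B \<and> adj a b}"

text \<open>One parameter measures both defects and sizes are bounded from below only, so the sets
  met in the proof need no trimming; \<open>sparse_triple_density\<close> restores exact thirds at
  the cost of a constant factor.\<close>

definition sparse_triple :: "(nat \<Rightarrow> 'a set) \<Rightarrow> ('a \<Rightarrow> 'a \<Rightarrow> bool) \<Rightarrow> nat \<Rightarrow> real \<Rightarrow> bool" where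
  "sparse_triple V adj N \<eta> \<longleftrightarrow>
     (\<exists>X. (\<forall>i\<in>{1,2,3}. X i \<subseteq> V i \<and> (1/3 - \<eta>) * real N \<le> real (card (X i))) \<and>
          (\<forall>i\<in>{1,2,3}. \<forall>j\<in>{1,2,3}. i \<noteq> j \<longrightarrow>
             real (pair_count adj (X i) (X j)) \<le> \<eta> * real N * real N))"

text \<open>Lets an argument be written once and used for every labelling of the classes.\<close>

definition all_idx :: "nat \<Rightarrow> nat \<Rightarrow> nat \<Rightarrow> bool" where
  "all_idx i j l \<longleftrightarrow> i \<in> {1,2,3} \<and> j \<in> {1,2,3} \<and> l \<in> {1,2,3} \<and> i \<noteq> j \<and> i \<noteq> l \<and> j \<noteq> l"

lemma all_idxD:
  assumes "all_idx i j l"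
  shows "i \<in> {1,2,3}" "j \<in> {1,2,3}" "l \<in> {1,2,3}" "i \<noteq> j" "i \<noteq> l" "j \<noteq> l"
    "{1,2,3} = {i,j,l}"
  using assms by (auto simp: all_idx_def)

lemma all_idx_perm:
  assumes "all_idx i j l"
  shows "all_idx i l j" "all_idx j i l" "all_idx j l i" "all_idx l i j" "all_idx l j i"
  using assms by (simp_all add: all_idx_def)

lemma all_idx_instances: "all_idx 1 2 3" "all_idx 2 1 3" "all_idx 3 1 2"
  by (auto simp: all_idx_def)

lemma all_idx_extend:
  assumes "i \<in> {1,2,3}"
  shows "\<exists>j l. all_idx i j l"
  using assms all_idx_instances by blast

lemma finite_pair_set:
  "finite A \<Longrightarrow> finite B \<Longrightarrow> finite {(a, b). a \<in> A \<and> b \<in> B \<and> R a b}"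
  by (rule finite_subset[of _ "A \<times> B"]) auto

lemma pair_count_sum:
  assumes "finite A" "finite B"
  shows "pair_count adj A B = (\<Sum>a\<in>A. card {b \<in> B. adj a b})"
proof -
  have "{(a, b). a \<in> A \<and> b \<in> B \<and> adj a b} = Sigma A (\<lambda>a. {b \<in> B. adj a b})" by auto
  then show ?thesis unfolding pair_count_def using assms by (simp add: card_SigmaI)
qed

lemma pair_count_commute:
  assumes "\<And>u v. adj u v \<Longrightarrow> adj v u"
  shows "pair_count adj A B = pair_count adj B A"
proof -
  have comm: "adj u v = adj v u" for u v using assms by blast
  have "bij_betw prod.swap {(a, b). a \<in> A \<and> b \<in> B \<and> adj a b} {(a, b). a \<in> B \<and> b \<in> A \<and> adj a b}"
    by (rule bij_betwI[where g = prod.swap]) (simp_all add: Pi_def comm split: prod.splits)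
  then show ?thesis unfolding pair_count_def by (rule bij_betw_same_card)
qed

lemma pair_count_le:
  assumes "finite A" "finite B" "\<And>a. a \<in> A \<Longrightarrow> real (card {b \<in> B. adj a b}) \<le> k"
  shows "real (pair_count adj A B) \<le> real (card A) * k"
proof -
  have "real (pair_count adj A B) = (\<Sum>a\<in>A. real (card {b \<in> B. adj a b}))"
    using assms by (simp add: pair_count_sum)
  also have "\<dots> \<le> (\<Sum>a\<in>A. k)" by (rule sum_mono) (use assms in auto)
  finally show ?thesis by simp
qed

lemma pair_count_ge:
  assumes "finite A" "finite B" "\<And>a. a \<in> A \<Longrightarrow> k \<le> real (card {b \<in> B. adj a b})"
  shows "real (card A) * k \<le> real (pair_count adj A B)"
proof -
  have "real (card A) * k = (\<Sum>a\<in>A. k)" by simp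
  also have "\<dots> \<le> (\<Sum>a\<in>A. real (card {b \<in> B. adj a b}))" by (rule sum_mono) (use assms in auto)
  also have "\<dots> = real (pair_count adj A B)" using assms by (simp add: pair_count_sum)
  finally show ?thesis .
qed

lemma card_split:
  assumes "finite A"
  shows "card {u \<in> A. P u} + card {u \<in> A. \<not> P u} = card A"
proof -
  have "card ({u \<in> A. P u} \<union> {u \<in> A. \<not> P u}) = card {u \<in> A. P u} + card {u \<in> A. \<not> P u}"
    by (rule card_Un_disjoint) (use assms in auto)
  moreover have "{u \<in> A. P u} \<union> {u \<in> A. \<not> P u} = A" by auto
  ultimately show ?thesis by simp
qed

lemma pair_count_compl:
  assumes "finite A" "finite B"
  shows "pair_count adj A B + pair_count (\<lambda>a b. \<not> adj a b) A B = card A * card B"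
  using assms by (simp add: pair_count_sum sum.distrib[symmetric] card_split)

text \<open>Instantiated twice: for the given graph, and for what is left of it once the absorbing
  set is removed, with a slightly smaller \<open>N\<close> and a doubled
  \<open>\<epsilon>\<close>.\<close>

locale tripartite =
  fixes V :: "nat \<Rightarrow> 'a set" and adj :: "'a \<Rightarrow> 'a \<Rightarrow> bool" and N :: nat and \<epsilon> :: real
  assumes fin: "i \<in> {1,2,3} \<Longrightarrow> finite (V i)"
    and card_V: "i \<in> {1,2,3} \<Longrightarrow> card (V i) = N"
    and disj: "i \<in> {1,2,3} \<Longrightarrow> j \<in> {1,2,3} \<Longrightarrow> i \<noteq> j \<Longrightarrow> V i \<inter> V j = {}"
    and sym: "adj u v \<Longrightarrow> adj v u"
    and deg: "i \<in> {1,2,3} \<Longrightarrow> j \<in> {1,2,3} \<Longrightarrow> i \<noteq> j \<Longrightarrow> v \<in> V i \<Longrightarrow>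
               (2/3 - \<epsilon>) * real N \<le> real (card {u \<in> V j. adj v u})"
    and eps: "0 < \<epsilon>" "\<epsilon> \<le> 1/1000"
    and N_pos: "0 < N"
begin

abbreviation sparse :: "real \<Rightarrow> bool" where
  "sparse \<equiv> sparse_triple V adj N"

lemma finite_sub: "i \<in> {1,2,3} \<Longrightarrow> A \<subseteq> V i \<Longrightarrow> finite A"
  using fin finite_subset by blast

lemma card_sub: "i \<in> {1,2,3} \<Longrightarrow> A \<subseteq> V i \<Longrightarrow> card A \<le> N"
  using fin card_V card_mono by metis

lemma pair_count_sym: "pair_count adj A B = pair_count adj B A"
  by (rule pair_count_commute) (rule sym)

lemma adj_commute: "adj u v \<longleftrightarrow> adj v u"
  using sym by blast

lemma sparseI:
  assumes idx: "all_idx i j l"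
    and sub: "A \<subseteq> V i" "B \<subseteq> V j" "C \<subseteq> V l"
    and size: "(1/3 - \<eta>) * real N \<le> real (card A)" "(1/3 - \<eta>) * real N \<le> real (card B)"
      "(1/3 - \<eta>) * real N \<le> real (card C)"
    and cnt: "real (pair_count adj A B) \<le> \<eta> * real N * real N"
      "real (pair_count adj A C) \<le> \<eta> * real N * real N"
      "real (pair_count adj B C) \<le> \<eta> * real N * real N"
  shows "sparse \<eta>"
proof -
  define X where "X = (\<lambda>m. if m = i then A else if m = j then B else C)"
  have X: "X i = A" "X j = B" "X l = C" using all_idxD[OF idx] by (auto simp: X_def)
  show ?thesis unfolding sparse_triple_def
    apply (rule exI[of _ X])
    unfolding all_idxD(7)[OF idx]
    using X sub size cnt by (auto simp: pair_count_sym)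
qed

lemma non_nbrs:
  assumes "i \<in> {1,2,3}" "j \<in> {1,2,3}" "i \<noteq> j" "v \<in> V i" "A \<subseteq> V j"
    "\<And>u. u \<in> A \<Longrightarrow> \<not> adj v u"
  shows "real (card A) \<le> (1/3 + \<epsilon>) * real N"
proof -
  have "card A \<le> card {u \<in> V j. \<not> adj v u}"
    by (rule card_mono) (use assms fin in auto)
  moreover have "card {u \<in> V j. adj v u} + card {u \<in> V j. \<not> adj v u} = N"
    using card_split[OF fin[OF assms(2)]] card_V[OF assms(2)] by simp
  ultimately have "real (card A) \<le> real N - real (card {u \<in> V j. adj v u})" by linarith
  also have "\<dots> \<le> real N - (2/3 - \<epsilon>) * real N" using deg[OF assms(1-4)] by simp
  finally show ?thesis by (simp add: algebra_simps)
qed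

lemma nbrs_in_subset:
  assumes "i \<in> {1,2,3}" "j \<in> {1,2,3}" "i \<noteq> j" "v \<in> V i" "A \<subseteq> V j"
  shows "real (card A) - (1/3 + \<epsilon>) * real N \<le> real (card {u \<in> A. adj v u})"
proof -
  have "real (card {u \<in> A. \<not> adj v u}) \<le> (1/3 + \<epsilon>) * real N"
    by (rule non_nbrs[OF assms(1-4)]) (use assms in auto)
  with card_split[of A "adj v"] finite_sub[OF assms(2,5)] show ?thesis by linarith
qed

lemma common_nbrs:
  assumes "i \<in> {1,2,3}" "j \<in> {1,2,3}" "i \<noteq> j" "v \<in> V i"
    "i' \<in> {1,2,3}" "i' \<noteq> j" "v' \<in> V i'"
  shows "(1/3 - 2 * \<epsilon>) * real N \<le> real (card {u \<in> V j. adj v u \<and> adj v' u})"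
proof -
  have "real (card {u \<in> V j. adj v u}) - (1/3 + \<epsilon>) * real N
       \<le> real (card {u \<in> {u \<in> V j. adj v u}. adj v' u})"
    by (rule nbrs_in_subset[OF assms(5) assms(2) assms(6) assms(7)]) auto
  moreover have "{u \<in> {u \<in> V j. adj v u}. adj v' u} = {u \<in> V j. adj v u \<and> adj v' u}" by auto
  ultimately show ?thesis using deg[OF assms(1-4)] by (simp add: algebra_simps)
qed

text \<open>Double count the non-adjacent pairs: each vertex of \<open>W\<close> misses all but
  \<open>\<tau> N\<close> of \<open>Q\<close>, while a vertex of \<open>Q\<close> misses at most
  \<open>(1/3 + \<epsilon>) N\<close> of \<open>W\<close>. The lower bound on \<open>Q\<close> turns
  \<open>\<tau> N\<close> into \<open>4 * \<tau>\<close> times its size, so \<open>W\<close> has at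
  most \<open>(1/3 + \<epsilon>) N / (1 - 4 * \<tau>)\<close> elements.\<close>

lemma few_low_degree:
  assumes "i \<in> {1,2,3}" "j \<in> {1,2,3}" "i \<noteq> j" "W \<subseteq> V i" "Q \<subseteq> V j"
    and low: "\<And>w. w \<in> W \<Longrightarrow> real (card {q \<in> Q. adj w q}) \<le> \<tau> * real N"
    and Q: "real N / 4 \<le> real (card Q)" and \<tau>: "0 \<le> \<tau>" "\<tau> \<le> 1/20"
  shows "real (card W) \<le> (1/3 + \<epsilon> + 2 * \<tau>) * real N"
proof -
  let ?n = "\<lambda>a b. \<not> adj a b"
  let ?w = "real (card W)" and ?q = "real (card Q)"
  have fW: "finite W" and fQ: "finite Q" using finite_sub assms by blast+
  have "?w * (?q - \<tau> * real N) \<le> real (pair_count ?n W Q)"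
  proof (rule pair_count_ge[OF fW fQ])
    fix a assume "a \<in> W"
    with low[of a] card_split[OF fQ, of "adj a"] show "?q - \<tau> * real N \<le> real (card {b \<in> Q. \<not> adj a b})"
      by linarith
  qed
  also have "pair_count ?n W Q = pair_count ?n Q W"
    by (rule pair_count_commute) (use sym in blast)
  also have "real (pair_count ?n Q W) \<le> ?q * ((1/3 + \<epsilon>) * real N)"
  proof (rule pair_count_le[OF fQ fW])
    fix a assume "a \<in> Q"
    then have "a \<in> V j" using assms by auto
    show "real (card {b \<in> W. \<not> adj a b}) \<le> (1/3 + \<epsilon>) * real N"
      by (rule non_nbrs[OF assms(2,1) _ \<open>a \<in> V j\<close>]) (use assms in auto)
  qed
  finally have 1: "?w * (?q - \<tau> * real N) \<le> ?q * ((1/3 + \<epsilon>) * real N)" .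
  have qpos: "0 < ?q" using Q N_pos by linarith
  have "\<tau> * real N \<le> 4 * \<tau> * ?q" using mult_left_mono[OF Q, of "4 * \<tau>"] \<tau> by simp
  then have "?w * (?q - 4 * \<tau> * ?q) \<le> ?w * (?q - \<tau> * real N)" by (intro mult_left_mono) auto
  with 1 have "?q * (?w * (1 - 4 * \<tau>)) \<le> ?q * ((1/3 + \<epsilon>) * real N)" by (simp add: algebra_simps)
  then have 2: "?w * (1 - 4 * \<tau>) \<le> (1/3 + \<epsilon>) * real N" using qpos by simp
  have "4 * \<tau> * (1/3 + \<epsilon> + 2 * \<tau>) \<le> 4 * \<tau> * (1/2)"
    using \<tau> eps by (intro mult_left_mono) auto
  then have "1/3 + \<epsilon> \<le> (1/3 + \<epsilon> + 2 * \<tau>) * (1 - 4 * \<tau>)" by (simp add: algebra_simps)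
  then have "(1/3 + \<epsilon>) * real N \<le> (1/3 + \<epsilon> + 2 * \<tau>) * (1 - 4 * \<tau>) * real N"
    by (intro mult_right_mono) auto
  with 2 have "?w * (1 - 4 * \<tau>) \<le> ((1/3 + \<epsilon> + 2 * \<tau>) * real N) * (1 - 4 * \<tau>)"
    by (simp add: mult_ac)
  then show ?thesis using \<tau> by (simp add: mult_le_cancel_right)
qed

end

section \<open>Links between vertices of a class\<close>

lemma pair_count_mono:
  assumes "finite A'" "finite B'" "A \<subseteq> A'" "B \<subseteq> B'"
  shows "pair_count adj A B \<le> pair_count adj A' B'"
  unfolding pair_count_def
  by (rule card_mono[OF finite_pair_set[OF assms(1,2)]]) (use assms in auto)

lemma pair_count_Un_right:
  assumes "finite A" "finite B" "finite B'" "B \<inter> B' = {}"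
  shows "pair_count adj A (B \<union> B') = pair_count adj A B + pair_count adj A B'"
proof -
  have "{(a, b). a \<in> A \<and> b \<in> B \<union> B' \<and> adj a b} =
     {(a, b). a \<in> A \<and> b \<in> B \<and> adj a b} \<union> {(a, b). a \<in> A \<and> b \<in> B' \<and> adj a b}" by auto
  then show ?thesis unfolding pair_count_def using assms
    by (simp, intro card_Un_disjoint finite_pair_set) auto
qed

lemma pair_count_compl_real:
  assumes "finite A" "finite B"
  shows "real (pair_count adj A B) + real (pair_count (\<lambda>a b. \<not> adj a b) A B) = real (card A) * real (card B)"
  using arg_cong[OF pair_count_compl[OF assms, of adj], of real] by simp

context tripartite
begin

definition common :: "nat \<Rightarrow> 'a \<Rightarrow> 'a \<Rightarrow> 'a set" where
  "common j x x' = {y \<in> V j. adj x y \<and> adj x' y}"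

text \<open>Each counted edge forms a triangle with \<open>x\<close> and also with
  \<open>x'\<close>, so over it the two vertices are interchangeable.\<close>

definition links :: "nat \<Rightarrow> nat \<Rightarrow> 'a \<Rightarrow> 'a \<Rightarrow> nat" where
  "links j l x x' = pair_count adj (common j x x') (common l x x')"

lemma common_commute: "common j x x' = common j x' x"
  by (auto simp: common_def)

lemma links_commute: "links j l x x' = links l j x x'"
  unfolding links_def by (rule pair_count_sym)

lemma links_swap: "links j l x x' = links j l x' x"
  unfolding links_def by (simp add: common_commute)

lemma common_sub: "common j x x' \<subseteq> V j"
  by (auto simp: common_def)

lemma common_size:
  assumes "all_idx i j l" "x \<in> V i" "x' \<in> V i"
  shows "(1/3 - 2 * \<epsilon>) * real N \<le> real (card (common j x x'))"
  unfolding common_def using common_nbrs[of i j x i x'] all_idxD[OF assms(1)] assms by auto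

lemma private_size:
  assumes "all_idx i j l" "x \<in> V i"
  shows "card {y \<in> V j. adj x y \<and> \<not> adj x' y} + card (common j x x') = card {y \<in> V j. adj x y}"
  using card_split[of "{y \<in> V j. adj x y}" "adj x'"] fin[OF all_idxD(2)[OF assms(1)]]
  by (simp add: common_def conj_ac)

text \<open>Split the common neighbours of \<open>x\<close> and \<open>v\<close> in
  \<open>V j\<close> by adjacency to \<open>x'\<close>. If \<open>v\<close> sees little of the
  common neighbourhood of \<open>x\<close> and \<open>x'\<close>, it sees much of the part private
  to \<open>x\<close>.\<close>

lemma degree_split:
  assumes "all_idx i j l" "x \<in> V i" "v \<in> V i"
  shows "(1/3 - 2 * \<epsilon>) * real N \<le> real (card {y \<in> common j x x'. adj v y})
     + real (card {y \<in> {y \<in> V j. adj x y \<and> \<not> adj x' y}. adj v y})"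
proof -
  have f: "finite (V j)" using fin[OF all_idxD(2)[OF assms(1)]] .
  have eq: "{y \<in> V j. adj x y \<and> adj v y} = {y \<in> common j x x'. adj v y} \<union>
    {y \<in> {y \<in> V j. adj x y \<and> \<not> adj x' y}. adj v y}" by (auto simp: common_def)
  have "card {y \<in> V j. adj x y \<and> adj v y} = card {y \<in> common j x x'. adj v y} +
    card {y \<in> {y \<in> V j. adj x y \<and> \<not> adj x' y}. adj v y}"
    unfolding eq by (rule card_Un_disjoint) (use f in \<open>auto simp: common_def\<close>)
  then show ?thesis
    using common_nbrs[of i j x i v] all_idxD[OF assms(1)] assms by auto
qed

text \<open>A vertex of \<open>V j\<close> misses at most about a third of \<open>V l\<close>. With
  few edges between the two common neighbourhoods, the vertices of the first use up these misses
  inside the second, which has about a third of \<open>V l\<close> or more. Hence the second cannot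
  be much larger, and almost nothing outside it is missed.\<close>

lemma sparse_common_size:
  assumes idx: "all_idx i j l" and x: "x \<in> V i" "x' \<in> V i" and \<beta>: "0 \<le> \<beta>"
    and few: "real (links j l x x') \<le> \<beta> * real N * real N"
  shows "real (card (common l x x')) \<le> (1/3 + \<epsilon> + 4 * \<beta>) * real N"
    and "real (pair_count (\<lambda>a b. \<not> adj a b) (common j x x') (V l - common l x x'))
      \<le> (3 * \<epsilon> + \<beta>) * real N * real N"
proof -
  let ?A = "common j x x'" and ?B = "common l x x'" and ?n = "\<lambda>a b. \<not> adj a b"
  let ?a = "real (card ?A)" and ?b = "real (card ?B)" and ?N = "real N"
  note D = all_idxD[OF idx]
  have fA: "finite ?A" and fB: "finite ?B" and fV: "finite (V l)"
    using finite_sub[OF D(2) common_sub] finite_sub[OF D(3) common_sub] fin[OF D(3)] by auto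
  have compl: "real (pair_count adj ?A ?B) + real (pair_count ?n ?A ?B) = ?a * ?b"
    by (rule pair_count_compl_real[OF fA fB])
  have few': "real (pair_count adj ?A ?B) \<le> \<beta> * ?N * ?N" using few by (simp add: links_def)
  have size_a: "(1/3 - 2 * \<epsilon>) * ?N \<le> ?a" using common_size[OF idx x] .
  have size_b: "(1/3 - 2 * \<epsilon>) * ?N \<le> ?b"
    using common_size[OF all_idx_perm(1)[OF idx] x] .
  have aN: "?a \<le> ?N" using card_sub[OF D(2) common_sub] by simp
  have nV: "real (pair_count ?n ?A (V l)) \<le> ?a * ((1/3 + \<epsilon>) * ?N)"
  proof (rule pair_count_le[OF fA fV])
    fix a assume "a \<in> ?A"
    then have "a \<in> V j" using common_sub by auto
    then show "real (card {b \<in> V l. \<not> adj a b}) \<le> (1/3 + \<epsilon>) * ?N"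
      by (intro non_nbrs[of j l a]) (use D in auto)
  qed
  have "V l = ?B \<union> (V l - ?B)" using common_sub by auto
  then have split: "pair_count ?n ?A (V l) = pair_count ?n ?A ?B + pair_count ?n ?A (V l - ?B)"
    using pair_count_Un_right[OF fA fB, of "V l - ?B" ?n] fV by auto
  have "?a * ?b \<le> ?a * ((1/3 + \<epsilon>) * ?N) + \<beta> * ?N * ?N"
    using compl few' nV split by linarith
  \<comment> \<open>The error becomes proportional to the size of \<open>?A\<close> because
    \<open>?A\<close> has at least \<open>N / 4\<close> elements.\<close>
  also have "\<beta> * ?N * ?N \<le> ?a * (4 * \<beta> * ?N)"
  proof -
    have "(1/4) * ?N \<le> (1/3 - 2 * \<epsilon>) * ?N" using eps by (intro mult_right_mono) auto
    then have "?N \<le> 4 * ?a" using size_a by simp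
    then have "(\<beta> * ?N) * ?N \<le> (\<beta> * ?N) * (4 * ?a)" using \<beta> by (intro mult_left_mono) auto
    then show ?thesis by (simp add: algebra_simps)
  qed
  finally have *: "?a * ?b \<le> ?a * ((1/3 + \<epsilon> + 4 * \<beta>) * ?N)" by (simp add: algebra_simps)
  have "0 < (1/3 - 2 * \<epsilon>) * ?N" using eps N_pos by (intro mult_pos_pos) auto
  with size_a have "0 < ?a" by linarith
  with * show "?b \<le> (1/3 + \<epsilon> + 4 * \<beta>) * ?N" by simp
  have "?a * ((1/3 - 2 * \<epsilon>) * ?N) \<le> ?a * ?b" using size_b by (intro mult_left_mono) auto
  then have "real (pair_count ?n ?A (V l - ?B)) \<le> ?a * (3 * \<epsilon> * ?N) + \<beta> * ?N * ?N"
    using compl few' nV split by (simp add: algebra_simps)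
  also have "?a * (3 * \<epsilon> * ?N) \<le> ?N * (3 * \<epsilon> * ?N)" using aN eps by (intro mult_right_mono) auto
  finally show "real (pair_count ?n ?A (V l - ?B)) \<le> (3 * \<epsilon> + \<beta>) * ?N * ?N"
    by (simp add: algebra_simps)
qed

text \<open>Neighbours of \<open>v\<close> among the common neighbours of \<open>x\<close> and
  \<open>x'\<close>, and among those private to \<open>x\<close>, all lie in the common
  neighbourhood of \<open>x\<close> and \<open>v\<close>. There are at least
  \<open>\<tau> * \<tau> * N * N\<close> pairs between the two kinds, and by density almost all are
  edges.\<close>

lemma links_through_dense:
  assumes idx: "all_idx i j l" and x: "x \<in> V i" "x' \<in> V i" "v \<in> V i"
    and dense: "real (pair_count (\<lambda>a b. \<not> adj a b) (common j x x') (V l - common l x x'))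
      \<le> \<kappa> * real N * real N"
    and d: "\<tau> * real N \<le> real (card {y \<in> common j x x'. adj v y})"
      "\<tau> * real N \<le> real (card {z \<in> {z \<in> V l. adj x z \<and> \<not> adj x' z}. adj v z})"
    and \<tau>: "0 \<le> \<tau>"
  shows "(\<tau> * \<tau> - \<kappa>) * real N * real N \<le> real (links j l x v)"
proof -
  let ?n = "\<lambda>a b. \<not> adj a b"
  let ?P = "{y \<in> common j x x'. adj v y}" and ?Q = "{z \<in> {z \<in> V l. adj x z \<and> \<not> adj x' z}. adj v z}"
  note D = all_idxD[OF idx]
  have fV: "finite (V j)" "finite (V l)" using fin[OF D(2)] fin[OF D(3)] .
  have fP: "finite ?P" "finite ?Q" using fV by (auto simp: common_def)
  have "pair_count ?n ?P ?Q \<le> pair_count ?n (common j x x') (V l - common l x x')"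
    by (rule pair_count_mono) (use fV in \<open>auto simp: common_def\<close>)
  then have n: "real (pair_count ?n ?P ?Q) \<le> \<kappa> * real N * real N" using dense by linarith
  have "pair_count adj ?P ?Q \<le> links j l x v"
    unfolding links_def by (rule pair_count_mono) (use fV in \<open>auto simp: common_def\<close>)
  moreover have "real (pair_count adj ?P ?Q) + real (pair_count ?n ?P ?Q) = real (card ?P) * real (card ?Q)"
    by (rule pair_count_compl_real[OF fP])
  moreover have "(\<tau> * real N) * (\<tau> * real N) \<le> real (card ?P) * real (card ?Q)"
    by (rule mult_mono[OF d]) (use \<tau> in auto)
  ultimately show ?thesis using n by (simp add: algebra_simps)
qed

text \<open>With \<open>A\<close> and \<open>B\<close> the common neighbourhoods of two unlinked vertices, the pairs \<open>A\<close>, \<open>V l - B\<close>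
  and \<open>V j - A\<close>, \<open>B\<close> are almost complete. A vertex that is not an intermediate link then either almost
  misses both \<open>A\<close> and \<open>B\<close>, or almost misses the private neighbourhood of \<open>x\<close> or of \<open>x'\<close> in \<open>V j\<close>;
  the latter happens for at most about two thirds of the class.\<close>

lemma linked_or_two_step:
  assumes idx: "all_idx i j l" and x: "x \<in> V i" "x' \<in> V i"
    and \<tau>: "0 < \<tau>" "\<tau> \<le> 1/20" and \<epsilon>: "12 * \<epsilon> \<le> \<tau> * \<tau>"
    and not_sparse: "\<not> sparse (20 * \<tau>)"
    and few: "real (links j l x x') \<le> \<tau> * \<tau> / 4 * real N * real N"
  shows "2 * \<tau> * real N \<le> real (card {v \<in> V i. \<tau> * \<tau> / 4 * real N * real N < real (links j l x v)
    \<and> \<tau> * \<tau> / 4 * real N * real N < real (links j l x' v)})"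
proof (rule ccontr)
  let ?N = "real N" and ?\<beta> = "\<tau> * \<tau> / 4"
  define G where "G = {v \<in> V i. ?\<beta> * ?N * ?N < real (links j l x v) \<and> ?\<beta> * ?N * ?N < real (links j l x' v)}"
  assume "\<not> 2 * \<tau> * ?N \<le> real (card {v \<in> V i. ?\<beta> * ?N * ?N < real (links j l x v)
    \<and> ?\<beta> * ?N * ?N < real (links j l x' v)})"
  then have G: "real (card G) < 2 * \<tau> * ?N" by (simp add: G_def)
  note D = all_idxD[OF idx] and idx' = all_idx_perm(1)[OF idx]
  have Npos: "0 < ?N" using N_pos by simp
  have few': "real (links l j x x') \<le> ?\<beta> * ?N * ?N" using few by (simp add: links_commute)
  have few2: "real (links j l x' x) \<le> ?\<beta> * ?N * ?N" using few by (simp add: links_swap)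
  have few2': "real (links l j x' x) \<le> ?\<beta> * ?N * ?N" using few' by (simp add: links_swap)
  have \<tau>2: "\<tau> * \<tau> \<le> 1/20 * \<tau>" using \<tau> by (intro mult_right_mono) auto
  have \<tau>2pos: "0 < \<tau> * \<tau>" using \<tau> by simp
  have \<beta>0: "0 \<le> ?\<beta>" using \<tau> by simp
  define A where "A = common j x x'"
  define B where "B = common l x x'"
  define A1 where "A1 = {y \<in> V j. adj x y \<and> \<not> adj x' y}"
  define A2 where "A2 = {y \<in> V j. adj x' y \<and> \<not> adj x y}"
  define B1 where "B1 = {y \<in> V l. adj x y \<and> \<not> adj x' y}"
  define B2 where "B2 = {y \<in> V l. adj x' y \<and> \<not> adj x y}"
  define C where "C = {v \<in> V i. real (card {y \<in> A. adj v y}) < \<tau> * ?N \<and> real (card {y \<in> B. adj v y}) < \<tau> * ?N}"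
  define W1 where "W1 = {v \<in> V i. real (card {y \<in> A1. adj v y}) < \<tau> * ?N}"
  define W2 where "W2 = {v \<in> V i. real (card {y \<in> A2. adj v y}) < \<tau> * ?N}"
  have sub: "A \<subseteq> V j" "B \<subseteq> V l" "A1 \<subseteq> V j" "A2 \<subseteq> V j" "C \<subseteq> V i" "W1 \<subseteq> V i" "W2 \<subseteq> V i" "G \<subseteq> V i"
    by (auto simp: A_def B_def A1_def A2_def common_def C_def W1_def W2_def G_def)
  have small: "\<tau> * ?N + \<tau> * ?N \<le> (1/3 - 2 * \<epsilon>) * ?N"
    using \<tau> eps mult_right_mono[of "2 * \<tau>" "1/3 - 2 * \<epsilon>" ?N] by (simp add: algebra_simps)
  \<comment> \<open>By \<open>12 * \<epsilon> \<le> \<tau> * \<tau>\<close> the loss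
    \<open>3 * \<epsilon>\<close> is at most \<open>?\<beta>\<close>; of
    \<open>\<tau> * \<tau>\<close>, which is four times \<open>?\<beta>\<close>, at least twice
    \<open>?\<beta>\<close> survives.\<close>
  have link_big: "?\<beta> * ?N * ?N < r" if "(\<tau> * \<tau> - (3 * \<epsilon> + ?\<beta>)) * ?N * ?N \<le> r" for r
  proof -
    have "?\<beta> * ?N * ?N < (\<tau> * \<tau> - (3 * \<epsilon> + ?\<beta>)) * ?N * ?N"
      using \<epsilon> \<tau>2pos Npos by (intro mult_strict_right_mono) auto
    then show ?thesis using that by linarith
  qed
  note dense = sparse_common_size(2)[OF idx x \<beta>0 few] sparse_common_size(2)[OF idx' x \<beta>0 few']
    sparse_common_size(2)[OF idx x(2) x(1) \<beta>0 few2] sparse_common_size(2)[OF idx' x(2) x(1) \<beta>0 few2']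
  have cov: "v \<in> G \<union> C \<union> W1 \<union> W2" if v: "v \<in> V i" for v
  proof (rule ccontr)
    assume not: "v \<notin> G \<union> C \<union> W1 \<union> W2"
    have dA1: "\<tau> * ?N \<le> real (card {y \<in> A1. adj v y})" and dA2: "\<tau> * ?N \<le> real (card {y \<in> A2. adj v y})"
      using not v by (auto simp: W1_def W2_def)
    note s1 = degree_split[OF idx' x(1) v, of x', folded B_def B1_def]
    note s2 = degree_split[OF idx' x(2) v, of x, folded B2_def, unfolded common_commute[of l x' x], folded B_def]
    \<comment> \<open>Rich in \<open>A\<close>, \<open>B1\<close> and \<open>B2\<close>, the vertex
      \<open>v\<close> would be linked to \<open>x\<close> over \<open>A\<close> and
      \<open>B1\<close>, and to \<open>x'\<close> over \<open>A\<close> and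
      \<open>B2\<close>.\<close>
    have not_both: "real (card {y \<in> A. adj v y}) < \<tau> * ?N \<or> real (card {y \<in> B1. adj v y}) < \<tau> * ?N \<or>
        real (card {y \<in> B2. adj v y}) < \<tau> * ?N"
    proof (rule ccontr)
      assume "\<not> ?thesis"
      then have d: "\<tau> * ?N \<le> real (card {y \<in> A. adj v y})" "\<tau> * ?N \<le> real (card {y \<in> B1. adj v y})"
        "\<tau> * ?N \<le> real (card {y \<in> B2. adj v y})" by auto
      have "?\<beta> * ?N * ?N < real (links j l x v)"
        by (rule link_big, rule links_through_dense[OF idx x v dense(1)]) (use d \<tau> in \<open>auto simp: A_def B1_def\<close>)
      moreover have "?\<beta> * ?N * ?N < real (links j l x' v)"
        by (rule link_big, rule links_through_dense[OF idx x(2) x(1) v dense(3)])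
          (use d \<tau> in \<open>auto simp: A_def B2_def common_commute\<close>)
      ultimately show False using not v by (auto simp: G_def)
    qed
    \<comment> \<open>Here the two classes change roles: avoiding \<open>W1\<close> and
      \<open>W2\<close> makes \<open>v\<close> rich in \<open>A1\<close> and \<open>A2\<close>, so
      richness in \<open>B\<close> would link it to both \<open>x\<close> and
      \<open>x'\<close>.\<close>
    have B_small: "real (card {y \<in> B. adj v y}) < \<tau> * ?N"
    proof (rule ccontr)
      assume "\<not> ?thesis"
      then have d: "\<tau> * ?N \<le> real (card {y \<in> B. adj v y})" by auto
      have "?\<beta> * ?N * ?N < real (links l j x v)"
        by (rule link_big, rule links_through_dense[OF idx' x v dense(2)]) (use d dA1 \<tau> in \<open>auto simp: B_def A1_def\<close>)
      moreover have "?\<beta> * ?N * ?N < real (links l j x' v)"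
        by (rule link_big, rule links_through_dense[OF idx' x(2) x(1) v dense(4)])
          (use d dA2 \<tau> in \<open>auto simp: B_def A2_def common_commute\<close>)
      ultimately show False using not v by (auto simp: G_def links_commute)
    qed
    \<comment> \<open>Poor in \<open>B\<close>, the vertex is rich in \<open>B1\<close> and
      \<open>B2\<close> by \<open>s1\<close> and \<open>s2\<close>, so \<open>not_both\<close> makes
      it poor in \<open>A\<close> too.\<close>
    have "real (card {y \<in> A. adj v y}) < \<tau> * ?N" using not_both s1 s2 small B_small by linarith
    then show False using not v B_small by (auto simp: C_def)
  qed
  \<comment> \<open>The size condition of \<open>few_low_degree\<close>: a neighbourhood of about
    two thirds minus a common part of about one third.\<close>
  have size_priv: "?N / 4 \<le> real (card {y \<in> V j. adj u y \<and> \<not> adj u' y})"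
    if u: "u \<in> V i" "u' \<in> V i" "real (links j l u u') \<le> ?\<beta> * ?N * ?N" for u u'
  proof -
    have fewu: "real (links l j u u') \<le> ?\<beta> * ?N * ?N" using u by (simp add: links_commute)
    have "real (card (common j u u')) \<le> (1/3 + \<epsilon> + 4 * ?\<beta>) * ?N"
      by (rule sparse_common_size(1)[OF idx' u(1,2) \<beta>0 fewu])
    moreover have "(2/3 - \<epsilon>) * ?N \<le> real (card {y \<in> V j. adj u y})" using deg[of i j u] D u by auto
    moreover have "(1/4 + (1/3 + \<epsilon> + 4 * ?\<beta>)) * ?N \<le> (2/3 - \<epsilon>) * ?N"
      by (rule mult_right_mono) (use eps \<tau> \<tau>2 in \<open>simp_all, linarith\<close>)
    ultimately show ?thesis using private_size[OF idx u(1), of u'] by (simp add: algebra_simps)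
  qed
  have W1: "real (card W1) \<le> (1/3 + \<epsilon> + 2 * \<tau>) * ?N"
    by (rule few_low_degree[OF D(1) D(2) D(4) sub(6) sub(3)])
      (use size_priv[OF x few] \<tau> in \<open>auto simp: W1_def A1_def\<close>)
  have W2: "real (card W2) \<le> (1/3 + \<epsilon> + 2 * \<tau>) * ?N"
    by (rule few_low_degree[OF D(1) D(2) D(4) sub(7) sub(4)])
      (use size_priv[OF x(2) x(1) few2] \<tau> in \<open>auto simp: W2_def A2_def\<close>)
  have fin': "finite G" "finite C" "finite W1" "finite W2" using sub finite_sub[OF D(1)] by auto
  have "N \<le> card (G \<union> C \<union> W1 \<union> W2)"
    using card_mono[of "G \<union> C \<union> W1 \<union> W2" "V i"] cov fin' card_V[OF D(1)] by auto
  also have "\<dots> \<le> card G + card C + card W1 + card W2"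
    using card_Un_le[of "G \<union> C \<union> W1" W2] card_Un_le[of "G \<union> C" W1] card_Un_le[of G C] by linarith
  finally have "?N \<le> real (card G) + real (card C) + real (card W1) + real (card W2)" by linarith
  \<comment> \<open>The class loses \<open>2 * \<tau>\<close> to \<open>G\<close> and
    \<open>1/3 + \<epsilon> + 2 * \<tau>\<close> to each of \<open>W1\<close> and \<open>W2\<close>;
    about a third remains.\<close>
  with G W1 W2 have C: "(1/3 - 6 * \<tau> - 2 * \<epsilon>) * ?N \<le> real (card C)" by (simp add: algebra_simps)
  have e\<tau>: "\<epsilon> \<le> \<tau>" using \<epsilon> \<tau>2 eps by linarith
  have "sparse (20 * \<tau>)"
  proof (rule sparseI[OF idx sub(5) sub(1) sub(2)])
    have "(1/3 - 20 * \<tau>) * ?N \<le> (1/3 - 6 * \<tau> - 2 * \<epsilon>) * ?N" using e\<tau> \<tau> by (intro mult_right_mono) auto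
    then show "(1/3 - 20 * \<tau>) * ?N \<le> real (card C)" using C by linarith
    have m: "(1/3 - 20 * \<tau>) * ?N \<le> (1/3 - 2 * \<epsilon>) * ?N" using e\<tau> \<tau> by (intro mult_right_mono) auto
    show "(1/3 - 20 * \<tau>) * ?N \<le> real (card A)" using m common_size[OF idx x] by (simp add: A_def)
    show "(1/3 - 20 * \<tau>) * ?N \<le> real (card B)" using m common_size[OF idx' x] by (simp add: B_def)
    have cC: "real (card C) \<le> ?N" using card_sub[OF D(1) sub(5)] by simp
    have le: "real (card C) * (\<tau> * ?N) \<le> 20 * \<tau> * ?N * ?N"
    proof -
      have "real (card C) * (\<tau> * ?N) \<le> ?N * (20 * \<tau> * ?N)" using cC \<tau> by (intro mult_mono) auto
      then show ?thesis by (simp add: algebra_simps)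
    qed
    have "real (pair_count adj C A) \<le> real (card C) * (\<tau> * ?N)"
      by (rule pair_count_le) (use fin' finite_sub sub D in \<open>auto simp: C_def intro: finite_subset less_imp_le\<close>)
    then show "real (pair_count adj C A) \<le> 20 * \<tau> * ?N * ?N" using le by linarith
    have "real (pair_count adj C B) \<le> real (card C) * (\<tau> * ?N)"
      by (rule pair_count_le) (use fin' finite_sub sub D in \<open>auto simp: C_def intro: finite_subset less_imp_le\<close>)
    then show "real (pair_count adj C B) \<le> 20 * \<tau> * ?N * ?N" using le by linarith
    have "?\<beta> * ?N * ?N \<le> 20 * \<tau> * ?N * ?N" using \<tau>2 \<tau> by (intro mult_right_mono) auto
    then show "real (pair_count adj A B) \<le> 20 * \<tau> * ?N * ?N"
      using few by (simp add: links_def A_def B_def)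
  qed
  then show False using not_sparse by simp
qed

end

section \<open>Tilings\<close>

text \<open>A function on class numbers gives access to each vertex by its class and makes the
  replacement of a vertex a function update. Values off \<open>{1,2,3}\<close> are
  arbitrary.\<close>

definition tile :: "(nat \<Rightarrow> 'a set) \<Rightarrow> ('a \<Rightarrow> 'a \<Rightarrow> bool) \<Rightarrow> (nat \<Rightarrow> 'a) \<Rightarrow> bool" where
  "tile V adj t \<longleftrightarrow> (\<forall>i\<in>{1,2,3}. t i \<in> V i) \<and>
     (\<forall>i\<in>{1,2,3}. \<forall>j\<in>{1,2,3}. i \<noteq> j \<longrightarrow> adj (t i) (t j))"

text \<open>Injectivity in each coordinate is disjointness of the tiles; it also prevents functions
  that agree on \<open>{1,2,3}\<close> and differ elsewhere from being counted twice.\<close>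

definition tiling :: "(nat \<Rightarrow> 'a set) \<Rightarrow> ('a \<Rightarrow> 'a \<Rightarrow> bool) \<Rightarrow> (nat \<Rightarrow> 'a) set \<Rightarrow> bool" where
  "tiling V adj T \<longleftrightarrow> finite T \<and> (\<forall>t\<in>T. tile V adj t) \<and> (\<forall>i\<in>{1,2,3}. inj_on (\<lambda>t. t i) T)"

definition cov :: "(nat \<Rightarrow> 'a) set \<Rightarrow> nat \<Rightarrow> 'a set" where
  "cov T i = (\<lambda>t. t i) ` T"

definition verts :: "(nat \<Rightarrow> 'a) set \<Rightarrow> 'a set" where
  "verts T = (\<Union>i\<in>{1,2,3}. cov T i)"

text \<open>Forgetting the tiling lets absorption be argued by cutting vertex sets into disjoint
  tileable pieces.\<close>

definition tileable :: "(nat \<Rightarrow> 'a set) \<Rightarrow> ('a \<Rightarrow> 'a \<Rightarrow> bool) \<Rightarrow> 'a set \<Rightarrow> bool" where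
  "tileable V adj S \<longleftrightarrow> (\<exists>T. tiling V adj T \<and> verts T = S)"

lemma tiling_empty: "tiling V adj {}"
  by (simp add: tiling_def)

lemma tileable_empty: "tileable V adj {}"
  unfolding tileable_def by (rule exI[of _ "{}"]) (simp add: tiling_empty verts_def cov_def)

lemma tileD:
  assumes "tile V adj t" "i \<in> {1,2,3}"
  shows "t i \<in> V i" "j \<in> {1,2,3} \<Longrightarrow> i \<noteq> j \<Longrightarrow> adj (t i) (t j)"
  using assms unfolding tile_def by blast+

lemma tilingD:
  assumes "tiling V adj T"
  shows "finite T" "t \<in> T \<Longrightarrow> tile V adj t" "i \<in> {1,2,3} \<Longrightarrow> inj_on (\<lambda>t. t i) T"
  using assms unfolding tiling_def by blast+

lemma tiling_coord_eq:
  assumes "tiling V adj T" "i \<in> {1,2,3}" "s \<in> T" "t \<in> T" "s i = t i"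
  shows "s = t"
  using inj_onD[OF tilingD(3)[OF assms(1,2)]] assms(3-5) by blast

lemma cov_sub:
  assumes "tiling V adj T" "i \<in> {1,2,3}"
  shows "cov T i \<subseteq> V i"
  unfolding cov_def using tileD(1)[OF tilingD(2)[OF assms(1)] assms(2)] by blast

lemma card_cov:
  assumes "tiling V adj T" "i \<in> {1,2,3}"
  shows "card (cov T i) = card T"
  unfolding cov_def by (rule card_image[OF tilingD(3)[OF assms]])

lemma finite_verts: "tiling V adj T \<Longrightarrow> finite (verts T)"
  using tilingD(1) by (auto simp: verts_def cov_def)

lemma tiling_subset: "tiling V adj T \<Longrightarrow> S \<subseteq> T \<Longrightarrow> tiling V adj S"
  unfolding tiling_def by (meson finite_subset inj_on_subset subsetD)

lemma cov_remove:
  assumes "tiling V adj T" "i \<in> {1,2,3}" "t \<in> T"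
  shows "cov (T - {t}) i = cov T i - {t i}"
proof -
  have "(\<lambda>t. t i) ` (T - {t}) = (\<lambda>t. t i) ` T - (\<lambda>t. t i) ` {t}"
    by (rule inj_on_image_set_diff[OF tilingD(3)[OF assms(1,2)]]) (use assms in auto)
  then show ?thesis by (simp add: cov_def)
qed

lemma cov_insert: "cov (insert t T) i = insert (t i) (cov T i)"
  by (simp add: cov_def)

lemma tiling_insert:
  assumes "tiling V adj T" "tile V adj t" "\<And>i. i \<in> {1,2,3} \<Longrightarrow> t i \<notin> cov T i"
  shows "tiling V adj (insert t T)" "card (insert t T) = Suc (card T)" "t \<notin> T"
proof -
  show "t \<notin> T" using assms(3)[of 1] by (auto simp: cov_def)
  then show "card (insert t T) = Suc (card T)" using tilingD(1)[OF assms(1)] by simp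
  have "inj_on (\<lambda>s. s i) (insert t T)" if "i \<in> {1,2,3}" for i
    using assms(3)[OF that] tilingD(3)[OF assms(1) that] by (auto simp: cov_def)
  then show "tiling V adj (insert t T)"
    using assms(2) tilingD[OF assms(1)] unfolding tiling_def by simp
qed

lemma tiling_replace:
  assumes T: "tiling V adj T" "t \<in> T" and t': "tile V adj t'"
    and new: "\<And>i. i \<in> {1,2,3} \<Longrightarrow> t' i = t i \<or> t' i \<notin> cov T i"
  shows "tiling V adj (insert t' (T - {t}))" "card (insert t' (T - {t})) = card T"
    "\<And>i. i \<in> {1,2,3} \<Longrightarrow> cov (insert t' (T - {t})) i = insert (t' i) (cov T i - {t i})"
proof -
  have R: "tiling V adj (T - {t})" by (rule tiling_subset[OF T(1)]) auto
  have "t' i \<notin> cov (T - {t}) i" if "i \<in> {1,2,3}" for i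
    using new[OF that] cov_remove[OF T(1) that T(2)] by auto
  note I = tiling_insert[OF R t' this]
  show "tiling V adj (insert t' (T - {t}))" by (rule I(1))
  show "card (insert t' (T - {t})) = card T"
    using I(2) T card_Suc_Diff1[OF tilingD(1)[OF T(1)] T(2)] by simp
  show "cov (insert t' (T - {t})) i = insert (t' i) (cov T i - {t i})" if "i \<in> {1,2,3}" for i
    using cov_remove[OF T(1) that T(2)] by (simp add: cov_insert)
qed

lemma verts_Un: "verts (S \<union> T) = verts S \<union> verts T"
  by (auto simp: verts_def cov_def)

section \<open>Tileable sets and the exchange of vertices of a class\<close>

context tripartite
begin

abbreviation "til \<equiv> tiling V adj"
abbreviation "tb \<equiv> tileable V adj"

lemma cov_verts:
  assumes "til T" "i \<in> {1,2,3}"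
  shows "cov T i = verts T \<inter> V i"
proof
  show "cov T i \<subseteq> verts T \<inter> V i" using cov_sub[OF assms] assms(2) by (auto simp: verts_def)
  show "verts T \<inter> V i \<subseteq> cov T i"
  proof
    fix x assume x: "x \<in> verts T \<inter> V i"
    then obtain j where j: "j \<in> {1,2,3}" "x \<in> cov T j" by (auto simp: verts_def)
    then have "x \<in> V j" using cov_sub[OF assms(1)] by auto
    then have "i = j" using disj[OF assms(2) j(1)] x by auto
    then show "x \<in> cov T i" using j by simp
  qed
qed

lemma tileable_sub: "tb S \<Longrightarrow> S \<subseteq> V 1 \<union> V 2 \<union> V 3"
  unfolding tileable_def verts_def using cov_sub by fastforce

lemma tileable_finite: "tb S \<Longrightarrow> finite S"
  unfolding tileable_def using finite_verts by auto

lemma tiling_Un: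
  assumes "til S" "til T" "verts S \<inter> verts T = {}"
  shows "til (S \<union> T)"
proof -
  have "inj_on (\<lambda>t. t i) (S \<union> T)" if i: "i \<in> {1,2,3}" for i
  proof -
    have "cov S i \<inter> cov T i = {}" using assms(3) i unfolding verts_def by blast
    then show ?thesis unfolding inj_on_Un
      using tilingD(3)[OF assms(1) i] tilingD(3)[OF assms(2) i] unfolding cov_def by blast
  qed
  then show ?thesis using assms(1,2) unfolding tiling_def by blast
qed

lemma tileable_Un:
  assumes "tb S" "tb T" "S \<inter> T = {}"
  shows "tb (S \<union> T)"
  using assms tiling_Un verts_Un unfolding tileable_def by metis

lemma tileable_UN:
  assumes "finite Q" "\<And>q. q \<in> Q \<Longrightarrow> tb (B q)" "disjoint_family_on B Q"
  shows "tb (\<Union>(B ` Q))"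
  using assms
proof (induction Q)
  case empty
  then show ?case by (simp add: tileable_empty)
next
  case (insert q Q)
  have "tb (B q \<union> \<Union>(B ` Q))"
  proof (rule tileable_Un)
    show "tb (B q)" using insert by simp
    show "tb (\<Union>(B ` Q))" using insert.IH insert.prems disjoint_family_on_mono[of Q "insert q Q" B] by auto
    show "B q \<inter> \<Union>(B ` Q) = {}" using insert.prems(2) insert.hyps(2) unfolding disjoint_family_on_def by (force simp del: disjoint_iff_not_equal)
  qed
  then show ?case by simp
qed

lemma tile_mk:
  assumes "all_idx i j l" "x \<in> V i" "y \<in> V j" "z \<in> V l" "adj x y" "adj x z" "adj y z"
  shows "tile V adj ((\<lambda>_. x)(j := y, l := z))"
  unfolding tile_def all_idxD(7)[OF assms(1)]
  using all_idxD(4-6)[OF assms(1)] assms(2-) assms(5-7)[THEN sym] by auto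

lemma tileable_triangle:
  assumes "all_idx i j l" "x \<in> V i" "y \<in> V j" "z \<in> V l" "adj x y" "adj x z" "adj y z"
  shows "tb {x, y, z}"
proof -
  let ?t = "(\<lambda>_. x)(j := y, l := z)"
  have "til {?t}"
    using tiling_insert(1)[OF tiling_empty tile_mk[OF assms]] by (simp add: cov_def)
  moreover have "verts {?t} = {x, y, z}"
    unfolding verts_def cov_def all_idxD(7)[OF assms(1)] using all_idxD(4-6)[OF assms(1)] by auto
  ultimately show ?thesis unfolding tileable_def by blast
qed

lemma idx_disjoint: "all_idx i j l \<Longrightarrow> V i \<inter> V j = {} \<and> V i \<inter> V l = {} \<and> V j \<inter> V l = {}"
  using disj[of i j] disj[of i l] disj[of j l] by (simp add: all_idx_def)

text \<open>A vertex meets at most \<open>N\<close> of the counted pairs, so \<open>W\<close>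
  destroys at most \<open>\<beta> * N * N\<close> of them.\<close>

lemma links_avoid:
  assumes idx: "all_idx i j l" and W: "finite W" "real (card W) \<le> \<beta> * real N"
    and many: "\<beta> * real N * real N < real (links j l x x')"
  shows "\<exists>y z. y \<in> common j x x' - W \<and> z \<in> common l x x' - W \<and> adj y z"
proof (rule ccontr)
  assume no: "\<not> ?thesis"
  note D = all_idxD[OF idx]
  have fV: "finite (V j)" "finite (V l)" using fin[OF D(2)] fin[OF D(3)] .
  have dj: "V j \<inter> V l = {}" using idx_disjoint[OF idx] by simp
  have "{(a, b). a \<in> common j x x' \<and> b \<in> common l x x' \<and> adj a b} \<subseteq> (W \<inter> V j) \<times> V l \<union> V j \<times> (W \<inter> V l)"
    using no by (auto simp: common_def)
  then have "links j l x x' \<le> card ((W \<inter> V j) \<times> V l \<union> V j \<times> (W \<inter> V l))"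
    unfolding links_def pair_count_def by (intro card_mono) (use fV in auto)
  also have "\<dots> \<le> card (W \<inter> V j) * N + N * card (W \<inter> V l)"
    using card_Un_le[of "(W \<inter> V j) \<times> V l" "V j \<times> (W \<inter> V l)"] card_V[OF D(2)] card_V[OF D(3)]
    by (simp add: card_cartesian_product)
  also have "\<dots> = (card (W \<inter> V j) + card (W \<inter> V l)) * N" by (simp add: algebra_simps)
  also have "card (W \<inter> V j) + card (W \<inter> V l) = card (W \<inter> V j \<union> W \<inter> V l)"
    by (rule card_Un_disjoint[symmetric]) (use W dj in auto)
  also have "card (W \<inter> V j \<union> W \<inter> V l) * N \<le> card W * N"
    by (intro mult_right_mono card_mono) (use W in auto)
  finally have "real (links j l x x') \<le> real (card W) * real N" by (metis of_nat_le_iff of_nat_mult)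
  also have "\<dots> \<le> \<beta> * real N * real N" using W by (intro mult_right_mono) auto
  finally show False using many by simp
qed

text \<open>Linked vertices share an edge \<open>yz\<close>, and \<open>S\<close> is its pair of
  endpoints. Otherwise some \<open>v\<close> is linked to both: with an edge \<open>yz\<close> for
  \<open>x\<close> and \<open>v\<close>, and an edge \<open>y'z'\<close> for \<open>x'\<close> and
  \<open>v\<close>, the tiles \<open>xyz\<close>, \<open>vy'z'\<close> or \<open>x'y'z'\<close>,
  \<open>vyz\<close> cover \<open>{v, y, z, y', z'}\<close> together with \<open>x\<close> or with
  \<open>x'\<close>.\<close>

lemma link_set:
  assumes \<tau>: "0 < \<tau>" "\<tau> \<le> 1/20" and \<epsilon>: "12 * \<epsilon> \<le> \<tau> * \<tau>"
    and not_sparse: "\<not> sparse (20 * \<tau>)"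
    and i: "i \<in> {1,2,3}" and x: "x \<in> V i" "x' \<in> V i" "x \<noteq> x'"
    and W: "finite W" "real (card W) + 10 \<le> \<tau> * \<tau> / 4 * real N"
  shows "\<exists>S. card S \<le> 5 \<and> finite S \<and> S \<inter> (W \<union> {x, x'}) = {} \<and> tb (insert x S) \<and> tb (insert x' S)"
proof -
  obtain j l where idx: "all_idx i j l" using all_idx_extend[OF i] by blast
  note D = all_idxD[OF idx] and dis = idx_disjoint[OF idx]
  let ?\<beta> = "\<tau> * \<tau> / 4"
  show ?thesis
  proof (cases "?\<beta> * real N * real N < real (links j l x x')")
    case True
    obtain y z where yz: "y \<in> common j x x' - W" "z \<in> common l x x' - W" "adj y z"
      using links_avoid[OF idx W(1) _ True] W(2) by auto
    have "tb {x, y, z}" "tb {x', y, z}"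
      using yz x by (auto intro!: tileable_triangle[OF idx] simp: common_def)
    moreover have "{y, z} \<inter> (W \<union> {x, x'}) = {}" using yz x dis by (auto simp: common_def)
    moreover have "card {y, z} \<le> 5" using card_insert_le_m1[of 5 "{z}" y] by simp
    ultimately show ?thesis by (intro exI[of _ "{y, z}"]) auto
  next
    case False
    define G where "G = {v \<in> V i. ?\<beta> * real N * real N < real (links j l x v)
      \<and> ?\<beta> * real N * real N < real (links j l x' v)}"
    have "2 * \<tau> * real N \<le> real (card G)" unfolding G_def
      by (rule linked_or_two_step[OF idx x(1,2) \<tau> \<epsilon> not_sparse]) (use False in auto)
    moreover have "?\<beta> * real N \<le> 2 * \<tau> * real N" using \<tau> by (intro mult_right_mono) auto
    moreover have "card (W \<union> {x, x'}) \<le> card W + 2"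
      using card_Un_le[of W "{x, x'}"] card_insert_le_m1[of 2 "{x'}" x] by simp
    ultimately have "card (W \<union> {x, x'}) < card G" using W by linarith
    then obtain v where v: "v \<in> G" "v \<notin> W" "v \<noteq> x" "v \<noteq> x'"
      using W(1) card_mono[of "W \<union> {x, x'}" G] by fastforce
    then have vV: "v \<in> V i" and lv: "?\<beta> * real N * real N < real (links j l x v)"
      "?\<beta> * real N * real N < real (links j l x' v)" by (auto simp: G_def)
    obtain y z where yz: "y \<in> common j x v - W" "z \<in> common l x v - W" "adj y z"
      using links_avoid[OF idx W(1) _ lv(1)] W(2) by auto
    have "card (insert y (insert z W)) \<le> card W + 2"
      using W(1) card_insert_le_m1 by (simp add: card_insert_if)
    then have "\<exists>y' z'. y' \<in> common j x' v - (insert y (insert z W)) \<and> z' \<in> common l x' v - (insert y (insert z W)) \<and> adj y' z'"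
      by (intro links_avoid[OF idx _ _ lv(2)]) (use W in auto)
    then obtain y' z' where yz': "y' \<in> common j x' v - (insert y (insert z W))"
      "z' \<in> common l x' v - (insert y (insert z W))" "adj y' z'" by blast
    let ?S = "{v, y, z, y', z'}"
    have t: "tb {x, y, z}" "tb {v, y, z}" "tb {x', y', z'}" "tb {v, y', z'}"
      using yz yz' x vV by (auto intro!: tileable_triangle[OF idx] simp: common_def)
    have V': "y \<in> V j" "z \<in> V l" "y' \<in> V j" "z' \<in> V l" using yz yz' by (auto simp: common_def)
    have "tb ({x, y, z} \<union> {v, y', z'})"
      by (rule tileable_Un[OF t(1,4)]) (use v vV x V' dis yz yz' in auto)
    moreover have "tb ({x', y', z'} \<union> {v, y, z})"
      by (rule tileable_Un[OF t(3,2)]) (use v vV x V' dis yz yz' in auto)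
    moreover have "{x, y, z} \<union> {v, y', z'} = insert x ?S" "{x', y', z'} \<union> {v, y, z} = insert x' ?S" by auto
    moreover have "?S \<inter> (W \<union> {x, x'}) = {}"
      using v vV x V' dis yz yz' by auto
    moreover have "card ?S \<le> 5" by (simp add: card_insert_if)
    ultimately show ?thesis by (intro exI[of _ ?S]) auto
  qed
qed

end

section \<open>Absorption\<close>

context tripartite
begin

lemma card_verts_le:
  assumes "til T"
  shows "card (verts T) \<le> 3 * card T"
proof -
  have "verts T = cov T 1 \<union> cov T 2 \<union> cov T 3" by (auto simp: verts_def)
  then have "card (verts T) \<le> card (cov T 1) + card (cov T 2) + card (cov T 3)"
    using card_Un_le[of "cov T 1 \<union> cov T 2" "cov T 3"] card_Un_le[of "cov T 1" "cov T 2"] by simp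
  then show ?thesis using card_cov[OF assms] by simp
qed

lemma avoid_size:
  assumes "finite W" "real (card W) \<le> real N / 100" "finite S"
  shows "real (card S) - real N / 100 \<le> real (card (S - W))"
proof -
  have "card S \<le> card (S - W) + card W"
    using card_Un_le[of "S - W" W] card_mono[of "S - W \<union> W" S] assms by auto
  then show ?thesis using assms(2) by linarith
qed

lemma common_avoid:
  assumes idx: "all_idx i j l" and y: "y \<in> V j" "z \<in> V l" and W: "finite W" "real (card W) \<le> real N / 100"
  shows "3/10 * real N \<le> real (card {x \<in> V i - W. adj y x \<and> adj z x})"
proof -
  note D = all_idxD[OF idx]
  have "(1/3 - 2 * \<epsilon>) * real N \<le> real (card {u \<in> V i. adj y u \<and> adj z u})"
    by (rule common_nbrs[of j i y l z]) (use D y in auto)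
  moreover have "real (card {u \<in> V i. adj y u \<and> adj z u}) - real N / 100
      \<le> real (card ({u \<in> V i. adj y u \<and> adj z u} - W))"
    by (rule avoid_size[OF W]) (use fin[OF D(1)] in auto)
  moreover have "{u \<in> V i. adj y u \<and> adj z u} - W = {x \<in> V i - W. adj y x \<and> adj z x}" by auto
  moreover have "(3/10 + 1/100) * real N \<le> (1/3 - 2 * \<epsilon>) * real N"
    using eps by (intro mult_right_mono) auto
  ultimately show ?thesis by (simp add: algebra_simps)
qed

text \<open>Averaging: outside \<open>W\<close> each \<open>u\<close> forms a triangle with at least
  \<open>(6/10) N * (3/10) N\<close> edges between \<open>V j\<close> and \<open>V l\<close>, out of
  at most \<open>N * N\<close>, so some edge serves at least a tenth of \<open>U\<close>. Its
  endpoints have common neighbours in \<open>V i\<close> off \<open>W\<close>, any of which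
  completes it to a tile.\<close>

lemma dominating_triangle:
  assumes idx: "all_idx i j l" and U: "U \<subseteq> V i" "U \<noteq> {}"
    and W: "finite W" "real (card W) \<le> real N / 100"
  shows "\<exists>t. tile V adj t \<and> t ` {1,2,3} \<inter> W = {} \<and>
     real (card U) / 10 \<le> real (card {u \<in> U. adj u (t j) \<and> adj u (t l)})"
proof -
  note D = all_idxD[OF idx]
  let ?N = "real N"
  define E where "E = {(y, z). y \<in> V j - W \<and> z \<in> V l - W \<and> adj y z}"
  define R where "R = (\<lambda>u (y, z). adj u y \<and> adj u z)"
  have fV: "finite (V i)" "finite (V j)" "finite (V l)" using fin[OF D(1)] fin[OF D(2)] fin[OF D(3)] .
  have fE: "finite E" unfolding E_def by (rule finite_pair_set) (use fV in auto)
  have fU: "finite U" by (rule finite_subset[OF U(1) fV(1)])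
  have Npos: "0 < ?N" using N_pos by simp
  have cE: "real (card E) \<le> ?N * ?N"
  proof -
    have "card E \<le> card (V j \<times> V l)" by (rule card_mono) (use fV in \<open>auto simp: E_def\<close>)
    then show ?thesis using card_V[OF D(2)] card_V[OF D(3)]
      by (metis card_cartesian_product of_nat_le_iff of_nat_mult)
  qed
  have cU: "0 < real (card U)" using U fU by (simp add: card_gt_0_iff)
  have "real (card U) * (18/100 * ?N * ?N) \<le> real (pair_count R U E)"
  proof (rule pair_count_ge[OF fU fE])
    fix u assume "u \<in> U"
    then have u: "u \<in> V i" using U by auto
    let ?Y = "{y \<in> V j - W. adj u y}" and ?Z = "{z \<in> V l - W. adj u z}"
    have "{p \<in> E. R u p} = {(y, z). y \<in> ?Y \<and> z \<in> ?Z \<and> adj y z}"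
      by (auto simp: E_def R_def)
    then have eq: "card {p \<in> E. R u p} = pair_count adj ?Y ?Z" by (simp add: pair_count_def)
    have "real (card ?Y) * (3/10 * ?N) \<le> real (pair_count adj ?Y ?Z)"
    proof (rule pair_count_ge)
      fix y assume y: "y \<in> ?Y"
      have "3/10 * ?N \<le> real (card {x \<in> V l - W. adj u x \<and> adj y x})"
        by (rule common_avoid[OF _ _ _ W, of l i j]) (use all_idx_perm[OF idx] u y in auto)
      moreover have "{x \<in> V l - W. adj u x \<and> adj y x} = {b \<in> ?Z. adj y b}" by auto
      ultimately show "3/10 * ?N \<le> real (card {b \<in> ?Z. adj y b})" by simp
    qed (use fV in auto)
    moreover have "6/10 * ?N \<le> real (card ?Y)"
    proof -
      have "real (card {y \<in> V j. adj u y}) - ?N / 100 \<le> real (card ({y \<in> V j. adj u y} - W))"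
        by (rule avoid_size[OF W]) (use fV in auto)
      moreover have "{y \<in> V j. adj u y} - W = ?Y" by auto
      moreover have "(2/3 - \<epsilon>) * ?N \<le> real (card {y \<in> V j. adj u y})" by (rule deg[OF D(1,2,4) u])
      moreover have "(6/10 + 1/100) * ?N \<le> (2/3 - \<epsilon>) * ?N" using eps by (intro mult_right_mono) auto
      ultimately show ?thesis by (simp add: algebra_simps)
    qed
    then have "6/10 * ?N * (3/10 * ?N) \<le> real (card ?Y) * (3/10 * ?N)" by (intro mult_right_mono) auto
    ultimately show "18/100 * ?N * ?N \<le> real (card {p \<in> E. R u p})" using eq by (simp add: algebra_simps)
  qed
  also have "pair_count R U E = pair_count (\<lambda>p u. R u p) E U"
    unfolding pair_count_def by (rule bij_betw_same_card[of prod.swap], rule bij_betwI[where g = prod.swap]) auto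
  finally have dbl: "real (card U) * (18/100 * ?N * ?N) \<le> real (pair_count (\<lambda>p u. R u p) E U)" .
  have "\<exists>p\<in>E. real (card U) / 10 \<le> real (card {u \<in> U. R u p})"
  proof (rule ccontr)
    assume "\<not> ?thesis"
    then have "real (pair_count (\<lambda>p u. R u p) E U) \<le> real (card E) * (real (card U) / 10)"
      by (intro pair_count_le[OF fE fU]) auto
    also have "\<dots> \<le> ?N * ?N * (real (card U) / 10)" using cE by (intro mult_right_mono) auto
    finally have "real (card U) * ?N * ?N * (18/100) \<le> real (card U) * ?N * ?N * (1/10)"
      using dbl by (simp add: algebra_simps)
    moreover have "0 < real (card U) * ?N * ?N" using cU Npos by simp
    ultimately show False by linarith
  qed
  then obtain y z where yz: "(y, z) \<in> E" and big: "real (card U) / 10 \<le> real (card {u \<in> U. R u (y, z)})" by auto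
  have yz': "y \<in> V j" "z \<in> V l" "y \<notin> W" "z \<notin> W" "adj y z" using yz by (auto simp: E_def)
  have "0 < 3/10 * ?N" using Npos by simp
  also have "\<dots> \<le> real (card {x \<in> V i - W. adj y x \<and> adj z x})" by (rule common_avoid[OF idx yz'(1,2) W])
  finally have "{x \<in> V i - W. adj y x \<and> adj z x} \<noteq> {}" by (metis card.empty of_nat_0 less_irrefl)
  then obtain x where x: "x \<in> V i" "x \<notin> W" "adj y x" "adj z x" by blast
  let ?t = "(\<lambda>_. x)(j := y, l := z)"
  have "tile V adj ?t" by (rule tile_mk[OF idx]) (use x yz' sym in auto)
  moreover have "?t ` {1,2,3} \<inter> W = {}" using x yz' by auto
  moreover have "?t j = y" "?t l = z" using D(6) by auto
  ultimately show ?thesis using big by (intro exI[of _ ?t]) (simp add: R_def)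
qed

lemma verts_insert: "verts (insert t T) = t ` {1,2,3} \<union> verts T"
  by (auto simp: verts_def cov_def)

text \<open>Greedy choice by \<open>dominating_triangle\<close>, applied each time to the vertices
  not yet served, which lose a tenth of their number per tile. Once
  \<open>(9/10) ^ m * N < 1\<close>, every vertex of \<open>V i\<close> is served.\<close>

lemma dominating_tiling:
  assumes idx: "all_idx i j l" and W: "finite W" "real (card W) + 3 * real m \<le> real N / 100"
  shows "\<exists>T. til T \<and> card T \<le> m \<and> verts T \<inter> W = {} \<and>
     real (card {u \<in> V i. \<not> (\<exists>t\<in>T. adj u (t j) \<and> adj u (t l))}) \<le> (9/10) ^ m * real N"
  using W(2)
proof (induction m)
  case 0
  show ?case by (rule exI[of _ "{}"])
      (use card_V[OF all_idxD(1)[OF idx]] in \<open>simp add: tiling_empty verts_def cov_def\<close>)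
next
  case (Suc m)
  then obtain T where T: "til T" "card T \<le> m" "verts T \<inter> W = {}"
    "real (card {u \<in> V i. \<not> (\<exists>t\<in>T. adj u (t j) \<and> adj u (t l))}) \<le> (9/10) ^ m * real N" by auto
  define U where "U = {u \<in> V i. \<not> (\<exists>t\<in>T. adj u (t j) \<and> adj u (t l))}"
  show ?case
  proof (cases "U = {}")
    case True
    then have "card {u \<in> V i. \<not> (\<exists>t\<in>T. adj u (t j) \<and> adj u (t l))} = 0" by (simp only: U_def card.empty)
    then show ?thesis using T by (intro exI[of _ T]) simp
  next
    case False
    have "card (W \<union> verts T) \<le> card W + 3 * m"
      using card_Un_le[of W "verts T"] card_verts_le[OF T(1)] T(2) by linarith
    then have W': "finite (W \<union> verts T)" "real (card (W \<union> verts T)) \<le> real N / 100"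
      using Suc.prems W(1) finite_verts[OF T(1)] by auto
    have US: "U \<subseteq> V i" by (auto simp: U_def)
    obtain t where t: "tile V adj t" "t ` {1,2,3} \<inter> (W \<union> verts T) = {}"
      "real (card U) / 10 \<le> real (card {u \<in> U. adj u (t j) \<and> adj u (t l)})"
      using dominating_triangle[OF idx US False W'] by blast
    have new: "t m \<notin> cov T m" if "m \<in> {1,2,3}" for m
      using t(2) that by (auto simp: verts_def)
    have fU: "finite U" by (rule finite_sub[OF all_idxD(1)[OF idx] US])
    have "{u \<in> V i. \<not> (\<exists>s\<in>insert t T. adj u (s j) \<and> adj u (s l))} = {u \<in> U. \<not> (adj u (t j) \<and> adj u (t l))}"
      by (auto simp: U_def)
    moreover have "real (card {u \<in> U. \<not> (adj u (t j) \<and> adj u (t l))}) \<le> 9/10 * real (card U)"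
      using card_split[OF fU, of "\<lambda>u. adj u (t j) \<and> adj u (t l)"] t(3) by linarith
    moreover have "9/10 * real (card U) \<le> (9/10) ^ Suc m * real N" using T(4) by (simp add: U_def)
    ultimately show ?thesis
      using tiling_insert[OF T(1) t(1) new] T t(2)
      by (intro exI[of _ "insert t T"]) (auto simp: verts_insert)
  qed
qed

text \<open>\<open>B\<close> consists of a tile \<open>t\<close> and link sets \<open>S1\<close>,
  \<open>S2\<close>, \<open>S3\<close> joining \<open>x\<close>, \<open>y\<close>, \<open>z\<close>
  to the vertices of \<open>t\<close>, at most \<open>3 + 3 * 5\<close> vertices. Alone, each vertex
  of \<open>t\<close> is tiled with its link set; with the triple added, \<open>x\<close>,
  \<open>y\<close>, \<open>z\<close> take over the link sets and \<open>t\<close> is a tile by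
  itself.\<close>

lemma absorber:
  assumes \<tau>: "0 < \<tau>" "\<tau> \<le> 1/20" and \<epsilon>: "12 * \<epsilon> \<le> \<tau> * \<tau>"
    and not_sparse: "\<not> sparse (20 * \<tau>)"
    and x: "x \<in> V 1" "y \<in> V 2" "z \<in> V 3" "{x, y, z} \<subseteq> W"
    and W: "finite W" "real (card W) + 40 \<le> \<tau> * \<tau> / 4 * real N"
  shows "\<exists>B. finite B \<and> card B \<le> 18 \<and> B \<inter> W = {} \<and> tb B \<and> tb (B \<union> {x, y, z})"
proof -
  have small: "\<tau> * \<tau> / 4 * real N \<le> real N / 100"
  proof -
    have "\<tau> * \<tau> / 4 \<le> 1/20 * (1/20) / 4" using \<tau> by (intro divide_right_mono mult_mono) auto
    then have "\<tau> * \<tau> / 4 \<le> 1/100" by simp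
    then have "\<tau> * \<tau> / 4 * real N \<le> 1/100 * real N" by (rule mult_right_mono) simp
    then show ?thesis by simp
  qed
  \<comment> \<open>Any tile off \<open>W\<close> will do; \<open>dominating_triangle\<close> is a
    convenient source of one.\<close>
  obtain t where t: "tile V adj t" "t ` {1,2,3} \<inter> W = {}"
    using dominating_triangle[OF all_idx_instances(1), of "V 1" W] x W small by (auto simp: mult_ac)
  have tV: "t 1 \<in> V 1" "t 2 \<in> V 2" "t 3 \<in> V 3" using tileD(1)[OF t(1)] by auto
  have tW: "t 1 \<notin> W" "t 2 \<notin> W" "t 3 \<notin> W" using t(2) by auto
  let ?W1 = "W \<union> {t 1, t 2, t 3}"
  have c3: "card {t 1, t 2, t 3} \<le> 3" by (simp add: card_insert_if)
  have W1: "finite ?W1" "card ?W1 \<le> card W + 3" using W c3 card_Un_le[of W "{t 1, t 2, t 3}"] by auto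
  have "\<exists>S. card S \<le> 5 \<and> finite S \<and> S \<inter> (?W1 \<union> {x, t 1}) = {} \<and> tb (insert x S) \<and> tb (insert (t 1) S)"
    by (rule link_set[OF \<tau> \<epsilon> not_sparse, of 1]) (use x tV tW W W1 in auto)
  then obtain S1 where S1: "card S1 \<le> 5" "finite S1" "S1 \<inter> ?W1 = {}" "tb (insert x S1)" "tb (insert (t 1) S1)" by blast
  let ?W2 = "?W1 \<union> S1"
  have W2: "finite ?W2" "card ?W2 \<le> card W + 8" using W1 S1 card_Un_le[of ?W1 S1] by auto
  have "\<exists>S. card S \<le> 5 \<and> finite S \<and> S \<inter> (?W2 \<union> {y, t 2}) = {} \<and> tb (insert y S) \<and> tb (insert (t 2) S)"
    by (rule link_set[OF \<tau> \<epsilon> not_sparse, of 2]) (use x tV tW W W2 in auto)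
  then obtain S2 where S2: "card S2 \<le> 5" "finite S2" "S2 \<inter> ?W2 = {}" "tb (insert y S2)" "tb (insert (t 2) S2)" by blast
  let ?W3 = "?W2 \<union> S2"
  have W3: "finite ?W3" "card ?W3 \<le> card W + 13" using W2 S2 card_Un_le[of ?W2 S2] by auto
  have "\<exists>S. card S \<le> 5 \<and> finite S \<and> S \<inter> (?W3 \<union> {z, t 3}) = {} \<and> tb (insert z S) \<and> tb (insert (t 3) S)"
    by (rule link_set[OF \<tau> \<epsilon> not_sparse, of 3]) (use x tV tW W W3 in auto)
  then obtain S3 where S3: "card S3 \<le> 5" "finite S3" "S3 \<inter> ?W3 = {}" "tb (insert z S3)" "tb (insert (t 3) S3)" by blast
  have tt: "tb {t 1, t 2, t 3}"
    using tV tileD(2)[OF t(1)] by (intro tileable_triangle[OF all_idx_instances(1)]) auto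
  have dis: "V 1 \<inter> V 2 = {}" "V 1 \<inter> V 3 = {}" "V 2 \<inter> V 3 = {}" using idx_disjoint[OF all_idx_instances(1)] by auto
  have xin: "x \<in> W" "y \<in> W" "z \<in> W" using x by auto
  let ?B = "insert (t 1) S1 \<union> insert (t 2) S2 \<union> insert (t 3) S3"
  have "tb ?B"
    by (intro tileable_Un S1 S2 S3) (use S1 S2 S3 tV dis in auto)
  moreover have "tb (insert x S1 \<union> insert y S2 \<union> insert z S3 \<union> {t 1, t 2, t 3})"
    by (intro tileable_Un S1 S2 S3 tt) (use S1 S2 S3 x xin tW dis in auto)
  moreover have "insert x S1 \<union> insert y S2 \<union> insert z S3 \<union> {t 1, t 2, t 3} = ?B \<union> {x, y, z}" by auto
  moreover have "?B \<inter> W = {}" using S1 S2 S3 tW by auto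
  moreover have "card ?B \<le> 18"
  proof -
    have "?B = {t 1, t 2, t 3} \<union> S1 \<union> S2 \<union> S3" by auto
    then show ?thesis
      using card_Un_le[of "{t 1, t 2, t 3} \<union> S1 \<union> S2" S3] card_Un_le[of "{t 1, t 2, t 3} \<union> S1" S2]
        card_Un_le[of "{t 1, t 2, t 3}" S1] c3 S1(1) S2(1) S3(1) by simp
  qed
  moreover have "finite ?B" using S1 S2 S3 by auto
  ultimately show ?thesis by (intro exI[of _ ?B]) simp
qed

text \<open>The absorbers are disjoint although triples in \<open>Q\<close> may share vertices: of
  one family, at most one triple is ever absorbed.\<close>

lemma absorber_family:
  assumes \<tau>: "0 < \<tau>" "\<tau> \<le> 1/20" and \<epsilon>: "12 * \<epsilon> \<le> \<tau> * \<tau>"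
    and not_sparse: "\<not> sparse (20 * \<tau>)"
    and "finite Q" "Q \<subseteq> (V 1 \<inter> W) \<times> (V 2 \<inter> W) \<times> (V 3 \<inter> W)"
    and "finite W" "real (card W) + 18 * real (card Q) + 40 \<le> \<tau> * \<tau> / 4 * real N"
  shows "\<exists>B. (\<forall>q\<in>Q. finite (B q) \<and> card (B q) \<le> 18 \<and> B q \<inter> W = {} \<and> tb (B q)
     \<and> tb (B q \<union> {fst q, fst (snd q), snd (snd q)})) \<and> disjoint_family_on B Q"
  using assms(5-)
proof (induction Q)
  case empty
  then show ?case by (simp add: disjoint_family_on_def)
next
  case (insert q Q)
  then have "\<exists>B. (\<forall>q\<in>Q. finite (B q) \<and> card (B q) \<le> 18 \<and> B q \<inter> W = {} \<and> tb (B q)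
     \<and> tb (B q \<union> {fst q, fst (snd q), snd (snd q)})) \<and> disjoint_family_on B Q" by auto
  then obtain B where B: "\<And>q. q \<in> Q \<Longrightarrow> finite (B q) \<and> card (B q) \<le> 18 \<and> B q \<inter> W = {} \<and> tb (B q)
     \<and> tb (B q \<union> {fst q, fst (snd q), snd (snd q)})" "disjoint_family_on B Q" by blast
  have "card (\<Union>(B ` Q)) \<le> (\<Sum>q\<in>Q. card (B q))" by (rule card_UN_le[OF insert.hyps(1)])
  also have "\<dots> \<le> (\<Sum>q\<in>Q. 18)" by (rule sum_mono) (use B in auto)
  finally have "card (W \<union> \<Union>(B ` Q)) \<le> card W + 18 * card Q"
    using card_Un_le[of W "\<Union>(B ` Q)"] by simp
  then have W': "real (card (W \<union> \<Union>(B ` Q))) + 40 \<le> \<tau> * \<tau> / 4 * real N"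
    using insert.prems(3) insert.hyps by simp
  have fW': "finite (W \<union> \<Union>(B ` Q))" using insert.prems insert.hyps B by auto
  have "\<exists>A. finite A \<and> card A \<le> 18 \<and> A \<inter> (W \<union> \<Union>(B ` Q)) = {} \<and> tb A \<and> tb (A \<union> {fst q, fst (snd q), snd (snd q)})"
    by (rule absorber[OF \<tau> \<epsilon> not_sparse _ _ _ _ fW' W']) (use insert.prems(1) in auto)
  then obtain A where A: "finite A" "card A \<le> 18" "A \<inter> (W \<union> \<Union>(B ` Q)) = {}" "tb A"
    "tb (A \<union> {fst q, fst (snd q), snd (snd q)})" by blast
  have "disjoint_family_on (B(q := A)) (insert q Q)"
  proof -
    have "A \<inter> B p = {}" if "p \<in> Q" for p using A(3) that by blast
    moreover have "B p \<inter> B p' = {}" if "p \<in> Q" "p' \<in> Q" "p \<noteq> p'" for p p'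
      using B(2) that by (simp add: disjoint_family_on_def)
    ultimately show ?thesis
      using insert.hyps(2) unfolding disjoint_family_on_def by (simp add: Int_commute)
  qed
  moreover have "\<forall>p\<in>insert q Q. finite ((B(q := A)) p) \<and> card ((B(q := A)) p) \<le> 18 \<and> (B(q := A)) p \<inter> W = {}
     \<and> tb ((B(q := A)) p) \<and> tb ((B(q := A)) p \<union> {fst p, fst (snd p), snd (snd p)})"
    using A B(1) insert.hyps by auto
  ultimately show ?case by blast
qed

text \<open>The basic exchange, used for absorption as well as for stuck pairs: \<open>t i\<close>
  is released while the covering of the other two classes stays the same.\<close>

lemma tiling_swap:
  assumes idx: "all_idx i j l" and T: "til T" "t \<in> T" and x: "x \<in> V i" "x \<notin> cov T i"
    and adj: "adj x (t j)" "adj x (t l)"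
  shows "til (insert (t(i := x)) (T - {t}))" "card (insert (t(i := x)) (T - {t})) = card T"
    "cov (insert (t(i := x)) (T - {t})) i = insert x (cov T i - {t i})"
    "cov (insert (t(i := x)) (T - {t})) j = cov T j"
    "cov (insert (t(i := x)) (T - {t})) l = cov T l"
proof -
  note D = all_idxD[OF idx]
  let ?t = "t(i := x)"
  have tt: "tile V adj t" using tilingD(2)[OF T] .
  have t': "tile V adj ?t"
  proof -
    have "t j \<in> V j" "t l \<in> V l" "adj (t j) (t l)" "adj (t l) (t j)"
      using tileD(1)[OF tt D(2)] tileD(1)[OF tt D(3)] tileD(2)[OF tt D(2,3,6)]
        tileD(2)[OF tt D(3,2) D(6)[symmetric]] .
    then show ?thesis
      using adj adj[THEN sym] x(1) D(4-6) unfolding tile_def D(7) by simp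
  qed
  have new: "?t m = t m \<or> ?t m \<notin> cov T m" if "m \<in> {1,2,3}" for m
    using x that by auto
  have R: "cov (insert ?t (T - {t})) m = insert (?t m) (cov T m - {t m})" if "m \<in> {1,2,3}" for m
    using tiling_replace(3)[OF T t' new that] .
  show "til (insert ?t (T - {t}))" "card (insert ?t (T - {t})) = card T"
    using tiling_replace(1,2)[OF T t' new] by blast+
  have tc: "t m \<in> cov T m" for m using T by (auto simp: cov_def)
  show "cov (insert ?t (T - {t})) i = insert x (cov T i - {t i})" using R[OF D(1)] by simp
  show "cov (insert ?t (T - {t})) j = cov T j" using R[OF D(2)] tc[of j] D(4) by auto
  show "cov (insert ?t (T - {t})) l = cov T l" using R[OF D(3)] tc[of l] D(5) by auto
qed

lemma tileable_swap:
  assumes idx: "all_idx i j l" and T: "til T" "t \<in> T" and x: "x \<in> V i" "x \<notin> verts T"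
    and adj: "adj x (t j)" "adj x (t l)"
  shows "tb (insert x (verts T - {t i}))"
proof -
  note D = all_idxD[OF idx]
  have x': "x \<notin> cov T i" using x(2) D(1) by (auto simp: verts_def)
  note R = tiling_swap[OF idx T x(1) x' adj]
  have "t i \<in> V i" using tileD(1)[OF tilingD(2)[OF T] D(1)] .
  then have ti: "t i \<notin> cov T j" "t i \<notin> cov T l"
    using cov_sub[OF T(1) D(2)] cov_sub[OF T(1) D(3)] idx_disjoint[OF idx] by blast+
  have "verts (insert (t(i := x)) (T - {t})) = insert x (verts T - {t i})"
    unfolding verts_def D(7) using R(3-5) ti by auto
  then show ?thesis using R(1) unfolding tileable_def by blast
qed

text \<open>An outside vertex \<open>x\<close> of class \<open>i\<close> is traded, inside a logarithmic family of triangles dominating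
  that class, for a vertex of the family. This leaves so few possible leftover triples that each of them
  can have its own absorber.\<close>

lemma absorb_triple:
  assumes \<tau>: "0 < \<tau>" "\<tau> \<le> 1/20" and \<epsilon>: "12 * \<epsilon> \<le> \<tau> * \<tau>"
    and not_sparse: "\<not> sparse (20 * \<tau>)"
    and m: "(9/10) ^ m * real N < 1"
    and W: "finite W" "real (card W) + real (9 * m + 18 * m ^ 3) + 40 \<le> \<tau> * \<tau> / 4 * real N"
  shows "\<exists>A. finite A \<and> A \<inter> W = {} \<and> card A \<le> 9 * m + 18 * m ^ 3 \<and> tb A \<and>
     (\<forall>x\<in>V 1 - A. \<forall>y\<in>V 2 - A. \<forall>z\<in>V 3 - A. tb (A \<union> {x, y, z}))"
proof -
  have small: "\<tau> * \<tau> / 4 * real N \<le> real N / 100"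
  proof -
    have "\<tau> * \<tau> / 4 \<le> 1/20 * (1/20) / 4" using \<tau> by (intro divide_right_mono mult_mono) auto
    then have "\<tau> * \<tau> / 4 \<le> 1/100" by simp
    then have "\<tau> * \<tau> / 4 * real N \<le> 1/100 * real N" by (rule mult_right_mono) simp
    then show ?thesis by simp
  qed
  \<comment> \<open>The term \<open>6 * m\<close> leaves room for the vertices of two dominating
    tilings chosen earlier, which must be avoided.\<close>
  have dominate: "\<exists>T. til T \<and> card T \<le> m \<and> verts T \<inter> W' = {} \<and>
      (\<forall>u\<in>V i. \<exists>t\<in>T. adj u (t j) \<and> adj u (t l))"
    if idx: "all_idx i j l" and W': "finite W'" "card W' \<le> card W + 6 * m" for i j l W'
  proof -
    have "real (card W') + 3 * real m \<le> real N / 100" proof -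
      have "real (card W') \<le> real (card W) + 6 * real m" using W'(2) by linarith
      moreover have "real (9 * m + 18 * m ^ 3) = 9 * real m + 18 * real m ^ 3" "0 \<le> real m ^ 3" by simp_all
      ultimately show ?thesis using W(2) small by linarith
    qed
    then obtain T where T: "til T" "card T \<le> m" "verts T \<inter> W' = {}"
      "real (card {u \<in> V i. \<not> (\<exists>t\<in>T. adj u (t j) \<and> adj u (t l))}) \<le> (9/10) ^ m * real N"
      using dominating_tiling[OF idx W'(1)] by blast
    then have "card {u \<in> V i. \<not> (\<exists>t\<in>T. adj u (t j) \<and> adj u (t l))} = 0" using m by linarith
    then have "{u \<in> V i. \<not> (\<exists>t\<in>T. adj u (t j) \<and> adj u (t l))} = {}"
      using fin[OF all_idxD(1)[OF idx]] by simp
    then show ?thesis using T by blast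
  qed
  obtain T1 where T1: "til T1" "card T1 \<le> m" "verts T1 \<inter> W = {}"
    "\<And>u. u \<in> V 1 \<Longrightarrow> \<exists>t\<in>T1. adj u (t 2) \<and> adj u (t 3)"
    using dominate[OF all_idx_instances(1) W(1)] by auto
  have c1: "card (W \<union> verts T1) \<le> card W + 3 * m"
    using card_Un_le[of W "verts T1"] card_verts_le[OF T1(1)] T1(2) by linarith
  have f1: "finite (W \<union> verts T1)" using W finite_verts[OF T1(1)] by simp
  obtain T2 where T2: "til T2" "card T2 \<le> m" "verts T2 \<inter> (W \<union> verts T1) = {}"
    "\<And>u. u \<in> V 2 \<Longrightarrow> \<exists>t\<in>T2. adj u (t 1) \<and> adj u (t 3)"
    using dominate[OF all_idx_instances(2) f1] c1 by auto
  have c2: "card (W \<union> verts T1 \<union> verts T2) \<le> card W + 6 * m"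
    using card_Un_le[of "W \<union> verts T1" "verts T2"] card_verts_le[OF T2(1)] T2(2) c1 by linarith
  have f2: "finite (W \<union> verts T1 \<union> verts T2)" using f1 finite_verts[OF T2(1)] by simp
  obtain T3 where T3: "til T3" "card T3 \<le> m" "verts T3 \<inter> (W \<union> verts T1 \<union> verts T2) = {}"
    "\<And>u. u \<in> V 3 \<Longrightarrow> \<exists>t\<in>T3. adj u (t 1) \<and> adj u (t 2)"
    using dominate[OF all_idx_instances(3) f2] c2 by auto
  define W3 where "W3 = W \<union> verts T1 \<union> verts T2 \<union> verts T3"
  have c3: "card W3 \<le> card W + 9 * m"
    using card_Un_le[of "W \<union> verts T1 \<union> verts T2" "verts T3"] card_verts_le[OF T3(1)] T3(2) c2
    unfolding W3_def by linarith
  have f3: "finite W3" using f2 finite_verts[OF T3(1)] by (simp add: W3_def)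
  define Q where "Q = cov T1 1 \<times> cov T2 2 \<times> cov T3 3"
  have cQ: "card Q \<le> m ^ 3"
  proof -
    have "card Q = card T1 * (card T2 * card T3)"
      unfolding Q_def card_cartesian_product using card_cov[OF T1(1)] card_cov[OF T2(1)] card_cov[OF T3(1)] by simp
    also have "\<dots> \<le> m * (m * m)" using T1(2) T2(2) T3(2) by (intro mult_le_mono) auto
    finally show ?thesis by (simp add: power3_eq_cube)
  qed
  have fQ: "finite Q" unfolding Q_def cov_def using tilingD(1)[OF T1(1)] tilingD(1)[OF T2(1)] tilingD(1)[OF T3(1)] by simp
  have QV: "Q \<subseteq> (V 1 \<inter> W3) \<times> (V 2 \<inter> W3) \<times> (V 3 \<inter> W3)"
    unfolding Q_def using cov_verts[OF T1(1), of 1] cov_verts[OF T2(1), of 2] cov_verts[OF T3(1), of 3]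
    by (auto simp: W3_def)
  have "18 * card Q \<le> 18 * m ^ 3" "card W3 \<le> card W + 9 * m" using cQ c3 by auto
  then have "real (card W3) + 18 * real (card Q) + 40 \<le> \<tau> * \<tau> / 4 * real N" using W(2) by linarith
  then obtain B where B: "\<And>q. q \<in> Q \<Longrightarrow> finite (B q) \<and> card (B q) \<le> 18 \<and> B q \<inter> W3 = {} \<and> tb (B q)
     \<and> tb (B q \<union> {fst q, fst (snd q), snd (snd q)})" "disjoint_family_on B Q"
    using absorber_family[OF \<tau> \<epsilon> not_sparse fQ QV f3] by blast
  define A where "A = verts T1 \<union> verts T2 \<union> verts T3 \<union> \<Union>(B ` Q)"
  have tbT: "tb (verts T1)" "tb (verts T2)" "tb (verts T3)"
    using T1(1) T2(1) T3(1) unfolding tileable_def by blast+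
  have BW: "\<Union>(B ` Q) \<inter> W3 = {}" using B(1) by blast
  have dT: "verts T1 \<inter> verts T2 = {}" "verts T1 \<inter> verts T3 = {}" "verts T2 \<inter> verts T3 = {}"
    using T2(3) T3(3) by auto
  have "tb A" unfolding A_def
    by (intro tileable_Un tbT tileable_UN fQ B(2)) (use B(1) BW dT in \<open>auto simp: W3_def\<close>)
  moreover have "finite A"
    using \<open>tb A\<close> by (rule tileable_finite)
  moreover have "A \<inter> W = {}" using T1(3) T2(3) T3(3) BW by (auto simp: A_def W3_def)
  moreover have "card A \<le> 9 * m + 18 * m ^ 3"
  proof -
    have "card (\<Union>(B ` Q)) \<le> (\<Sum>q\<in>Q. card (B q))" by (rule card_UN_le[OF fQ])
    also have "\<dots> \<le> (\<Sum>q\<in>Q. 18)" by (rule sum_mono) (use B in auto)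
    finally have "card (\<Union>(B ` Q)) \<le> 18 * m ^ 3" using cQ by simp
    then show ?thesis unfolding A_def
      using card_Un_le[of "verts T1 \<union> verts T2 \<union> verts T3" "\<Union>(B ` Q)"] card_Un_le[of "verts T1 \<union> verts T2" "verts T3"]
        card_Un_le[of "verts T1" "verts T2"] card_verts_le[OF T1(1)] card_verts_le[OF T2(1)] card_verts_le[OF T3(1)]
        T1(2) T2(2) T3(2) by linarith
  qed
  moreover have "tb (A \<union> {x, y, z})" if x: "x \<in> V 1 - A" "y \<in> V 2 - A" "z \<in> V 3 - A" for x y z
  proof -
    obtain t1 where t1: "t1 \<in> T1" "adj x (t1 2)" "adj x (t1 3)" using T1(4)[of x] x by auto
    obtain t2 where t2: "t2 \<in> T2" "adj y (t2 1)" "adj y (t2 3)" using T2(4)[of y] x by auto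
    obtain t3 where t3: "t3 \<in> T3" "adj z (t3 1)" "adj z (t3 2)" using T3(4)[of z] x by auto
    \<comment> \<open>The three swaps release a triple from \<open>Q\<close>, so its own absorber
      takes it in while every other absorber is tiled by itself.\<close>
    let ?q = "(t1 1, t2 2, t3 3)"
    have q: "?q \<in> Q" using t1 t2 t3 by (auto simp: Q_def cov_def)
    have qV: "t1 1 \<in> verts T1" "t2 2 \<in> verts T2" "t3 3 \<in> verts T3"
      using t1 t2 t3 by (auto simp: verts_def cov_def)
    have S1: "tb (insert x (verts T1 - {t1 1}))"
      by (rule tileable_swap[OF all_idx_instances(1) T1(1) t1(1)]) (use x t1 in \<open>auto simp: A_def\<close>)
    have S2: "tb (insert y (verts T2 - {t2 2}))"
      by (rule tileable_swap[OF all_idx_instances(2) T2(1) t2(1)]) (use x t2 in \<open>auto simp: A_def\<close>)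
    have S3: "tb (insert z (verts T3 - {t3 3}))"
      by (rule tileable_swap[OF all_idx_instances(3) T3(1) t3(1)]) (use x t3 in \<open>auto simp: A_def\<close>)
    have S4: "tb (B ?q \<union> {t1 1, t2 2, t3 3})" using B(1)[OF q] by simp
    have S5: "tb (\<Union>(B ` (Q - {?q})))"
      by (rule tileable_UN) (use fQ B disjoint_family_on_mono[OF _ B(2), of "Q - {?q}"] in auto)
    have BB: "B ?q \<inter> \<Union>(B ` (Q - {?q})) = {}"
      using B(2) q unfolding disjoint_family_on_def by blast
    have dis: "V 1 \<inter> V 2 = {}" "V 1 \<inter> V 3 = {}" "V 2 \<inter> V 3 = {}" using idx_disjoint[OF all_idx_instances(1)] by auto
    have xyz: "x \<noteq> y" "x \<noteq> z" "y \<noteq> z" using x dis by auto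
    have nA: "x \<notin> A" "y \<notin> A" "z \<notin> A" using x by auto
    have qB: "B ?q \<subseteq> \<Union>(B ` Q)" "\<Union>(B ` (Q - {?q})) \<subseteq> \<Union>(B ` Q)" using q by auto
    have Bsplit: "\<Union>(B ` Q) = B ?q \<union> \<Union>(B ` (Q - {?q}))" using q by auto
    define Bq where "Bq = B ?q"
    define Br where "Br = \<Union>(B ` (Q - {?q}))"
    have A': "A = verts T1 \<union> verts T2 \<union> verts T3 \<union> Bq \<union> Br" unfolding A_def Bsplit Bq_def Br_def by blast
    have dB: "Bq \<inter> Br = {}" "Bq \<inter> verts T1 = {}" "Bq \<inter> verts T2 = {}" "Bq \<inter> verts T3 = {}"
       "Br \<inter> verts T1 = {}" "Br \<inter> verts T2 = {}" "Br \<inter> verts T3 = {}"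
    proof -
      show "Bq \<inter> Br = {}" using BB by (simp add: Bq_def Br_def)
      have "Bq \<inter> W3 = {}" "Br \<inter> W3 = {}" using BW qB unfolding Bq_def Br_def by blast+
      then show "Bq \<inter> verts T1 = {}" "Bq \<inter> verts T2 = {}" "Bq \<inter> verts T3 = {}"
        "Br \<inter> verts T1 = {}" "Br \<inter> verts T2 = {}" "Br \<inter> verts T3 = {}" by (auto simp: W3_def)
    qed
    have "tb (insert x (verts T1 - {t1 1}) \<union> insert y (verts T2 - {t2 2}) \<union> insert z (verts T3 - {t3 3})
       \<union> (Bq \<union> {t1 1, t2 2, t3 3}) \<union> Br)"
    proof (intro tileable_Un[OF _ S5[folded Br_def]] tileable_Un[OF _ S4[folded Bq_def]]
        tileable_Un[OF _ S3] tileable_Un[OF S1 S2])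
      have x': "x \<notin> verts T1" "x \<notin> verts T2" "x \<notin> verts T3" "x \<notin> Bq" "x \<notin> Br"
        "y \<notin> verts T1" "y \<notin> verts T2" "y \<notin> verts T3" "y \<notin> Bq" "y \<notin> Br"
        "z \<notin> verts T1" "z \<notin> verts T2" "z \<notin> verts T3" "z \<notin> Bq" "z \<notin> Br"
        using nA[unfolded A'] by auto
      note f = x' xyz qV dT dB
      show "insert x (verts T1 - {t1 1}) \<inter> insert y (verts T2 - {t2 2}) = {}" using f by auto
      show "(insert x (verts T1 - {t1 1}) \<union> insert y (verts T2 - {t2 2})) \<inter> insert z (verts T3 - {t3 3}) = {}"
        using f by auto
      show "(insert x (verts T1 - {t1 1}) \<union> insert y (verts T2 - {t2 2}) \<union> insert z (verts T3 - {t3 3}))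
          \<inter> (Bq \<union> {t1 1, t2 2, t3 3}) = {}" using f by auto
      show "(insert x (verts T1 - {t1 1}) \<union> insert y (verts T2 - {t2 2}) \<union> insert z (verts T3 - {t3 3})
          \<union> (Bq \<union> {t1 1, t2 2, t3 3})) \<inter> Br = {}" using f by auto
    qed
    moreover have "insert x (verts T1 - {t1 1}) \<union> insert y (verts T2 - {t2 2}) \<union> insert z (verts T3 - {t3 3})
       \<union> (Bq \<union> {t1 1, t2 2, t3 3}) \<union> Br = A \<union> {x, y, z}"
      unfolding A' using qV by blast
    ultimately show ?thesis by simp
  qed
  ultimately show ?thesis by blast
qed

text \<open>\<open>A\<close> is the union of \<open>k\<close> disjoint sets from
  \<open>absorb_triple\<close>, each able to take in one vertex per class. If fewer than
  \<open>k\<close> vertices per class arrive, the sets left idle are tiled on their own.\<close>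

lemma absorbing_set:
  assumes \<tau>: "0 < \<tau>" "\<tau> \<le> 1/20" and \<epsilon>: "12 * \<epsilon> \<le> \<tau> * \<tau>"
    and not_sparse: "\<not> sparse (20 * \<tau>)"
    and m: "(9/10) ^ m * real N < 1"
    and K: "K = 9 * m + 18 * m ^ 3"
    and big: "real (k * K) + 40 \<le> \<tau> * \<tau> / 4 * real N"
  shows "\<exists>A. card A \<le> k * K \<and> tb A \<and>
     (\<forall>L c. L \<subseteq> V 1 \<union> V 2 \<union> V 3 - A \<and> c \<le> k \<and> (\<forall>i\<in>{1,2,3}. card (L \<inter> V i) = c) \<longrightarrow> tb (A \<union> L))"
  using big
proof (induction k)
  case 0
  have "L = {}" if "L \<subseteq> V 1 \<union> V 2 \<union> V 3" "\<forall>i\<in>{1,2,3}. card (L \<inter> V i) = 0" for L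
  proof -
    have "L \<inter> V i = {}" if "i \<in> {1,2,3}" for i using that fin[OF that] \<open>\<forall>i\<in>{1,2,3}. card (L \<inter> V i) = 0\<close>
      by (metis card_0_eq finite_Int)
    from this[of 1] this[of 2] this[of 3] show ?thesis using \<open>L \<subseteq> V 1 \<union> V 2 \<union> V 3\<close> by auto
  qed
  then have "tb ({} \<union> L)" if "L \<subseteq> V 1 \<union> V 2 \<union> V 3 - {}" "c \<le> 0" "\<forall>i\<in>{1,2,3}. card (L \<inter> V i) = c" for L c
    using that tileable_empty by (metis Diff_empty Un_empty le_zero_eq)
  then show ?case by (intro exI[of _ "{}"]) (simp add: tileable_empty)
next
  case (Suc k)
  then obtain A where A: "card A \<le> k * K" "tb A"
     "\<And>L c. L \<subseteq> V 1 \<union> V 2 \<union> V 3 - A \<Longrightarrow> c \<le> k \<Longrightarrow> \<forall>i\<in>{1,2,3}. card (L \<inter> V i) = c \<Longrightarrow> tb (A \<union> L)"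
    by auto
  have fA: "finite A" using tileable_finite[OF A(2)] .
  have "real (card A) + real K + 40 \<le> \<tau> * \<tau> / 4 * real N"
  proof -
    have "card A + K \<le> Suc k * K" using A(1) by simp
    then have "real (card A) + real K \<le> real (Suc k * K)" by linarith
    then show ?thesis using Suc.prems by linarith
  qed
  then obtain A' where A': "finite A'" "A' \<inter> A = {}" "card A' \<le> K" "tb A'"
     "\<And>x y z. x \<in> V 1 - A' \<Longrightarrow> y \<in> V 2 - A' \<Longrightarrow> z \<in> V 3 - A' \<Longrightarrow> tb (A' \<union> {x, y, z})"
    using absorb_triple[OF \<tau> \<epsilon> not_sparse m fA] unfolding K by blast
  have "tb (A \<union> A' \<union> L)"
    if L: "L \<subseteq> V 1 \<union> V 2 \<union> V 3 - (A \<union> A')" "c \<le> Suc k" "\<forall>i\<in>{1,2,3}. card (L \<inter> V i) = c" for L c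
  proof (cases "c \<le> k")
    case True
    have "tb (A \<union> L)" by (rule A(3)[OF _ True]) (use L in auto)
    then have "tb (A \<union> L \<union> A')" by (rule tileable_Un[OF _ A'(4)]) (use L A'(2) in auto)
    moreover have "A \<union> L \<union> A' = A \<union> A' \<union> L" by auto
    ultimately show ?thesis by simp
  next
    case False
    then have c: "c = Suc k" using L by simp
    have ne: "\<exists>x. x \<in> L \<inter> V i" if "i \<in> {1,2,3}" for i using L(3) that c by (metis card.empty ex_in_conv nat.distinct(1))
    obtain x y z where xyz: "x \<in> L \<inter> V 1" "y \<in> L \<inter> V 2" "z \<in> L \<inter> V 3"
      using ne[of 1] ne[of 2] ne[of 3] by auto
    have dis: "V 1 \<inter> V 2 = {}" "V 1 \<inter> V 3 = {}" "V 2 \<inter> V 3 = {}" using idx_disjoint[OF all_idx_instances(1)] by auto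
    let ?L = "L - {x, y, z}"
    have "?L \<inter> V 1 = L \<inter> V 1 - {x}" "?L \<inter> V 2 = L \<inter> V 2 - {y}" "?L \<inter> V 3 = L \<inter> V 3 - {z}"
      using xyz dis by auto
    then have "\<forall>i\<in>{1,2,3}. card (?L \<inter> V i) = k" using L(3) c xyz by (simp add: card_Diff_singleton)
    then have "tb (A \<union> ?L)" by (intro A(3)[of ?L k]) (use L in auto)
    moreover have "tb (A' \<union> {x, y, z})" by (rule A'(5)) (use xyz L in auto)
    ultimately have "tb ((A \<union> ?L) \<union> (A' \<union> {x, y, z}))" by (rule tileable_Un) (use A'(2) L xyz in auto)
    moreover have "(A \<union> ?L) \<union> (A' \<union> {x, y, z}) = A \<union> A' \<union> L" using xyz by auto
    ultimately show ?thesis by simp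
  qed
  moreover have "tb (A \<union> A')" by (rule tileable_Un[OF A(2) A'(4)]) (use A'(2) in auto)
  moreover have "card (A \<union> A') \<le> Suc k * K" using card_Un_le[of A A'] A(1) A'(3) by simp
  ultimately show ?case by (intro exI[of _ "A \<union> A'"]) blast
qed

end

section \<open>Almost covering tilings\<close>

context tripartite
begin

text \<open>The vertices of \<open>P\<close> are reserved. A stuck pair \<open>x\<close>, \<open>y\<close> stays stuck under swaps, which is what
  all non-adjacencies below are derived from.\<close>

definition stuck :: "nat \<Rightarrow> nat \<Rightarrow> (nat \<Rightarrow> 'a) set \<Rightarrow> 'a set \<Rightarrow> 'a \<Rightarrow> 'a \<Rightarrow> bool" where
  "stuck i j T P x y \<longleftrightarrow> til T \<and> finite P \<and> card P \<le> 12 \<and> P \<inter> verts T = {} \<and>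
     x \<in> V i - cov T i - P \<and> y \<in> V j - cov T j - P \<and>
     (\<forall>T' u w. til T' \<and> card T' = card T \<and> P \<inter> verts T' = {} \<and>
        u \<in> V i - cov T' i - P \<and> w \<in> V j - cov T' j - P \<longrightarrow> \<not> adj u w)"

lemma stuck_sym: "stuck i j T P x y \<Longrightarrow> stuck j i T P y x"
  unfolding stuck_def using adj_commute by blast

lemma stuck_nonadj: "stuck i j T P x y \<Longrightarrow> \<not> adj x y"
  unfolding stuck_def by blast

lemma stuck_other: "stuck i j T P x y \<Longrightarrow> w \<in> V j - cov T j - P \<Longrightarrow> stuck i j T P x w"
  unfolding stuck_def by blast

lemma stuckD:
  assumes "stuck i j T P x y"
  shows "til T" "finite P" "card P \<le> 12" "P \<inter> verts T = {}" "x \<in> V i" "x \<notin> cov T i" "x \<notin> P"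
    "y \<in> V j" "y \<notin> cov T j" "y \<notin> P"
  using assms unfolding stuck_def by blast+

text \<open>The last clause of \<open>stuck\<close> ranges over all tilings of the same size that
  avoid \<open>P\<close>, so it survives the swap; what changes is the outside vertex on display,
  now the released \<open>t i\<close>.\<close>

lemma stuck_swap:
  assumes S: "stuck i j T P x y" and idx: "all_idx i j l" and t: "t \<in> T" "adj x (t j)" "adj x (t l)"
  shows "stuck i j (insert (t(i := x)) (T - {t})) P (t i) y"
proof -
  note D = all_idxD[OF idx] and S' = stuckD[OF S]
  let ?T = "insert (t(i := x)) (T - {t})"
  note R = tiling_swap[OF idx S'(1) t(1) S'(5,6) t(2,3)]
  have "verts ?T \<subseteq> insert x (verts T)" unfolding verts_def D(7) using R(3-5) by auto
  then have P: "P \<inter> verts ?T = {}" using S'(4,7) by auto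
  have tc: "t i \<in> cov T i" using t by (auto simp: cov_def)
  have "t i \<in> V i" using tileD(1)[OF tilingD(2)[OF S'(1) t(1)] D(1)] .
  moreover have "t i \<notin> cov ?T i" using R(3) tc S'(6) by auto
  moreover have "t i \<notin> P" using tc S'(4) D(1) by (auto simp: verts_def)
  moreover have "y \<notin> cov ?T j" using R(4) S'(9) by simp
  ultimately have mem: "t i \<in> V i - cov ?T i - P" "y \<in> V j - cov ?T j - P" using S'(8,10) by auto
  have "\<forall>T' u w. til T' \<and> card T' = card ?T \<and> P \<inter> verts T' = {} \<and>
        u \<in> V i - cov T' i - P \<and> w \<in> V j - cov T' j - P \<longrightarrow> \<not> adj u w"
    using S unfolding stuck_def R(2) by (elim conjE)
  then show ?thesis using R(1) S'(2,3) P mem unfolding stuck_def by (intro conjI)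
qed

text \<open>The class of \<open>x\<close> is the remaining one: such a tile stays a tile when
  \<open>x\<close> replaces its vertex there.\<close>

definition swaps :: "nat \<Rightarrow> nat \<Rightarrow> (nat \<Rightarrow> 'a) set \<Rightarrow> 'a \<Rightarrow> (nat \<Rightarrow> 'a) set" where
  "swaps j l T x = {t \<in> T. adj x (t j) \<and> adj x (t l)}"

lemma card_coord:
  assumes "til T" "m \<in> {1,2,3}" "S \<subseteq> T"
  shows "card ((\<lambda>t. t m) ` S) = card S"
  by (rule card_image[OF inj_on_subset[OF tilingD(3)[OF assms(1,2)] assms(3)]])

lemma coord_sub:
  assumes "til T" "m \<in> {1,2,3}" "S \<subseteq> T"
  shows "(\<lambda>t. t m) ` S \<subseteq> V m"
  using cov_sub[OF assms(1,2)] assms(3) by (auto simp: cov_def)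

text \<open>\<open>x\<close> has at most \<open>(1/3 + \<epsilon>) N\<close> non-neighbours in each
  other class. Those in \<open>V j\<close> include all uncovered unreserved vertices, which makes up
  for the tiles that \<open>T\<close> lacks; the at most twelve reserved vertices are paid for by
  \<open>20 \<le> \<epsilon> * N\<close>.\<close>

lemma swaps_lower:
  assumes S: "stuck i j T P x y" and idx: "all_idx i j l" and big: "20 \<le> \<epsilon> * real N"
  shows "(1/3 - 3 * \<epsilon>) * real N \<le> real (card (swaps j l T x))"
proof -
  note D = all_idxD[OF idx] and S' = stuckD[OF S]
  define a where "a = {t \<in> T. \<not> adj x (t j)}"
  define b where "b = {t \<in> T. \<not> adj x (t l)}"
  define Y where "Y = V j - cov T j - P"
  have fT: "finite T" using tilingD(1)[OF S'(1)] .
  have "real (card ((\<lambda>t. t l) ` b)) \<le> (1/3 + \<epsilon>) * real N"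
    by (rule non_nbrs[OF D(1,3,5) S'(5)]) (use coord_sub[OF S'(1) D(3)] in \<open>auto simp: b_def\<close>)
  then have b: "real (card b) \<le> (1/3 + \<epsilon>) * real N"
    using card_coord[OF S'(1) D(3), of b] by (auto simp: b_def)
  have "real (card ((\<lambda>t. t j) ` a \<union> Y)) \<le> (1/3 + \<epsilon>) * real N"
    by (rule non_nbrs[OF D(1,2,4) S'(5)])
      (use coord_sub[OF S'(1) D(2)] stuck_nonadj[OF stuck_other[OF S]] in \<open>auto simp: a_def Y_def\<close>)
  moreover have "card ((\<lambda>t. t j) ` a \<union> Y) = card ((\<lambda>t. t j) ` a) + card Y"
    by (rule card_Un_disjoint) (use fT fin[OF D(2)] in \<open>auto simp: a_def Y_def cov_def\<close>)
  ultimately have a: "real (card a) + real (card Y) \<le> (1/3 + \<epsilon>) * real N"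
    using card_coord[OF S'(1) D(2), of a] by (auto simp: a_def)
  have "card (V j - cov T j) = N - card T"
    using card_Diff_subset[OF _ cov_sub[OF S'(1) D(2)]] card_V[OF D(2)] card_cov[OF S'(1) D(2)] fT
    by (simp add: cov_def)
  moreover have "card (V j - cov T j) \<le> card Y + card P"
    unfolding Y_def using S'(2) by (metis diff_card_le_card_Diff le_diff_conv)
  moreover have "card T \<le> N" using card_cov[OF S'(1) D(2)] card_sub[OF D(2) cov_sub[OF S'(1) D(2)]] by simp
  ultimately have Y: "real N - real (card T) \<le> real (card Y) + 12" using S'(3) by linarith
  have "T \<subseteq> swaps j l T x \<union> a \<union> b" by (auto simp: swaps_def a_def b_def)
  then have "card T \<le> card (swaps j l T x \<union> a \<union> b)" by (rule card_mono[rotated]) (use fT in \<open>auto simp: swaps_def a_def b_def\<close>)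
  also have "\<dots> \<le> card (swaps j l T x) + card a + card b"
    using card_Un_le[of "swaps j l T x \<union> a" b] card_Un_le[of "swaps j l T x" a] by linarith
  finally have "real (card T) \<le> real (card (swaps j l T x)) + real (card a) + real (card b)" by linarith
  then show ?thesis using a b Y big by (simp add: algebra_simps)
qed

text \<open>Swapping \<open>x\<close> into \<open>t\<close> and \<open>y\<close> into
  \<open>s\<close> releases \<open>t i\<close> and \<open>s j\<close>, again a stuck pair;
  \<open>s \<noteq> t\<close> keeps the second tile intact.\<close>

lemma swaps_nonadj:
  assumes S: "stuck i j T P x y" and idx: "all_idx i j l"
    and t: "t \<in> swaps j l T x" and s: "s \<in> swaps i l T y" "s \<noteq> t"
  shows "\<not> adj (t i) (s j)"
proof -
  have "stuck i j (insert (t(i := x)) (T - {t})) P (t i) y"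
    by (rule stuck_swap[OF S idx]) (use t in \<open>auto simp: swaps_def\<close>)
  from stuck_swap[OF stuck_sym[OF this] all_idx_perm(2)[OF idx], of s] s
  have "stuck j i (insert (s(j := y)) (insert (t(i := x)) (T - {t}) - {s})) P (s j) (t i)"
    by (auto simp: swaps_def)
  then show ?thesis using stuck_nonadj adj_commute by blast
qed

text \<open>A chain of swaps: \<open>x\<close> enters \<open>t\<close>, the released
  \<open>t i\<close> enters \<open>t'\<close>, and \<open>y\<close> enters \<open>s\<close>.\<close>

lemma swaps_nonadj2:
  assumes S: "stuck i j T P x y" and idx: "all_idx i j l"
    and t: "t \<in> swaps j l T x" and t': "t' \<in> swaps j l T (t i)" "t' \<noteq> t"
    and s: "s \<in> swaps i l T y" "s \<noteq> t" "s \<noteq> t'"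
  shows "\<not> adj (t' i) (s j)"
proof -
  have "stuck i j (insert (t(i := x)) (T - {t})) P (t i) y"
    by (rule stuck_swap[OF S idx]) (use t in \<open>auto simp: swaps_def\<close>)
  then show ?thesis
    by (rule swaps_nonadj[OF _ idx]) (use t' s in \<open>auto simp: swaps_def\<close>)
qed

text \<open>The vertices \<open>t i\<close> released by \<open>x\<close> are non-neighbours of the
  single vertex \<open>s j\<close>; the extra \<open>1\<close> is for \<open>t = s\<close>.\<close>

lemma swaps_upper:
  assumes S: "stuck i j T P x y" and idx: "all_idx i j l" and s: "s \<in> swaps i l T y"
  shows "real (card (swaps j l T x)) \<le> (1/3 + \<epsilon>) * real N + 1"
proof -
  note D = all_idxD[OF idx] and S' = stuckD[OF S]
  have sT: "s \<in> T" using s by (simp add: swaps_def)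
  have sV: "s j \<in> V j" using tileD(1)[OF tilingD(2)[OF S'(1) sT] D(2)] .
  have sub: "swaps j l T x - {s} \<subseteq> T" by (auto simp: swaps_def)
  have "real (card ((\<lambda>t. t i) ` (swaps j l T x - {s}))) \<le> (1/3 + \<epsilon>) * real N"
  proof (rule non_nbrs[OF D(2,1) D(4)[symmetric] sV coord_sub[OF S'(1) D(1) sub]])
    fix u assume "u \<in> (\<lambda>t. t i) ` (swaps j l T x - {s})"
    then obtain t where "u = t i" "t \<in> swaps j l T x" "s \<noteq> t" by auto
    then show "\<not> adj (s j) u" using swaps_nonadj[OF S idx _ s] adj_commute by blast
  qed
  then have "real (card (swaps j l T x - {s})) \<le> (1/3 + \<epsilon>) * real N"
    using card_coord[OF S'(1) D(1) sub] by simp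
  moreover have "card (swaps j l T x) \<le> card (swaps j l T x - {s}) + 1"
    using diff_card_le_card_Diff[of "{s}" "swaps j l T x"] by simp
  ultimately show ?thesis by linarith
qed

text \<open>Let \<open>v\<close> be \<open>t i\<close>. In \<open>V j\<close> it misses the vertices
  of the tiles in \<open>Dy\<close>, about a third, so few other tiles have a class \<open>j\<close>
  vertex that it misses. The tiles that \<open>v\<close> can enter are nearly all in
  \<open>Dx\<close>, since a vertex \<open>s j\<close> from \<open>Dy\<close> misses the class
  \<open>i\<close> vertices of both kinds. A tile outside \<open>Dx\<close> and \<open>Dy\<close>
  whose class \<open>l\<close> vertex is adjacent to \<open>v\<close> belongs to one of these two
  exceptional sets. The uncovered vertices of \<open>V l\<close> are as many as those of
  \<open>V j\<close>, and the unreserved ones of the latter are missed by \<open>v\<close>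
  too.\<close>

lemma swaps_degree:
  assumes S: "stuck i j T P x y" and idx: "all_idx i j l" and big: "20 \<le> \<epsilon> * real N"
    and t: "t \<in> swaps j l T x"
  shows "real (card {w \<in> V l - (\<lambda>t. t l) ` (swaps j l T x \<union> swaps i l T y). adj (t i) w}) \<le> 9 * \<epsilon> * real N"
proof -
  note D = all_idxD[OF idx] and S' = stuckD[OF S]
  let ?N = "real N" and ?v = "t i"
  define Dx where "Dx = swaps j l T x"
  define Dy where "Dy = swaps i l T y"
  define Dv where "Dv = swaps j l T ?v"
  define Z where "Z = {s \<in> T - Dy. \<not> adj ?v (s j)}"
  define Y where "Y = V j - cov T j - P"
  have fT: "finite T" using tilingD(1)[OF S'(1)] .
  have subs: "Dx \<subseteq> T" "Dy \<subseteq> T" "Dv \<subseteq> T" "Z \<subseteq> T" by (auto simp: Dx_def Dy_def Dv_def Z_def swaps_def)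
  have fs: "finite Dx" "finite Dy" "finite Dv" "finite Z" "finite Y"
    using subs fT finite_subset fin[OF D(2)] by (auto simp: Y_def)
  have tT: "t \<in> T" using t by (simp add: swaps_def)
  have vV: "?v \<in> V i" using tileD(1)[OF tilingD(2)[OF S'(1) tT] D(1)] .
  have lowx: "(1/3 - 3 * \<epsilon>) * ?N \<le> real (card Dx)" unfolding Dx_def by (rule swaps_lower[OF S idx big])
  have lowy: "(1/3 - 3 * \<epsilon>) * ?N \<le> real (card Dy)"
    unfolding Dy_def by (rule swaps_lower[OF stuck_sym[OF S] all_idx_perm(2)[OF idx] big])
  have S1: "stuck i j (insert (t(i := x)) (T - {t})) P ?v y"
    by (rule stuck_swap[OF S idx]) (use t in \<open>auto simp: swaps_def\<close>)
  have covj: "cov (insert (t(i := x)) (T - {t})) j = cov T j"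
    by (rule tiling_swap(4)[OF idx S'(1) tT S'(5,6)]) (use t in \<open>auto simp: swaps_def\<close>)
  have nY: "\<not> adj ?v w" if "w \<in> Y" for w
    using stuck_nonadj[OF stuck_other[OF S1]] that covj by (simp add: Y_def)
  have sub2: "(Dy - {t}) \<union> Z \<subseteq> T" using subs by auto
  have "real (card ((\<lambda>s. s j) ` ((Dy - {t}) \<union> Z) \<union> Y)) \<le> (1/3 + \<epsilon>) * ?N"
  proof (rule non_nbrs[OF D(1,2,4) vV])
    show "(\<lambda>s. s j) ` ((Dy - {t}) \<union> Z) \<union> Y \<subseteq> V j"
      using coord_sub[OF S'(1) D(2) sub2] by (auto simp: Y_def)
    fix u assume "u \<in> (\<lambda>s. s j) ` ((Dy - {t}) \<union> Z) \<union> Y"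
    then show "\<not> adj ?v u" using nY swaps_nonadj[OF S idx t] by (auto simp: Z_def Dy_def)
  qed
  moreover have "card ((\<lambda>s. s j) ` ((Dy - {t}) \<union> Z) \<union> Y) = card ((Dy - {t}) \<union> Z) + card Y"
    unfolding card_coord[OF S'(1) D(2) sub2, symmetric]
    by (rule card_Un_disjoint) (use fs sub2 in \<open>auto simp: Y_def cov_def\<close>)
  moreover have "card ((Dy - {t}) \<union> Z) = card (Dy - {t}) + card Z"
    by (rule card_Un_disjoint) (use fs in \<open>auto simp: Z_def\<close>)
  moreover have "card Dy \<le> card (Dy - {t}) + 1"
    using diff_card_le_card_Diff[of "{t}" Dy] by simp
  ultimately have ZY: "real (card Z) + real (card Y) \<le> 4 * \<epsilon> * ?N + 1"
    using lowy by (simp add: algebra_simps)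
  have Npos: "20 * 1000 \<le> ?N"
  proof -
    have "\<epsilon> * ?N \<le> 1/1000 * ?N" using eps by (intro mult_right_mono) auto
    then show ?thesis using big by simp
  qed
  have "(1/4) * ?N \<le> (1/3 - 3 * \<epsilon>) * ?N" using eps by (intro mult_right_mono) auto
  then have "2 \<le> card Dy" using lowy Npos by linarith
  then have "\<not> Dy \<subseteq> {t}" using card_mono[of "{t}" Dy] by auto
  then obtain s where s: "s \<in> Dy" "s \<noteq> t" by auto
  have sV: "s j \<in> V j" using tileD(1)[OF tilingD(2)[OF S'(1)] D(2)] s subs by auto
  have sub3: "(Dv \<union> Dx) - {s, t} \<subseteq> T" using subs by auto
  have "real (card ((\<lambda>t. t i) ` ((Dv \<union> Dx) - {s, t}))) \<le> (1/3 + \<epsilon>) * ?N"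
  proof (rule non_nbrs[OF D(2,1) D(4)[symmetric] sV coord_sub[OF S'(1) D(1) sub3]])
    fix u assume "u \<in> (\<lambda>t. t i) ` ((Dv \<union> Dx) - {s, t})"
    then obtain t' where t': "u = t' i" "t' \<in> Dv \<union> Dx" "t' \<noteq> s" "t' \<noteq> t" by auto
    have "\<not> adj (t' i) (s j)"
    proof (cases "t' \<in> Dx")
      case True
      then show ?thesis using swaps_nonadj[OF S idx, of t' s] t' s by (auto simp: Dx_def Dy_def)
    next
      case False
      then show ?thesis using swaps_nonadj2[OF S idx t, of t' s] t' s by (auto simp: Dv_def Dy_def)
    qed
    then show "\<not> adj (s j) u" using t'(1) adj_commute by blast
  qed
  then have "real (card ((Dv \<union> Dx) - {s, t})) \<le> (1/3 + \<epsilon>) * ?N"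
    using card_coord[OF S'(1) D(1) sub3] by simp
  moreover have "card (Dv \<union> Dx) \<le> card ((Dv \<union> Dx) - {s, t}) + 2"
    using diff_card_le_card_Diff[of "{s, t}" "Dv \<union> Dx"] s by simp
  moreover have "card (Dv \<union> Dx) = card Dx + card (Dv - Dx)"
    using card_Un_disjoint[of Dx "Dv - Dx"] fs by (simp add: Un_commute)
  ultimately have Dv: "real (card (Dv - Dx)) \<le> 4 * \<epsilon> * ?N + 2" using lowx by (simp add: algebra_simps)
  define L where "L = V l - cov T l"
  have "card L = N - card T" unfolding L_def
    using card_Diff_subset[OF _ cov_sub[OF S'(1) D(3)]] card_V[OF D(3)] card_cov[OF S'(1) D(3)] fT
    by (simp add: cov_def)
  moreover have "card (V j - cov T j) = N - card T"
    using card_Diff_subset[OF _ cov_sub[OF S'(1) D(2)]] card_V[OF D(2)] card_cov[OF S'(1) D(2)] fT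
    by (simp add: cov_def)
  moreover have "card (V j - cov T j) \<le> card Y + card P"
    unfolding Y_def using S'(2) by (metis diff_card_le_card_Diff le_diff_conv)
  ultimately have L: "card L \<le> card Y + 12" using S'(3) by linarith
  have fL: "finite L" using fin[OF D(3)] by (simp add: L_def)
  have "{w \<in> V l - (\<lambda>t. t l) ` (Dx \<union> Dy). adj ?v w} \<subseteq> L \<union> (\<lambda>t. t l) ` (Z \<union> (Dv - Dx))"
  proof
    fix w assume w: "w \<in> {w \<in> V l - (\<lambda>t. t l) ` (Dx \<union> Dy). adj ?v w}"
    show "w \<in> L \<union> (\<lambda>t. t l) ` (Z \<union> (Dv - Dx))"
    proof (cases "w \<in> cov T l")
      case True
      then obtain s where s: "s \<in> T" "w = s l" by (auto simp: cov_def)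
      then have "s \<notin> Dx" "s \<notin> Dy" using w by auto
      then have "s \<in> Z \<union> (Dv - Dx)" using s w by (auto simp: Z_def Dv_def swaps_def)
      then show ?thesis using s by blast
    next
      case False
      then show ?thesis using w by (auto simp: L_def)
    qed
  qed
  then have "card {w \<in> V l - (\<lambda>t. t l) ` (Dx \<union> Dy). adj ?v w} \<le> card (L \<union> (\<lambda>t. t l) ` (Z \<union> (Dv - Dx)))"
    by (rule card_mono[rotated]) (use fs fL in auto)
  also have "\<dots> \<le> card L + card ((\<lambda>t. t l) ` (Z \<union> (Dv - Dx)))" by (rule card_Un_le)
  also have "card ((\<lambda>t. t l) ` (Z \<union> (Dv - Dx))) \<le> card (Z \<union> (Dv - Dx))" by (rule card_image_le) (use fs in auto)
  also have "\<dots> \<le> card Z + card (Dv - Dx)" by (rule card_Un_le)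
  finally have "real (card {w \<in> V l - (\<lambda>t. t l) ` (Dx \<union> Dy). adj ?v w})
      \<le> real (card L) + real (card Z) + real (card (Dv - Dx))" by linarith
  also have "\<dots> \<le> real (card Y) + 12 + real (card Z) + real (card (Dv - Dx))" using L by linarith
  \<comment> \<open>The sum is at most \<open>8 * \<epsilon> * N + 15\<close>, and
    \<open>20 \<le> \<epsilon> * N\<close>.\<close>
  also have "\<dots> \<le> 9 * \<epsilon> * ?N" using ZY Dv big by linarith
  finally show ?thesis by (simp add: Dx_def Dy_def)
qed

text \<open>The triple consists of the vertices released by swapping \<open>x\<close>, those
  released by swapping \<open>y\<close>, and the vertices of \<open>V l\<close> in none of the tiles
  involved. The first two sets are nearly non-adjacent by \<open>swaps_nonadj\<close>, and both see
  little of the third by \<open>swaps_degree\<close>.\<close>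

lemma stuck_sparse:
  assumes S: "stuck i j T P x y" and idx: "all_idx i j l" and big: "20 \<le> \<epsilon> * real N" and \<eta>: "10 * \<epsilon> \<le> \<eta>"
  shows "sparse \<eta>"
proof -
  note D = all_idxD[OF idx] and S' = stuckD[OF S]
  let ?N = "real N"
  define Dx where "Dx = swaps j l T x"
  define Dy where "Dy = swaps i l T y"
  define A where "A = (\<lambda>t. t i) ` Dx"
  define B where "B = (\<lambda>t. t j) ` Dy"
  define C where "C = V l - (\<lambda>t. t l) ` (Dx \<union> Dy)"
  note Ss = stuck_sym[OF S] and idx' = all_idx_perm(2)[OF idx]
  have fT: "finite T" using tilingD(1)[OF S'(1)] .
  have subs: "Dx \<subseteq> T" "Dy \<subseteq> T" by (auto simp: Dx_def Dy_def swaps_def)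
  have fs: "finite Dx" "finite Dy" using subs fT finite_subset by auto
  have sub: "A \<subseteq> V i" "B \<subseteq> V j" "C \<subseteq> V l"
    unfolding A_def B_def C_def using coord_sub[OF S'(1) D(1) subs(1)] coord_sub[OF S'(1) D(2) subs(2)] by auto
  have fABC: "finite A" "finite B" "finite C" using sub finite_sub D by blast+
  have cA: "card A = card Dx" "card B = card Dy"
    unfolding A_def B_def using card_coord[OF S'(1)] D subs by auto
  have low: "(1/3 - 3 * \<epsilon>) * ?N \<le> real (card Dx)" "(1/3 - 3 * \<epsilon>) * ?N \<le> real (card Dy)"
    unfolding Dx_def Dy_def using swaps_lower[OF S idx big] swaps_lower[OF Ss idx' big] by auto
  have Npos: "0 < ?N" using N_pos by simp
  have "0 < (1/3 - 3 * \<epsilon>) * ?N" using Npos eps by (intro mult_pos_pos) auto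
  then have "0 < card Dx" "0 < card Dy" using low by linarith+
  then obtain s t where st: "s \<in> Dx" "t \<in> Dy" by (metis card_gt_0_iff ex_in_conv)
  have up: "real (card Dx) \<le> (1/3 + \<epsilon>) * ?N + 1" "real (card Dy) \<le> (1/3 + \<epsilon>) * ?N + 1"
    using swaps_upper[OF S idx] swaps_upper[OF Ss idx'] st unfolding Dx_def Dy_def by auto
  have m: "(1/3 - \<eta>) * ?N \<le> (1/3 - 3 * \<epsilon>) * ?N" "(1/3 - \<eta>) * ?N \<le> (1/3 - 4 * \<epsilon>) * ?N"
    using \<eta> eps by (auto intro!: mult_right_mono)
  have e9: "9 * \<epsilon> * ?N \<le> \<eta> * ?N" "\<epsilon> * ?N \<le> \<eta> * ?N" using \<eta> eps by (auto intro!: mult_right_mono)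
  have cnt: "real (pair_count adj X Y) \<le> \<eta> * ?N * ?N"
    if "X \<subseteq> V m" "m \<in> {1,2,3}" "finite Y" "\<And>a. a \<in> X \<Longrightarrow> real (card {b \<in> Y. adj a b}) \<le> \<eta> * ?N"
    for X Y m
  proof -
    have "real (pair_count adj X Y) \<le> real (card X) * (\<eta> * ?N)"
      by (rule pair_count_le[OF finite_sub[OF that(2,1)] that(3,4)])
    also have "\<dots> \<le> ?N * (\<eta> * ?N)" using card_sub[OF that(2,1)] \<eta> eps by (intro mult_right_mono) auto
    finally show ?thesis by (simp add: mult_ac)
  qed
  show ?thesis
  proof (rule sparseI[OF idx sub])
    show "(1/3 - \<eta>) * ?N \<le> real (card A)" "(1/3 - \<eta>) * ?N \<le> real (card B)" using m low cA by linarith+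
    have "card ((\<lambda>t. t l) ` (Dx \<union> Dy)) \<le> card Dx + card Dy"
      using card_image_le[of "Dx \<union> Dy" "\<lambda>t. t l"] fs card_Un_le[of Dx Dy] by simp
    moreover have "N - card ((\<lambda>t. t l) ` (Dx \<union> Dy)) \<le> card C"
      unfolding C_def using diff_card_le_card_Diff[of "(\<lambda>t. t l) ` (Dx \<union> Dy)" "V l"] fs card_V[OF D(3)] by simp
    ultimately have "?N - real (card Dx) - real (card Dy) \<le> real (card C)" by linarith
    then have "(1/3 - 4 * \<epsilon>) * ?N \<le> real (card C)" using up big by (simp add: algebra_simps)
    then show "(1/3 - \<eta>) * ?N \<le> real (card C)" using m by linarith
    show "real (pair_count adj A C) \<le> \<eta> * ?N * ?N"
    proof (rule cnt[OF sub(1) D(1) fABC(3)])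
      fix a assume "a \<in> A"
      then obtain t where "t \<in> Dx" "a = t i" by (auto simp: A_def)
      then show "real (card {b \<in> C. adj a b}) \<le> \<eta> * ?N"
        using swaps_degree[OF S idx big, of t] e9 unfolding C_def Dx_def Dy_def by auto
    qed
    show "real (pair_count adj B C) \<le> \<eta> * ?N * ?N"
    proof (rule cnt[OF sub(2) D(2) fABC(3)])
      fix a assume "a \<in> B"
      then obtain t where "t \<in> Dy" "a = t j" by (auto simp: B_def)
      then show "real (card {b \<in> C. adj a b}) \<le> \<eta> * ?N"
        using swaps_degree[OF Ss idx' big, of t] e9 unfolding C_def Dx_def Dy_def by (auto simp: Un_commute)
    qed
    show "real (pair_count adj A B) \<le> \<eta> * ?N * ?N"
    proof (rule cnt[OF sub(1) D(1) fABC(2)])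
      fix a assume "a \<in> A"
      then obtain t where t: "t \<in> Dx" "a = t i" by (auto simp: A_def)
      \<comment> \<open>\<open>t j\<close> is the exception made by \<open>s \<noteq> t\<close> in
        \<open>swaps_nonadj\<close>.\<close>
      have "{b \<in> B. adj a b} \<subseteq> {t j}"
        using swaps_nonadj[OF S idx, of t] t unfolding B_def Dx_def Dy_def by blast
      then have "card {b \<in> B. adj a b} \<le> 1" using card_mono[of "{t j}"] by fastforce
      then show "real (card {b \<in> B. adj a b}) \<le> \<eta> * ?N" using e9 big by linarith
    qed
  qed
qed

text \<open>Otherwise any two leftover vertices of the two classes off \<open>P\<close> are stuck.
  Having more than twelve leftover vertices ensures that each class has one outside
  \<open>P\<close>.\<close>

lemma free_edge_exists:
  assumes idx: "all_idx i j l" and big: "20 \<le> \<epsilon> * real N" and \<eta>: "10 * \<epsilon> \<le> \<eta>" "\<not> sparse \<eta>"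
    and T: "til T" "finite P" "card P \<le> 12" "P \<inter> verts T = {}"
    and left: "card T + 12 < N"
  shows "\<exists>T' u w. til T' \<and> card T' = card T \<and> P \<inter> verts T' = {} \<and>
     u \<in> V i - cov T' i - P \<and> w \<in> V j - cov T' j - P \<and> adj u w"
proof (rule ccontr)
  assume no: "\<not> ?thesis"
  note D = all_idxD[OF idx]
  have ex: "\<exists>x. x \<in> V m - cov T m - P" if m: "m \<in> {1,2,3}" for m
  proof (rule ccontr)
    assume "\<not> ?thesis"
    then have "V m \<subseteq> cov T m \<union> P" by auto
    then have "N \<le> card (cov T m \<union> P)"
      using card_mono[of "cov T m \<union> P" "V m"] card_V[OF m] T(2) tilingD(1)[OF T(1)] by (simp add: cov_def)
    also have "\<dots> \<le> card T + 12" using card_Un_le[of "cov T m" P] card_cov[OF T(1) m] T(3) by simp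
    finally show False using left by simp
  qed
  obtain x y where "x \<in> V i - cov T i - P" "y \<in> V j - cov T j - P" using ex[OF D(1)] ex[OF D(2)] by blast
  then have "stuck i j T P x y" unfolding stuck_def using T no by blast
  then show False using stuck_sparse[OF _ idx big \<eta>(1)] \<eta>(2) by blast
qed

section \<open>Free edges and the vertices they release\<close>

definition free_edge :: "(nat \<Rightarrow> 'a) set \<Rightarrow> nat \<Rightarrow> (nat \<Rightarrow> 'a) \<Rightarrow> bool" where
  "free_edge T m e \<longleftrightarrow> (\<forall>j\<in>{1,2,3}. j \<noteq> m \<longrightarrow> e j \<in> V j \<and> e j \<notin> cov T j) \<and>
     (\<forall>j\<in>{1,2,3}. \<forall>l\<in>{1,2,3}. j \<noteq> l \<and> j \<noteq> m \<and> l \<noteq> m \<longrightarrow> adj (e j) (e l))"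

lemma free_edgeD:
  assumes "free_edge T m e" "all_idx m j l"
  shows "e j \<in> V j" "e l \<in> V l" "e j \<notin> cov T j" "e l \<notin> cov T l" "adj (e j) (e l)"
proof -
  note D = all_idxD[OF assms(2)] and e = assms(1)[unfolded free_edge_def]
  show "e j \<in> V j" "e j \<notin> cov T j" using bspec[OF conjunct1[OF e] D(2)] D(4) by auto
  show "e l \<in> V l" "e l \<notin> cov T l" using bspec[OF conjunct1[OF e] D(3)] D(5) by auto
  show "adj (e j) (e l)" using bspec[OF bspec[OF conjunct2[OF e] D(2)] D(3)] D(4-6) by auto
qed

text \<open>The reason why \<open>free_edge\<close> leaves the value of \<open>e\<close> at
  \<open>m\<close> open: an edge missing class \<open>m\<close> becomes a tile by one function
  update.\<close>

lemma free_edge_tile: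
  assumes e: "free_edge T m e" and idx: "all_idx m j l" and v: "v \<in> V m" "adj v (e j)" "adj v (e l)"
  shows "tile V adj (e(m := v))"
  using free_edgeD[OF e idx] free_edgeD(5)[OF e idx, THEN sym] v v(2,3)[THEN sym] all_idxD(4-6)[OF idx]
  unfolding tile_def all_idxD(7)[OF idx] by simp

text \<open>The tile \<open>t\<close> is replaced by the triangle on \<open>e\<close> and
  \<open>t m\<close>. Its two other vertices are released at the price of the endpoints of
  \<open>e\<close>, and all other tiles survive, so the step can be repeated.\<close>

lemma free_vertex:
  assumes T: "til T" "t \<in> T" and e: "free_edge T m e" and idx: "all_idx m j l"
    and adj: "adj (t m) (e j)" "adj (t m) (e l)"
  shows "\<exists>T'. til T' \<and> card T' = card T \<and> T - {t} \<subseteq> T' \<and>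
     (\<forall>i\<in>{1,2,3}. cov T' i \<subseteq> cov T i \<union> (if i = m then {} else {e i})) \<and>
     (\<forall>i\<in>{1,2,3}. i \<noteq> m \<longrightarrow> t i \<notin> cov T' i)"
proof -
  note D = all_idxD[OF idx] and E = free_edgeD[OF e idx]
  let ?t = "e(m := t m)"
  have tV: "t m \<in> V m" using tileD(1)[OF tilingD(2)[OF T] D(1)] .
  have new: "?t i = t i \<or> ?t i \<notin> cov T i" if "i \<in> {1,2,3}" for i
    using that E D(4-6) unfolding D(7) by auto
  have t': "tile V adj ?t" by (rule free_edge_tile[OF e idx tV adj])
  have tc: "t i \<in> cov T i" for i using T(2) by (auto simp: cov_def)
  have R: "til (insert ?t (T - {t}))" "card (insert ?t (T - {t})) = card T"
    using tiling_replace(1,2)[OF T t' new] by blast+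
  have C: "cov (insert ?t (T - {t})) i = insert (?t i) (cov T i - {t i})" if "i \<in> {1,2,3}" for i
    using tiling_replace(3)[OF T t' new that] .
  have "cov (insert ?t (T - {t})) i \<subseteq> cov T i \<union> (if i = m then {} else {e i})" if "i \<in> {1,2,3}" for i
    using C[OF that] tc[of i] by auto
  moreover have "t i \<notin> cov (insert ?t (T - {t})) i" if "i \<in> {1,2,3}" "i \<noteq> m" for i
  proof -
    have "e i \<notin> cov T i" using E that D(4-6) unfolding D(7) by auto
    then show ?thesis using C[OF that(1)] tc[of i] that(2) by auto
  qed
  ultimately show ?thesis using R by (intro exI[of _ "insert ?t (T - {t})"]) blast
qed

text \<open>A trade along one free edge newly covers only its endpoints, so free edges disjoint from
  it stay free.\<close>

lemma free_edge_cov: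
  assumes e: "free_edge T m e" "free_edge T m' e'"
    and T': "\<forall>i\<in>{1,2,3}. cov T' i \<subseteq> cov T i \<union> (if i = m then {} else {e i})"
    and ne: "\<forall>i\<in>{1,2,3}. i \<noteq> m \<and> i \<noteq> m' \<longrightarrow> e i \<noteq> e' i"
  shows "free_edge T' m' e'"
  unfolding free_edge_def
proof (intro conjI ballI impI)
  fix i assume i: "i \<in> {1,2,3::nat}" "i \<noteq> m'"
  show "e' i \<in> V i" using e(2) i unfolding free_edge_def by blast
  have "e' i \<notin> cov T i" using e(2) i unfolding free_edge_def by blast
  moreover have "i \<noteq> m \<Longrightarrow> e i \<noteq> e' i" using ne i by blast
  moreover have "cov T' i \<subseteq> cov T i \<union> (if i = m then {} else {e i})" using T' i by blast
  ultimately show "e' i \<notin> cov T' i" by (auto split: if_splits)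
next
  fix j l assume "j \<in> {1,2,3::nat}" "l \<in> {1,2,3::nat}" "j \<noteq> l \<and> j \<noteq> m' \<and> l \<noteq> m'"
  then show "adj (e' j) (e' l)" using e(2) unfolding free_edge_def by blast
qed

definition completes :: "(nat \<Rightarrow> 'a) set \<Rightarrow> nat \<Rightarrow> (nat \<Rightarrow> 'a) \<Rightarrow> (nat \<Rightarrow> 'a) set" where
  "completes T m e = {t \<in> T. \<forall>j\<in>{1,2,3}. j \<noteq> m \<longrightarrow> adj (t m) (e j)}"

lemma completesD:
  assumes "t \<in> completes T m e" "all_idx m j l"
  shows "t \<in> T" "adj (t m) (e j)" "adj (t m) (e l)"
proof -
  note D = all_idxD[OF assms(2)]
  have t: "t \<in> T" "\<forall>j\<in>{1,2,3}. j \<noteq> m \<longrightarrow> adj (t m) (e j)" using assms(1) by (auto simp: completes_def)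
  show "t \<in> T" by (rule t(1))
  show "adj (t m) (e j)" using bspec[OF t(2) D(2)] D(4) by auto
  show "adj (t m) (e l)" using bspec[OF t(2) D(3)] D(5) by auto
qed

definition max_tiling :: "(nat \<Rightarrow> 'a) set \<Rightarrow> bool" where
  "max_tiling T \<longleftrightarrow> til T \<and> (\<forall>T'. til T' \<longrightarrow> card T' \<le> card T)"

lemma max_tiling_insert:
  assumes "max_tiling T" "til T'" "card T' = card T" "tile V adj t"
  shows "\<exists>i\<in>{1,2,3}. t i \<in> cov T' i"
proof (rule ccontr)
  assume "\<not> ?thesis"
  then have "til (insert t T')" "card (insert t T') = Suc (card T')"
    using tiling_insert[OF assms(2,4)] by blast+
  then show False using assms(1,3) unfolding max_tiling_def by fastforce
qed

text \<open>A common neighbour of the endpoints in \<open>V m\<close> must be covered, or the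
  triangle could be added to \<open>T\<close>.\<close>

lemma completes_lower:
  assumes T: "max_tiling T" and e: "free_edge T m e" and idx: "all_idx m j l"
  shows "(1/3 - 2 * \<epsilon>) * real N \<le> real (card (completes T m e))"
proof -
  note D = all_idxD[OF idx] and E = free_edgeD[OF e idx]
  have tT: "til T" using T by (simp add: max_tiling_def)
  have "{u \<in> V m. adj (e j) u \<and> adj (e l) u} \<subseteq> (\<lambda>t. t m) ` completes T m e"
  proof
    fix u assume "u \<in> {u \<in> V m. adj (e j) u \<and> adj (e l) u}"
    then have u: "u \<in> V m" "adj u (e j)" "adj u (e l)" using sym by auto
    have "\<exists>i\<in>{1,2,3}. (e(m := u)) i \<in> cov T i"
      by (rule max_tiling_insert[OF T tT refl free_edge_tile[OF e idx u]])
    then have "u \<in> cov T m" using E D(4-6) unfolding D(7) by auto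
    then obtain t where t: "t \<in> T" "u = t m" by (auto simp: cov_def)
    then have "t \<in> completes T m e" using u D(4-6) unfolding completes_def D(7) by auto
    then show "u \<in> (\<lambda>t. t m) ` completes T m e" using t by blast
  qed
  then have "card {u \<in> V m. adj (e j) u \<and> adj (e l) u} \<le> card ((\<lambda>t. t m) ` completes T m e)"
    by (rule card_mono[rotated]) (use tilingD(1)[OF tT] in \<open>auto simp: completes_def\<close>)
  also have "\<dots> = card (completes T m e)" by (rule card_coord[OF tT D(1)]) (auto simp: completes_def)
  finally show ?thesis
    using common_nbrs[OF D(2,1) D(4)[symmetric] E(1) D(3) D(5)[symmetric] E(2)] by linarith
qed

text \<open>A tile in both sets would yield one more: \<open>free_vertex\<close> trades it along
  \<open>e\<close> and releases \<open>t m'\<close>, which forms a triangle with the untouched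
  \<open>e'\<close>.\<close>

lemma completes_disjoint:
  assumes T: "max_tiling T" and e: "free_edge T m e" "free_edge T m' e'"
    and ne: "\<forall>i\<in>{1,2,3}. i \<noteq> m \<and> i \<noteq> m' \<longrightarrow> e i \<noteq> e' i"
    and idx: "all_idx m m' l"
  shows "completes T m e \<inter> completes T m' e' = {}"
proof (rule ccontr)
  assume "\<not> ?thesis"
  then obtain t where t: "t \<in> completes T m e" "t \<in> completes T m' e'" by blast
  note D = all_idxD[OF idx] and idx' = all_idx_perm(2)[OF idx]
  have tT: "til T" using T by (simp add: max_tiling_def)
  note t1 = completesD[OF t(1) idx] and t2 = completesD[OF t(2) idx']
  obtain T' where T': "til T'" "card T' = card T" "T - {t} \<subseteq> T'"
     "\<forall>i\<in>{1,2,3}. cov T' i \<subseteq> cov T i \<union> (if i = m then {} else {e i})"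
     "\<forall>i\<in>{1,2,3}. i \<noteq> m \<longrightarrow> t i \<notin> cov T' i"
    using free_vertex[OF tT t1(1) e(1) idx t1(2,3)] by blast
  have e': "free_edge T' m' e'" by (rule free_edge_cov[OF e T'(4) ne])
  have tV: "t m' \<in> V m'" using tileD(1)[OF tilingD(2)[OF tT t1(1)] D(2)] .
  have "\<exists>i\<in>{1,2,3}. (e'(m' := t m')) i \<in> cov T' i"
    by (rule max_tiling_insert[OF T T'(1,2) free_edge_tile[OF e' idx' tV t2(2,3)]])
  moreover have "t m' \<notin> cov T' m'" using T'(5) D(2,4) by auto
  ultimately show False using free_edgeD(3,4)[OF e' idx'] D(4-6) unfolding D(7) by auto
qed

text \<open>Three successive trades along disjoint free edges release \<open>r i\<close>,
  \<open>s j\<close> and \<open>t l\<close> without changing the number of tiles; a triangle on them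
  could then be added. A trade along an edge missing class \<open>a\<close> keeps \<open>r a\<close>
  covered, hence \<open>a\<close> must differ from \<open>i\<close>, and likewise for the
  others.\<close>

lemma no_free_triangle:
  assumes T: "max_tiling T" and idx: "all_idx i j l"
    and abc: "a \<in> {1,2,3} - {i}" "b \<in> {1,2,3} - {j}" "c \<in> {1,2,3} - {l}"
    and e: "free_edge T a e1" "free_edge T b e2" "free_edge T c e3"
    and ne: "\<forall>k\<in>{1,2,3}. k \<noteq> a \<and> k \<noteq> b \<longrightarrow> e1 k \<noteq> e2 k"
       "\<forall>k\<in>{1,2,3}. k \<noteq> a \<and> k \<noteq> c \<longrightarrow> e1 k \<noteq> e3 k"
       "\<forall>k\<in>{1,2,3}. k \<noteq> b \<and> k \<noteq> c \<longrightarrow> e2 k \<noteq> e3 k"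
    and r: "r \<in> completes T a e1" and s: "s \<in> completes T b e2" and t: "t \<in> completes T c e3"
    and dist: "r \<noteq> s" "r \<noteq> t" "s \<noteq> t"
    and adj: "adj (r i) (s j)" "adj (r i) (t l)" "adj (s j) (t l)"
  shows False
proof -
  note D = all_idxD[OF idx]
  have tT: "til T" using T by (simp add: max_tiling_def)
  obtain p1 q1 where ia: "all_idx a p1 q1" using all_idx_extend abc(1) by blast
  obtain p2 q2 where ib: "all_idx b p2 q2" using all_idx_extend abc(2) by blast
  obtain p3 q3 where ic: "all_idx c p3 q3" using all_idx_extend abc(3) by blast
  have rT: "r \<in> T" and sT: "s \<in> T" and tT': "t \<in> T" using r s t by (auto simp: completes_def)
  have rc: "r i \<in> cov T i" "s j \<in> cov T j" "t l \<in> cov T l" using rT sT tT' by (auto simp: cov_def)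
  obtain T1 where T1: "til T1" "card T1 = card T" "T - {r} \<subseteq> T1"
     "\<forall>k\<in>{1,2,3}. cov T1 k \<subseteq> cov T k \<union> (if k = a then {} else {e1 k})"
     "\<forall>k\<in>{1,2,3}. k \<noteq> a \<longrightarrow> r k \<notin> cov T1 k"
    using free_vertex[OF tT rT e(1) ia completesD(2,3)[OF r ia]] by blast
  have e2: "free_edge T1 b e2" by (rule free_edge_cov[OF e(1,2) T1(4) ne(1)])
  have e3: "free_edge T1 c e3" by (rule free_edge_cov[OF e(1,3) T1(4) ne(2)])
  have sT1: "s \<in> T1" using T1(3) sT dist by auto
  obtain T2 where T2: "til T2" "card T2 = card T1" "T1 - {s} \<subseteq> T2"
     "\<forall>k\<in>{1,2,3}. cov T2 k \<subseteq> cov T1 k \<union> (if k = b then {} else {e2 k})"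
     "\<forall>k\<in>{1,2,3}. k \<noteq> b \<longrightarrow> s k \<notin> cov T2 k"
    using free_vertex[OF T1(1) sT1 e2 ib completesD(2,3)[OF s ib]] by blast
  have e3': "free_edge T2 c e3" by (rule free_edge_cov[OF e2 e3 T2(4) ne(3)])
  have tT2: "t \<in> T2" using T2(3) T1(3) tT' dist by auto
  obtain T3 where T3: "til T3" "card T3 = card T2" "T2 - {t} \<subseteq> T3"
     "\<forall>k\<in>{1,2,3}. cov T3 k \<subseteq> cov T2 k \<union> (if k = c then {} else {e3 k})"
     "\<forall>k\<in>{1,2,3}. k \<noteq> c \<longrightarrow> t k \<notin> cov T3 k"
    using free_vertex[OF T2(1) tT2 e3' ic completesD(2,3)[OF t ic]] by blast
  have out: "k \<noteq> m \<Longrightarrow> e' k \<notin> cov T k" if "free_edge T m e'" "k \<in> {1,2,3}" for m e' k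
    using that unfolding free_edge_def by blast
  \<comment> \<open>Later trades newly cover only endpoints of \<open>e2\<close> and
    \<open>e3\<close>, which are uncovered in \<open>T\<close>, whereas \<open>r i\<close> is
    covered in \<open>T\<close>.\<close>
  have r3: "r i \<notin> cov T3 i"
  proof -
    have 1: "r i \<notin> cov T1 i" using bspec[OF T1(5) D(1)] abc(1) by auto
    have 2: "i \<noteq> b \<Longrightarrow> r i \<noteq> e2 i" "i \<noteq> c \<Longrightarrow> r i \<noteq> e3 i" using out[OF e(2) D(1)] out[OF e(3) D(1)] rc(1) by metis+
    have "cov T2 i \<subseteq> cov T1 i \<union> (if i = b then {} else {e2 i})" using bspec[OF T2(4) D(1)] .
    then have 3: "r i \<notin> cov T2 i" using 1 2 by (auto split: if_splits)
    have "cov T3 i \<subseteq> cov T2 i \<union> (if i = c then {} else {e3 i})" using bspec[OF T3(4) D(1)] .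
    then show ?thesis using 3 2 by (auto split: if_splits)
  qed
  have s3: "s j \<notin> cov T3 j"
  proof -
    have 1: "s j \<notin> cov T2 j" using bspec[OF T2(5) D(2)] abc(2) by auto
    have 2: "j \<noteq> c \<Longrightarrow> s j \<noteq> e3 j" using out[OF e(3) D(2)] rc(2) by metis
    have "cov T3 j \<subseteq> cov T2 j \<union> (if j = c then {} else {e3 j})" using bspec[OF T3(4) D(2)] .
    then show ?thesis using 1 2 by (auto split: if_splits)
  qed
  have t3: "t l \<notin> cov T3 l" using bspec[OF T3(5) D(3)] abc(3) by auto
  have V': "r i \<in> V i" "s j \<in> V j" "t l \<in> V l" using rc cov_sub[OF tT] D by blast+
  have "\<exists>k\<in>{1,2,3}. ((\<lambda>_. r i)(j := s j, l := t l)) k \<in> cov T3 k"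
    by (rule max_tiling_insert[OF T T3(1) _ tile_mk[OF idx V' adj]]) (use T1 T2 T3 in simp)
  then show False using r3 s3 t3 D(4-6) unfolding D(7) by auto
qed

text \<open>Labels allow for the triangles using two vertices of one tile, which need not be absent: at most one
  vertex per class has a given label.\<close>

lemma triangle_free_sparse:
  fixes \<kappa> :: "nat \<Rightarrow> 'a \<Rightarrow> 'b"
  assumes F: "\<And>m. m \<in> {1,2,3} \<Longrightarrow> F m \<subseteq> V m"
    "\<And>m. m \<in> {1,2,3} \<Longrightarrow> (2/3 - 16 * \<epsilon>) * real N \<le> real (card (F m))"
    and inj: "\<And>m. m \<in> {1,2,3} \<Longrightarrow> inj_on (\<kappa> m) (F m)"
    and no_tri: "\<And>i j l u v w. all_idx i j l \<Longrightarrow> u \<in> F i \<Longrightarrow> v \<in> F j \<Longrightarrow> w \<in> F l \<Longrightarrow>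
      \<kappa> i u \<noteq> \<kappa> j v \<Longrightarrow> \<kappa> i u \<noteq> \<kappa> l w \<Longrightarrow> \<kappa> j v \<noteq> \<kappa> l w \<Longrightarrow> adj u v \<Longrightarrow> adj u w \<Longrightarrow> adj v w \<Longrightarrow> False"
    and big: "20 \<le> \<epsilon> * real N" and \<eta>: "60 * \<epsilon> \<le> \<eta>"
  shows "sparse \<eta>"
proof -
  let ?N = "real N"
  have idx: "all_idx 1 2 3" by (rule all_idx_instances)
  have Npos: "20 * 1000 \<le> ?N"
  proof -
    have "\<epsilon> * ?N \<le> 1/1000 * ?N" using eps by (intro mult_right_mono) auto
    then show ?thesis using big by simp
  qed
  have scale: "x * ?N \<le> y * ?N" if "x \<le> y" for x y using that by (intro mult_right_mono) auto
  have finF: "finite (F m)" if "m \<in> {1,2,3}" for m using finite_sub[OF that F(1)[OF that]] .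
  have label: "card {z \<in> F m. \<kappa> m z = c} \<le> 1" if "m \<in> {1,2,3}" for m c
  proof -
    have "\<forall>a\<in>{z \<in> F m. \<kappa> m z = c}. \<forall>b\<in>{z \<in> F m. \<kappa> m z = c}. a = b"
      using inj[OF that] by (auto dest: inj_onD)
    then show ?thesis using card_le_Suc0_iff_eq[of "{z \<in> F m. \<kappa> m z = c}"] finF[OF that] by simp
  qed
  have "0 < card (F 1)"
  proof -
    have "1/2 * ?N \<le> (2/3 - 16 * \<epsilon>) * ?N" using eps by (intro scale) auto
    then show ?thesis using F(2)[of 1] Npos by (simp; linarith)
  qed
  then obtain u0 where u0: "u0 \<in> F 1" by (metis card_gt_0_iff ex_in_conv)
  \<comment> \<open>Up to labels no edge joins \<open>P 2\<close> and \<open>P 3\<close>, which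
    makes them two of the three sets sought; the third is \<open>C\<close> below.\<close>
  define P where "P m = {w \<in> F m. adj u0 w \<and> \<kappa> m w \<noteq> \<kappa> 1 u0}" for m
  have P_sub: "P m \<subseteq> F m" for m by (auto simp: P_def)
  have P_lower: "(1/3 - 18 * \<epsilon>) * ?N \<le> real (card (P m))" if m: "m \<in> {2,3}" for m
  proof -
    have mI: "m \<in> {1,2,3}" "1 \<noteq> m" using m by auto
    have "u0 \<in> V 1" using u0 F(1)[of 1] by auto
    then have "real (card (F m)) - (1/3 + \<epsilon>) * ?N \<le> real (card {w \<in> F m. adj u0 w})"
      by (intro nbrs_in_subset[of 1]) (use mI F in auto)
    moreover have "card {w \<in> F m. adj u0 w} \<le> card (P m \<union> {z \<in> F m. \<kappa> m z = \<kappa> 1 u0})"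
      by (rule card_mono) (use finF[OF mI(1)] in \<open>auto simp: P_def\<close>)
    moreover have "\<dots> \<le> card (P m) + 1"
      using card_Un_le[of "P m" "{z \<in> F m. \<kappa> m z = \<kappa> 1 u0}"] label[OF mI(1), of "\<kappa> 1 u0"] by linarith
    ultimately show ?thesis using F(2)[OF mI(1)] big by (simp add: algebra_simps)
  qed
  have P_cross: "card {z \<in> P l. adj y z} \<le> 1" if jl: "all_idx 1 j l" and y: "y \<in> P j" for j l y
  proof -
    have "{z \<in> P l. adj y z} \<subseteq> {z \<in> F l. \<kappa> l z = \<kappa> j y}"
      using no_tri[OF jl u0] y unfolding P_def by fastforce
    then have "card {z \<in> P l. adj y z} \<le> card {z \<in> F l. \<kappa> l z = \<kappa> j y}"
      by (rule card_mono[rotated]) (use finF all_idxD(3)[OF jl] in auto)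
    then show ?thesis using label[OF all_idxD(3)[OF jl], of "\<kappa> j y"] by linarith
  qed
  have P_non: "real (card {z \<in> P l. \<not> adj y z}) \<ge> real (card (P l)) - 1"
    if jl: "all_idx 1 j l" and y: "y \<in> P j" for j l y
    using P_cross[OF jl y] card_split[OF finite_subset[OF P_sub finF[OF all_idxD(3)[OF jl]]], of "adj y"] by linarith
  have P_upper: "real (card (P l)) \<le> (1/3 + 2 * \<epsilon>) * ?N" if jl: "all_idx 1 j l" for j l
  proof -
    note D = all_idxD[OF jl]
    have "j \<in> {2,3}" using D by auto
    from P_lower[OF this] have "0 < card (P j)"
    proof -
      assume a: "(1/3 - 18 * \<epsilon>) * ?N \<le> real (card (P j))"
      have "1/4 * ?N \<le> (1/3 - 18 * \<epsilon>) * ?N" using eps by (intro scale) auto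
      then show ?thesis using a Npos by linarith
    qed
    then obtain y where y: "y \<in> P j" by (metis card_gt_0_iff ex_in_conv)
    have "y \<in> V j" using y P_sub F(1)[OF D(2)] by blast
    then have "real (card {z \<in> P l. \<not> adj y z}) \<le> (1/3 + \<epsilon>) * ?N"
      by (rule non_nbrs[OF D(2,3,6)]) (use P_sub F(1)[OF D(3)] in auto)
    then show ?thesis using P_non[OF jl y] big by (simp add: algebra_simps)
  qed
  \<comment> \<open>A vertex of \<open>P j\<close> spends nearly all its non-neighbours inside
    \<open>P l\<close>, so it is adjacent to almost all of \<open>F l - P l\<close>.\<close>
  have dense: "real (card {z \<in> F l - P l. \<not> adj y z}) \<le> 20 * \<epsilon> * ?N"
    if jl: "all_idx 1 j l" and y: "y \<in> P j" for j l y
  proof -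
    note D = all_idxD[OF jl]
    have "y \<in> V j" using y P_sub F(1)[OF D(2)] by blast
    then have "real (card {z \<in> F l. \<not> adj y z}) \<le> (1/3 + \<epsilon>) * ?N"
      by (rule non_nbrs[OF D(2,3,6)]) (use F(1)[OF D(3)] in auto)
    moreover have "card {z \<in> F l. \<not> adj y z} = card {z \<in> P l. \<not> adj y z} + card {z \<in> F l - P l. \<not> adj y z}"
    proof -
      have eq: "{z \<in> F l. \<not> adj y z} = {z \<in> P l. \<not> adj y z} \<union> {z \<in> F l - P l. \<not> adj y z}"
        using P_sub by auto
      show ?thesis unfolding eq
        by (rule card_Un_disjoint) (use finF[OF D(3)] finite_subset[OF P_sub finF[OF D(3)]] in auto)
    qed
    moreover have "(1/3 - 18 * \<epsilon>) * ?N \<le> real (card (P l))" by (rule P_lower) (use D in auto)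
    ultimately show ?thesis using P_non[OF jl y] big by (simp add: algebra_simps)
  qed
  \<comment> \<open>Of two neighbours in \<open>P j\<close> one has a label other than that of
    \<open>v\<close>. It sees nearly all of \<open>F l - P l\<close>, where up to labels it has no
    common neighbour with \<open>v\<close>.\<close>
  have miss: "real (card {z \<in> F l - P l. adj v z}) \<le> 21 * \<epsilon> * ?N"
    if jl: "all_idx 1 j l" and v: "v \<in> F 1" "2 \<le> card {y \<in> P j. adj v y}" for j l v
  proof -
    note D = all_idxD[OF jl]
    have "\<not> {y \<in> P j. adj v y} \<subseteq> {y \<in> F j. \<kappa> j y = \<kappa> 1 v}"
    proof
      assume "{y \<in> P j. adj v y} \<subseteq> {y \<in> F j. \<kappa> j y = \<kappa> 1 v}"
      then have "card {y \<in> P j. adj v y} \<le> card {y \<in> F j. \<kappa> j y = \<kappa> 1 v}"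
        by (rule card_mono[rotated]) (use finF[OF D(2)] in auto)
      then show False using label[OF D(2), of "\<kappa> 1 v"] v(2) by linarith
    qed
    then obtain y where y: "y \<in> P j" "adj v y" "\<kappa> j y \<noteq> \<kappa> 1 v" using P_sub by blast
    have yF: "y \<in> F j" using y P_sub by blast
    let ?E = "{z \<in> F l. \<kappa> l z = \<kappa> 1 v} \<union> {z \<in> F l. \<kappa> l z = \<kappa> j y}"
    have sub: "{z \<in> F l - P l. adj v z} \<subseteq> {z \<in> F l - P l. \<not> adj y z} \<union> ?E"
    proof
      fix z assume z: "z \<in> {z \<in> F l - P l. adj v z}"
      show "z \<in> {z \<in> F l - P l. \<not> adj y z} \<union> ?E"
      proof (rule ccontr)
        assume n: "z \<notin> {z \<in> F l - P l. \<not> adj y z} \<union> ?E"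
        show False by (rule no_tri[OF jl v(1) yF, of z]) (use z n y in auto)
      qed
    qed
    have "card {z \<in> F l - P l. adj v z} \<le> card ({z \<in> F l - P l. \<not> adj y z} \<union> ?E)"
      by (rule card_mono[OF _ sub]) (use finF[OF D(3)] in auto)
    also have "\<dots> \<le> card {z \<in> F l - P l. \<not> adj y z} + card ?E" by (rule card_Un_le)
    also have "card ?E \<le> 1 + 1"
      using card_Un_le[of "{z \<in> F l. \<kappa> l z = \<kappa> 1 v}" "{z \<in> F l. \<kappa> l z = \<kappa> j y}"]
        label[OF D(3), of "\<kappa> 1 v"] label[OF D(3), of "\<kappa> j y"] by linarith
    finally have "real (card {z \<in> F l - P l. adj v z}) \<le> real (card {z \<in> F l - P l. \<not> adj y z}) + 2" by simp
    then show ?thesis using dense[OF jl y(1)] big by linarith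
  qed
  \<comment> \<open>Missing most of \<open>F l - P l\<close>, the vertex must find its neighbours in
    \<open>P l\<close>; so the two conditions in \<open>W\<close> below imply each other.\<close>
  have gain: "2 \<le> card {z \<in> P l. adj v z}"
    if jl: "all_idx 1 j l" and v: "v \<in> F 1" "2 \<le> card {y \<in> P j. adj v y}" for j l v
  proof -
    note D = all_idxD[OF jl]
    have vV: "v \<in> V 1" using v F(1)[OF D(1)] by blast
    have "real (card (F l)) - (1/3 + \<epsilon>) * ?N \<le> real (card {z \<in> F l. adj v z})"
      by (rule nbrs_in_subset[OF D(1,3,5) vV F(1)[OF D(3)]])
    moreover have "card {z \<in> F l. adj v z} = card {z \<in> P l. adj v z} + card {z \<in> F l - P l. adj v z}"
    proof -
      have eq: "{z \<in> F l. adj v z} = {z \<in> P l. adj v z} \<union> {z \<in> F l - P l. adj v z}"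
        using P_sub by auto
      show ?thesis unfolding eq
        by (rule card_Un_disjoint) (use finF[OF D(3)] finite_subset[OF P_sub finF[OF D(3)]] in auto)
    qed
    ultimately have "(1/3 - 38 * \<epsilon>) * ?N \<le> real (card {z \<in> P l. adj v z})"
      using miss[OF jl v] F(2)[OF D(3)] by (simp add: algebra_simps)
    moreover have "1/4 * ?N \<le> (1/3 - 38 * \<epsilon>) * ?N" using eps by (intro scale) auto
    ultimately show ?thesis using Npos by linarith
  qed
  define W where "W = {v \<in> F 1. 2 \<le> card {y \<in> P 2. adj v y} \<or> 2 \<le> card {z \<in> P 3. adj v z}}"
  define C where "C = F 1 - W"
  have idx': "all_idx 1 3 2" by (rule all_idx_perm(1)[OF idx])
  have W_sub: "W \<subseteq> V 1" using F(1)[of 1] by (auto simp: W_def)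
  have Q_sub: "F 2 - P 2 \<subseteq> V 2" using F(1)[of 2] by auto
  have fP: "finite (P m)" if "m \<in> {1,2,3}" for m using finite_subset[OF P_sub finF[OF that]] .
  have Q_size: "?N / 4 \<le> real (card (F 2 - P 2))"
  proof -
    have "card (F 2 - P 2) = card (F 2) - card (P 2)" "card (P 2) \<le> card (F 2)"
      using card_Diff_subset[OF _ P_sub] card_mono[OF _ P_sub] finF[of 2] fP[of 2] by auto
    then have "real (card (F 2 - P 2)) = real (card (F 2)) - real (card (P 2))" by simp
    moreover have "(1/4 + (1/3 + 2 * \<epsilon>)) * ?N \<le> (2/3 - 16 * \<epsilon>) * ?N" using eps by (intro scale) auto
    ultimately show ?thesis using F(2)[of 2] P_upper[OF idx'] by (simp add: algebra_simps)
  qed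
  \<comment> \<open>By \<open>gain\<close> every member of \<open>W\<close> has two neighbours in
    \<open>P 3\<close>, so by \<open>miss\<close> it has low degree into
    \<open>F 2 - P 2\<close>.\<close>
  have "real (card W) \<le> (1/3 + \<epsilon> + 2 * (21 * \<epsilon>)) * ?N"
  proof (rule few_low_degree[OF _ _ _ W_sub Q_sub _ Q_size])
    fix w assume w: "w \<in> W"
    then have wF: "w \<in> F 1" by (simp add: W_def)
    have "2 \<le> card {z \<in> P 3. adj w z}" using w gain[OF idx wF] by (auto simp: W_def)
    then show "real (card {q \<in> F 2 - P 2. adj w q}) \<le> 21 * \<epsilon> * ?N" by (rule miss[OF idx' wF])
  qed (use eps in auto)
  moreover have "card C = card (F 1) - card W" "card W \<le> card (F 1)"
    unfolding C_def using card_Diff_subset[of W "F 1"] card_mono[of "F 1" W] finF[of 1] by (auto simp: W_def)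
  ultimately have C: "(1/3 - 59 * \<epsilon>) * ?N \<le> real (card C)" using F(2)[of 1] by (simp add: algebra_simps)
  have C_low: "card {y \<in> P 2. adj v y} \<le> 1" "card {y \<in> P 3. adj v y} \<le> 1" if "v \<in> C" for v
    using that by (auto simp: C_def W_def)
  have cnt: "real (pair_count adj X Y) \<le> \<eta> * ?N * ?N"
    if "X \<subseteq> V m" "m \<in> {1,2,3}" "finite Y" "\<And>a. a \<in> X \<Longrightarrow> card {b \<in> Y. adj a b} \<le> 1"
    for X Y m
  proof -
    have e1: "\<epsilon> * ?N \<le> \<eta> * ?N" using \<eta> eps by (intro scale) auto
    have "real (pair_count adj X Y) \<le> real (card X) * (\<eta> * ?N)"
    proof (rule pair_count_le[OF finite_sub[OF that(2,1)] that(3)])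
      fix a assume "a \<in> X"
      from that(4)[OF this] show "real (card {b \<in> Y. adj a b}) \<le> \<eta> * ?N" using e1 big by linarith
    qed
    also have "\<dots> \<le> ?N * (\<eta> * ?N)" using card_sub[OF that(2,1)] \<eta> eps by (intro mult_right_mono) auto
    finally show ?thesis by (simp add: mult_ac)
  qed
  have sub: "C \<subseteq> V 1" "P 2 \<subseteq> V 2" "P 3 \<subseteq> V 3"
    using F(1)[of 1] F(1)[of 2] F(1)[of 3] P_sub[of 2] P_sub[of 3] by (auto simp: C_def)
  have m: "(1/3 - \<eta>) * ?N \<le> (1/3 - 59 * \<epsilon>) * ?N" "(1/3 - \<eta>) * ?N \<le> (1/3 - 18 * \<epsilon>) * ?N"
    using \<eta> eps by (auto intro!: scale)
  show ?thesis
  proof (rule sparseI[OF idx sub])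
    show "(1/3 - \<eta>) * ?N \<le> real (card C)" using m C by linarith
    show "(1/3 - \<eta>) * ?N \<le> real (card (P 2))" "(1/3 - \<eta>) * ?N \<le> real (card (P 3))"
      using m P_lower[of 2] P_lower[of 3] by auto
    show "real (pair_count adj C (P 2)) \<le> \<eta> * ?N * ?N" "real (pair_count adj C (P 3)) \<le> \<eta> * ?N * ?N"
      using C_low fP by (auto intro!: cnt[OF sub(1)])
    show "real (pair_count adj (P 2) (P 3)) \<le> \<eta> * ?N * ?N"
      using P_cross[OF idx] fP by (auto intro!: cnt[OF sub(2)])
  qed
qed

text \<open>The index \<open>(c, m)\<close> names copy \<open>c\<close> of an edge missing class
  \<open>m\<close>. Edges are found one at a time by \<open>free_edge_exists\<close>, with the
  endpoints of the earlier ones reserved in \<open>P\<close>, so that the swaps for a new edge do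
  not cover them and the new edge does not use them.\<close>

lemma collect_edges:
  assumes big: "20 \<le> \<epsilon> * real N" and \<eta>: "10 * \<epsilon> \<le> \<eta>" "\<not> sparse \<eta>"
    and T0: "til T0" "card T0 + 12 < N"
    and J: "finite J" "J \<subseteq> {0,1} \<times> {1,2,3}"
  shows "\<exists>T (q :: nat \<times> nat \<Rightarrow> nat \<Rightarrow> 'a). til T \<and> card T = card T0 \<and> (\<forall>p\<in>J. free_edge T (snd p) (q p)) \<and>
     (\<forall>p\<in>J. \<forall>p'\<in>J. p \<noteq> p' \<longrightarrow> (\<forall>k\<in>{1,2,3}. k \<noteq> snd p \<and> k \<noteq> snd p' \<longrightarrow> q p k \<noteq> q p' k))"
  using J
proof (induction J)
  case empty
  then show ?case using T0(1) by auto
next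
  case (insert p J)
  have "J \<subseteq> {0,1} \<times> {1,2,3}" using insert.prems by (rule insert_subset[THEN iffD1, THEN conjunct2])
  from insert.IH[OF this] obtain T and q :: "nat \<times> nat \<Rightarrow> nat \<Rightarrow> 'a"
    where T: "til T" "card T = card T0" and q_raw: "\<forall>p\<in>J. free_edge T (snd p) (q p)"
      "\<forall>p\<in>J. \<forall>p'\<in>J. p \<noteq> p' \<longrightarrow> (\<forall>k\<in>{1,2,3}. k \<noteq> snd p \<and> k \<noteq> snd p' \<longrightarrow> q p k \<noteq> q p' k)" by blast
  have q: "\<And>p. p \<in> J \<Longrightarrow> free_edge T (snd p) (q p)"
    "\<And>p p' k. p \<in> J \<Longrightarrow> p' \<in> J \<Longrightarrow> p \<noteq> p' \<Longrightarrow> k \<in> {1,2,3} \<Longrightarrow> k \<noteq> snd p \<Longrightarrow> k \<noteq> snd p' \<Longrightarrow> q p k \<noteq> q p' k"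
    using q_raw by blast+
  define m where "m = snd p"
  have "m \<in> {1,2,3}" using insert.prems by (auto simp: m_def)
  then obtain i j where idx: "all_idx m i j" using all_idx_extend by blast
  note D = all_idxD[OF idx]
  define P where "P = (\<Union>p'\<in>J. q p' ` ({1,2,3} - {snd p'}))"
  have snd_in: "snd p' \<in> {1,2,3}" if "p' \<in> J" for p' using insert.prems that by auto
  have two: "card (q p' ` ({1,2,3} - {snd p'})) \<le> 2" if "p' \<in> J" for p'
  proof -
    have "card (q p' ` ({1,2,3} - {snd p'})) \<le> card ({1,2,3} - {snd p'})" by (rule card_image_le) simp
    also have "\<dots> = 2" using snd_in[OF that] by (simp add: card_Diff_singleton)
    finally show ?thesis .
  qed
  have "card J \<le> card ({0,1::nat} \<times> {1,2,3::nat})" by (rule card_mono) (use insert.prems in auto)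
  then have cJ: "card J \<le> 6" by (simp add: card_cartesian_product)
  have "card P \<le> (\<Sum>p'\<in>J. card (q p' ` ({1,2,3} - {snd p'})))"
    unfolding P_def by (rule card_UN_le[OF insert.hyps(1)])
  also have "\<dots> \<le> (\<Sum>p'\<in>J. 2)" by (rule sum_mono) (rule two)
  finally have cP: "card P \<le> 12" using cJ by simp
  have fP: "finite P" using insert.hyps by (simp add: P_def)
  have qP: "q p' k \<in> P" if "p' \<in> J" "k \<in> {1,2,3}" "k \<noteq> snd p'" for p' k
    using that unfolding P_def by blast
  have "P \<inter> verts T = {}"
  proof (rule ccontr)
    assume "P \<inter> verts T \<noteq> {}"
    then obtain p' k where k: "p' \<in> J" "k \<in> {1,2,3} - {snd p'}" "q p' k \<in> verts T" unfolding P_def by blast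
    then have "q p' k \<in> V k" "q p' k \<notin> cov T k" using q(1)[OF k(1)] unfolding free_edge_def by blast+
    then show False using k cov_verts[OF T(1), of k] by blast
  qed
  then obtain T' u w where T': "til T'" "card T' = card T" "P \<inter> verts T' = {}"
     "u \<in> V i - cov T' i - P" "w \<in> V j - cov T' j - P" "adj u w"
    using free_edge_exists[OF all_idx_perm(3)[OF idx] big \<eta> T(1) fP cP] T0(2) T(2) by auto
  define e where "e = (\<lambda>_. u)(j := w)"
  have e: "e i = u" "e j = w" using D by (auto simp: e_def)
  have e_free: "free_edge T' m e"
    unfolding free_edge_def D(7) using T' e D(4-6) sym[OF T'(6)] by auto
  have eP: "e k \<notin> P" for k using T' by (auto simp: e_def)
  have old: "free_edge T' (snd p') (q p')" if p': "p' \<in> J" for p'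
  proof -
    have "q p' k \<notin> cov T' k" if "k \<in> {1,2,3}" "k \<noteq> snd p'" for k
      using qP[OF p' that] T'(3) that unfolding verts_def by blast
    then show ?thesis using q(1)[OF p'] unfolding free_edge_def by blast
  qed
  let ?q = "q(p := e)"
  have "\<forall>p'\<in>insert p J. free_edge T' (snd p') (?q p')"
    using old e_free insert.hyps(2) by (auto simp: m_def)
  moreover have sep: "?q p1 k \<noteq> ?q p2 k"
    if "p1 \<in> insert p J" "p2 \<in> insert p J" "p1 \<noteq> p2" "k \<in> {1,2,3}" "k \<noteq> snd p1" "k \<noteq> snd p2" for p1 p2 k
  proof (cases "p1 = p \<or> p2 = p")
    case True
    then show ?thesis using that qP[of p1 k] qP[of p2 k] eP[of k] by (auto simp del: insert_iff)
  next
    case False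
    then show ?thesis using q(2)[of p1 p2 k] that by auto
  qed
  ultimately show ?case using T'(1,2) T(2) by (intro exI[of _ T'] exI[of _ ?q]) (simp only:, blast)
qed

lemma almost_cover:
  assumes big: "20 \<le> \<epsilon> * real N" and \<eta>: "60 * \<epsilon> \<le> \<eta>" "\<not> sparse \<eta>"
  shows "\<exists>T. til T \<and> N \<le> card T + 12"
proof (rule ccontr)
  assume no: "\<not> ?thesis"
  let ?N = "real N"
  have le_N: "card T \<le> N" if "til T" for T
    using card_cov[OF that, of 1] card_sub[of 1, OF _ cov_sub[OF that]] by simp
  obtain T0 where T0: "til T0" "\<And>T. til T \<Longrightarrow> card T \<le> card T0"
    using ex_has_greatest_nat[of "til" "{}" card "Suc N"] tiling_empty le_N by (metis le_imp_less_Suc)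
  have left: "card T0 + 12 < N" using no T0(1) by (metis not_le)
  let ?J = "{0,1::nat} \<times> {1,2,3::nat}"
  have "10 * \<epsilon> \<le> \<eta>" using \<eta> eps by linarith
  from collect_edges[OF big this \<eta>(2) T0(1) left, of ?J]
  obtain T and q :: "nat \<times> nat \<Rightarrow> nat \<Rightarrow> 'a" where T: "til T" "card T = card T0"
    and q: "\<And>p. p \<in> ?J \<Longrightarrow> free_edge T (snd p) (q p)"
      "\<And>p p'. p \<in> ?J \<Longrightarrow> p' \<in> ?J \<Longrightarrow> p \<noteq> p' \<Longrightarrow> \<forall>k\<in>{1,2,3}. k \<noteq> snd p \<and> k \<noteq> snd p' \<longrightarrow> q p k \<noteq> q p' k"
    by (metis (no_types, lifting) finite.emptyI finite_SigmaI finite_insert order_refl)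
  have maxT: "max_tiling T" unfolding max_tiling_def using T T0 by auto
  have qe: "free_edge T m (q (c, m))" if "c \<in> {0,1}" "m \<in> {1,2,3}" for c m
    using q(1)[of "(c, m)"] that by auto
  have fT: "finite T" using tilingD(1)[OF T(1)] .
  define K where "K c m = completes T m (q (c, m))" for c m
  have K_sub: "K c m \<subseteq> T" for c m by (auto simp: K_def completes_def)
  have fK: "finite (K c m)" for c m using finite_subset[OF K_sub fT] .
  have K_lower: "(1/3 - 2 * \<epsilon>) * ?N \<le> real (card (K c m))" if "c \<in> {0,1}" "all_idx m j l" for c m j l
    unfolding K_def by (rule completes_lower[OF maxT qe that(2)]) (use that(1) all_idxD(1)[OF that(2)] in auto)
  have K_disj: "K c m \<inter> K c' m' = {}" if "c \<in> {0,1}" "c' \<in> {0,1}" "all_idx m m' l" for c c' m m' l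
  proof -
    note D = all_idxD[OF that(3)]
    show ?thesis unfolding K_def
      by (rule completes_disjoint[OF maxT qe[OF that(1) D(1)] qe[OF that(2) D(2)] _ that(3)])
        (use q(2)[of "(c, m)" "(c', m')"] that D(1,2,4) in auto)
  qed
  \<comment> \<open>Tiles serving both copies, whose vertices can be released along either; a
    triangle may need two edges missing the same class.\<close>
  define S where "S m = K 0 m \<inter> K 1 m" for m
  have S_sub: "S m \<subseteq> T" for m using K_sub by (auto simp: S_def)
  have fS: "finite (S m)" for m using fK by (simp add: S_def)
  \<comment> \<open>Four sets of at least \<open>(1/3 - 2 * \<epsilon>) N\<close> tiles lie among at
    most \<open>N\<close>, and the two for class \<open>m\<close> are the only ones that can
    overlap.\<close>
  have S_lower: "(1/3 - 8 * \<epsilon>) * ?N \<le> real (card (S m))" if idx: "all_idx m j l" for m j l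
  proof -
    note perm = all_idx_perm[OF idx]
    have "card (K 0 m \<union> K 1 m \<union> K 0 j \<union> K 0 l) \<le> card T"
      by (rule card_mono[OF fT]) (use K_sub in auto)
    moreover have "card (K 0 m \<union> K 1 m \<union> K 0 j \<union> K 0 l) = card (K 0 m \<union> K 1 m \<union> K 0 j) + card (K 0 l)"
      by (rule card_Un_disjoint)
        (use fK K_disj[OF _ _ perm(1), of 0 0] K_disj[OF _ _ perm(1), of 1 0] K_disj[OF _ _ perm(3), of 0 0] in auto)
    moreover have "card (K 0 m \<union> K 1 m \<union> K 0 j) = card (K 0 m \<union> K 1 m) + card (K 0 j)"
      by (rule card_Un_disjoint)
        (use fK K_disj[OF _ _ idx, of 0 0] K_disj[OF _ _ idx, of 1 0] in auto)
    moreover have "card (K 0 m \<union> K 1 m) + card (S m) = card (K 0 m) + card (K 1 m)"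
      unfolding S_def using card_Un_Int[OF fK fK] by simp
    ultimately have "real (card (K 0 m)) + real (card (K 1 m)) + real (card (K 0 j)) + real (card (K 0 l))
        \<le> real (card (S m)) + ?N" using le_N[OF T(1)] by linarith
    moreover have "(1/3 - 2 * \<epsilon>) * ?N \<le> real (card (K 0 m))" "(1/3 - 2 * \<epsilon>) * ?N \<le> real (card (K 1 m))"
      "(1/3 - 2 * \<epsilon>) * ?N \<le> real (card (K 0 j))" "(1/3 - 2 * \<epsilon>) * ?N \<le> real (card (K 0 l))"
      using K_lower[OF _ idx, of 0] K_lower[OF _ idx, of 1] K_lower[OF _ perm(2), of 0] K_lower[OF _ perm(4), of 0]
      by auto
    ultimately show ?thesis by (simp add: algebra_simps)
  qed
  \<comment> \<open>A vertex of class \<open>m\<close> is released by trading its tile along an edge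
    that misses another class.\<close>
  define G where "G m = (\<Union>k\<in>{1,2,3} - {m}. S k)" for m
  define F where "F m = (\<lambda>t. t m) ` G m" for m
  \<comment> \<open>The label of a vertex is its tile, so distinct labels give the distinct tiles
    required by \<open>no_free_triangle\<close>.\<close>
  define \<kappa> where "\<kappa> m u = inv_into T (\<lambda>t. t m) u" for m :: nat and u
  have G_sub: "G m \<subseteq> T" for m using S_sub by (auto simp: G_def)
  have \<kappa>: "\<kappa> m (t m) = t" if "m \<in> {1,2,3}" "t \<in> T" for m t
    unfolding \<kappa>_def by (rule inv_into_f_f[OF tilingD(3)[OF T(1) that(1)] that(2)])
  have "sparse \<eta>"
  proof (rule triangle_free_sparse[where F = F and \<kappa> = \<kappa>, OF _ _ _ _ big \<eta>(1)])
    fix m :: nat assume m: "m \<in> {1,2,3}"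
    show "F m \<subseteq> V m" unfolding F_def by (rule coord_sub[OF T(1) m G_sub])
    show "inj_on (\<kappa> m) (F m)"
      by (rule inj_on_inverseI[where g = "\<lambda>t. t m"]) (use \<kappa>[OF m] G_sub[of m] in \<open>auto simp: F_def subset_iff\<close>)
    obtain j l where idx: "all_idx m j l" using all_idx_extend[OF m] by blast
    note D = all_idxD[OF idx] and perm = all_idx_perm[OF idx]
    have "G m = S j \<union> S l" unfolding G_def D(7) using D(4-6) by auto
    moreover have "S j \<inter> S l = {}" using K_disj[OF _ _ perm(3), of 0 0] by (auto simp: S_def)
    ultimately have "card (G m) = card (S j) + card (S l)" using card_Un_disjoint[OF fS fS] by simp
    then have "card (F m) = card (S j) + card (S l)" unfolding F_def using card_coord[OF T(1) m G_sub] by simp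
    then show "(2/3 - 16 * \<epsilon>) * ?N \<le> real (card (F m))"
      using S_lower[OF perm(2)] S_lower[OF perm(4)] by (simp add: algebra_simps)
  next
    fix i j l u v w
    assume idx: "all_idx i j l" and F: "u \<in> F i" "v \<in> F j" "w \<in> F l"
      and ne: "\<kappa> i u \<noteq> \<kappa> j v" "\<kappa> i u \<noteq> \<kappa> l w" "\<kappa> j v \<noteq> \<kappa> l w" and adj: "adj u v" "adj u w" "adj v w"
    note D = all_idxD[OF idx]
    obtain r a where r: "u = r i" "r \<in> S a" "a \<in> {1,2,3} - {i}" using F(1) unfolding F_def G_def by blast
    obtain s b where s: "v = s j" "s \<in> S b" "b \<in> {1,2,3} - {j}" using F(2) unfolding F_def G_def by blast
    obtain t c where t: "w = t l" "t \<in> S c" "c \<in> {1,2,3} - {l}" using F(3) unfolding F_def G_def by blast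
    have rst: "r \<in> T" "s \<in> T" "t \<in> T" using r s t S_sub by blast+
    have dist: "r \<noteq> s" "r \<noteq> t" "s \<noteq> t"
      using ne \<kappa>[OF D(1) rst(1)] \<kappa>[OF D(2) rst(2)] \<kappa>[OF D(3) rst(3)] r(1) s(1) t(1) by auto
    \<comment> \<open>A common value of \<open>a\<close>, \<open>b\<close>, \<open>c\<close> would
      differ from all three classes. So no class is missed three times, and two copies
      suffice.\<close>
    have not_all: "\<not> (a = b \<and> b = c)" using r(3) s(3) t(3) unfolding D(7) by auto
    \<comment> \<open>Of two edges missing the same class, the two copies are used.\<close>
    define c2 :: nat where "c2 = (if b = a then 1 else 0)"
    define c3 :: nat where "c3 = (if c = a \<or> c = b then 1 else 0)"
    have cc: "c2 \<in> {0,1}" "c3 \<in> {0,1}" by (auto simp: c2_def c3_def)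
    have abc: "a \<in> {1,2,3}" "b \<in> {1,2,3}" "c \<in> {1,2,3}" using r s t by auto
    have jobs: "(0::nat, a) \<noteq> (c2, b)" "(0::nat, a) \<noteq> (c3, c)" "(c2, b) \<noteq> (c3, c)"
      using not_all by (auto simp: c2_def c3_def split: if_splits)
    have mem: "(0::nat, a) \<in> ?J" "(c2, b) \<in> ?J" "(c3, c) \<in> ?J" using abc cc by auto
    have comp: "r \<in> completes T a (q (0, a))" "s \<in> completes T b (q (c2, b))" "t \<in> completes T c (q (c3, c))"
      using r(2) s(2) t(2) cc by (auto simp: S_def K_def)
    show False
      by (rule no_free_triangle[OF maxT idx r(3) s(3) t(3) q(1)[OF mem(1), unfolded snd_conv]
            q(1)[OF mem(2), unfolded snd_conv] q(1)[OF mem(3), unfolded snd_conv]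
            q(2)[OF mem(1,2) jobs(1), unfolded snd_conv] q(2)[OF mem(1,3) jobs(2), unfolded snd_conv]
            q(2)[OF mem(2,3) jobs(3), unfolded snd_conv] comp dist adj[unfolded r(1) s(1) t(1)]])
  qed
  then show False using \<eta>(2) by simp
qed

end

text \<open>Take for \<open>m\<close> the integer part of the fourth root of \<open>N\<close>: then
  \<open>m ^ 3\<close> is of smaller order than \<open>N\<close>, while \<open>(9/10) ^ m\<close>
  outweighs \<open>(m + 1) ^ 4\<close>, which exceeds \<open>N\<close>. The factor \<open>12\<close>
  counts the absorbing sets, one for each leftover vertex a class may have, and \<open>40\<close> is
  the slack of \<open>absorber\<close>.\<close>

lemma exists_family_size:
  fixes c :: real
  assumes "0 < c"
  shows "\<exists>N0. \<forall>N\<ge>N0. \<exists>m::nat. (9/10) ^ m * real N < 1 \<and> real (12 * (9 * m + 18 * m ^ 3)) + 40 \<le> c * real N"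
proof -
  have "\<forall>\<^sub>F m in sequentially. (9/10) ^ m * (real m + 1) ^ 4 < 1" by real_asymp
  moreover have "\<forall>\<^sub>F m in sequentially. 12 * (9 * real m + 18 * real m ^ 3) + 40 \<le> c * real m ^ 4"
    using assms by real_asymp
  ultimately have "\<forall>\<^sub>F m in sequentially. (9/10) ^ m * (real m + 1) ^ 4 < 1 \<and>
      12 * (9 * real m + 18 * real m ^ 3) + 40 \<le> c * real m ^ 4" by (rule eventually_conj)
  then obtain m0 where m0: "\<And>m. m \<ge> m0 \<Longrightarrow> (9/10) ^ m * (real m + 1) ^ 4 < 1"
    "\<And>m. m \<ge> m0 \<Longrightarrow> 12 * (9 * real m + 18 * real m ^ 3) + 40 \<le> c * real m ^ 4"
    unfolding eventually_sequentially by blast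
  have "\<exists>m. (9/10) ^ m * real N < 1 \<and> real (12 * (9 * m + 18 * m ^ 3)) + 40 \<le> c * real N"
    if N: "N \<ge> m0 ^ 4" for N
  proof -
    have bound: "m \<le> N" if "m ^ 4 \<le> N" for m using that self_le_power[of m 4] by (cases "m = 0") auto
    have "\<exists>m. m ^ 4 \<le> N \<and> (\<forall>k. k ^ 4 \<le> N \<longrightarrow> k \<le> m)"
      by (rule ex_has_greatest_nat[of _ m0 _ "Suc N"]) (use N bound in \<open>auto simp: le_imp_less_Suc\<close>)
    then obtain m where m: "m ^ 4 \<le> N" "\<And>k. k ^ 4 \<le> N \<Longrightarrow> k \<le> m" by blast
    have mm: "m0 \<le> m" using m(2)[OF N] .
    have "\<not> (m + 1) ^ 4 \<le> N" using m(2)[of "m + 1"] by auto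
    then have "real N \<le> real ((m + 1) ^ 4)" by (intro of_nat_mono) simp
    then have up: "real N \<le> (real m + 1) ^ 4" by (simp add: add.commute)
    have "(9/10) ^ m * real N \<le> (9/10) ^ m * (real m + 1) ^ 4" using up by (intro mult_left_mono) auto
    then have 1: "(9/10) ^ m * real N < 1" using m0(1)[OF mm] by linarith
    have "real (m ^ 4) \<le> real N" using m(1) by (rule of_nat_mono)
    then have "c * real m ^ 4 \<le> c * real N" using assms by (intro mult_left_mono) auto
    then have "real (12 * (9 * m + 18 * m ^ 3)) + 40 \<le> c * real N" using m0(2)[OF mm] by simp
    with 1 show ?thesis by blast
  qed
  then show ?thesis by blast
qed

section \<open>Covering the whole graph\<close>

lemma resize_subset:
  assumes "finite V" "X \<subseteq> V" "k \<le> card V"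
  shows "\<exists>Y\<subseteq>V. card Y = k \<and> card (Y - X) \<le> k - card X"
proof (cases "k \<le> card X")
  case True
  then obtain Y where Y: "Y \<subseteq> X" "card Y = k" by (meson obtain_subset_with_card_n)
  then have "Y - X = {}" by blast
  then have "card (Y - X) \<le> k - card X" by (simp only: card.empty)
  then show ?thesis using Y assms(2) by blast
next
  case False
  then obtain Y where Y: "X \<subseteq> Y" "Y \<subseteq> V" "card Y = k"
    using exists_subset_between[of X k V] assms by auto
  then have "card (Y - X) = k - card X"
    using card_Diff_subset[OF finite_subset[OF assms(2,1)] Y(1)] by simp
  then show ?thesis using Y by (metis order_refl)
qed

lemma pair_count_resize:
  assumes "finite Y" "finite Y'" "finite X" "finite X'"
  shows "pair_count adj Y Y' \<le> pair_count adj X X' + card (Y - X) * card Y' + card Y * card (Y' - X')"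
proof -
  have "{(a, b). a \<in> Y \<and> b \<in> Y' \<and> adj a b} \<subseteq>
     {(a, b). a \<in> X \<and> b \<in> X' \<and> adj a b} \<union> (Y - X) \<times> Y' \<union> Y \<times> (Y' - X')" by auto
  then have "pair_count adj Y Y' \<le> card ({(a, b). a \<in> X \<and> b \<in> X' \<and> adj a b} \<union> (Y - X) \<times> Y' \<union> Y \<times> (Y' - X'))"
    unfolding pair_count_def by (rule card_mono[rotated]) (use assms in \<open>simp add: finite_pair_set\<close>)
  also have "\<dots> \<le> pair_count adj X X' + card ((Y - X) \<times> Y') + card (Y \<times> (Y' - X'))"
    unfolding pair_count_def
    using card_Un_le[of "{(a, b). a \<in> X \<and> b \<in> X' \<and> adj a b} \<union> (Y - X) \<times> Y'" "Y \<times> (Y' - X')"]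
      card_Un_le[of "{(a, b). a \<in> X \<and> b \<in> X' \<and> adj a b}" "(Y - X) \<times> Y'"] by linarith
  finally show ?thesis by (simp add: card_cartesian_product)
qed

lemma card_edges_between_le:
  assumes "finite A" "finite B"
  shows "card (edges_between E A B) \<le> pair_count (\<lambda>u v. {u, v} \<in> E) A B"
proof -
  have "edges_between E A B \<subseteq> (\<lambda>(a, b). {a, b}) ` {(a, b). a \<in> A \<and> b \<in> B \<and> {a, b} \<in> E}"
    unfolding edges_between_def by auto
  then have "card (edges_between E A B) \<le> card ((\<lambda>(a, b). {a, b}) ` {(a, b). a \<in> A \<and> b \<in> B \<and> {a, b} \<in> E})"
    by (rule card_mono[rotated]) (use assms in \<open>simp add: finite_pair_set\<close>)
  also have "\<dots> \<le> pair_count (\<lambda>u v. {u, v} \<in> E) A B"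
    unfolding pair_count_def by (rule card_image_le) (use assms in \<open>simp add: finite_pair_set\<close>)
  finally show ?thesis .
qed

lemma sparse_triple_density:
  fixes V :: "nat \<Rightarrow> 'a set"
  assumes sp: "sparse_triple V (\<lambda>u v. {u, v} \<in> E) N \<eta>"
    and V: "\<And>i. i \<in> {1,2,3} \<Longrightarrow> finite (V i)" "\<And>i. i \<in> {1,2,3} \<Longrightarrow> card (V i) = N"
    and N: "3 dvd N" "0 < N" and \<eta>: "0 \<le> \<eta>"
  shows "\<exists>X :: nat \<Rightarrow> 'a set. (\<forall>i\<in>{1,2,3}. X i \<subseteq> V i \<and> card (X i) = N div 3) \<and>
     (\<forall>i\<in>{1,2,3}. \<forall>j\<in>{1,2,3}. i \<noteq> j \<longrightarrow> density E (X i) (X j) \<le> 18 * \<eta>)"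
proof -
  let ?adj = "\<lambda>u v. {u, v} \<in> E" and ?N = "real N"
  obtain k where k: "N = 3 * k" using N(1) by auto
  obtain X where X: "\<And>i. i \<in> {1,2,3} \<Longrightarrow> X i \<subseteq> V i" "\<And>i. i \<in> {1,2,3} \<Longrightarrow> (1/3 - \<eta>) * ?N \<le> real (card (X i))"
    and cnt: "\<And>i j. i \<in> {1,2,3} \<Longrightarrow> j \<in> {1,2,3} \<Longrightarrow> i \<noteq> j \<Longrightarrow> real (pair_count ?adj (X i) (X j)) \<le> \<eta> * ?N * ?N"
    using sp unfolding sparse_triple_def by metis
  \<comment> \<open>Truncated subtraction covers both cases: a set that is too large is shrunk and
    gains no vertex.\<close>
  have "\<forall>i\<in>{1,2,3}. \<exists>Y\<subseteq>V i. card Y = k \<and> card (Y - X i) \<le> k - card (X i)"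
    using resize_subset[OF V(1) X(1)] V(2) k by simp
  then obtain Y where Y: "\<And>i. i \<in> {1,2,3} \<Longrightarrow> Y i \<subseteq> V i \<and> card (Y i) = k \<and> card (Y i - X i) \<le> k - card (X i)"
    by metis
  have kN: "?N = 3 * real k" using k by simp
  have kpos: "0 < real k" using N(2) k by simp
  have diff: "real (card (Y i - X i)) \<le> \<eta> * ?N" if i: "i \<in> {1,2,3}" for i
  proof (cases "card (X i) \<le> k")
    case True
    then have "real (card (Y i - X i)) \<le> real k - real (card (X i))" using Y[OF i] by linarith
    then show ?thesis using X(2)[OF i] kN by (simp add: algebra_simps)
  next
    case False
    then show ?thesis using Y[OF i] \<eta> by simp
  qed
  have "density E (Y i) (Y j) \<le> 18 * \<eta>" if i: "i \<in> {1,2,3}" and j: "j \<in> {1,2,3}" "i \<noteq> j" for i j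
  proof -
    have f: "finite (Y i)" "finite (Y j)" "finite (X i)" "finite (X j)"
      using Y X(1) V(1) i j by (meson finite_subset)+
    have "real (card (edges_between E (Y i) (Y j))) \<le> real (pair_count ?adj (Y i) (Y j))"
      using card_edges_between_le[OF f(1,2)] by (rule of_nat_mono)
    also have "\<dots> \<le> real (pair_count ?adj (X i) (X j) + card (Y i - X i) * card (Y j) + card (Y i) * card (Y j - X j))"
      using pair_count_resize[OF f] by (rule of_nat_mono)
    also have "\<dots> = real (pair_count ?adj (X i) (X j)) + real (card (Y i - X i)) * real k + real k * real (card (Y j - X j))"
      using Y[OF i] Y[OF j(1)] by simp
    also have "\<dots> \<le> \<eta> * ?N * ?N + \<eta> * ?N * real k + real k * (\<eta> * ?N)"
      using cnt[OF i j] diff[OF i] diff[OF j(1)] by (intro add_mono mult_mono) auto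
    \<comment> \<open>With \<open>N = 3 * k\<close> the three terms are \<open>9\<close>,
      \<open>3\<close> and \<open>3\<close> times \<open>\<eta> * k * k\<close>; their sum
      \<open>15\<close> is rounded up to \<open>18\<close>.\<close>
    also have "\<dots> \<le> 18 * \<eta> * (real k * real k)"
      unfolding kN using \<eta> mult_nonneg_nonneg[of \<eta> "real k * real k"] by (simp add: algebra_simps)
    finally show ?thesis unfolding density_def using Y[OF i] Y[OF j(1)] kpos by (simp add: divide_le_eq)
  qed
  then show ?thesis using Y k by (intro exI[of _ Y]) auto
qed

section \<open>Assembly of the triangle partition\<close>

lemma (in tripartite) triangle_partition:
  assumes "tb (V 1 \<union> V 2 \<union> V 3)" and adj: "\<And>u v. adj u v \<Longrightarrow> {u, v} \<in> E"
  shows "\<exists>\<T> :: 'a set set. card \<T> = N \<and> (\<forall>T\<in>\<T>. triangle E T) \<and> disjoint \<T> \<and> \<Union>\<T> = V 1 \<union> V 2 \<union> V 3"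
proof -
  obtain S where S: "til S" "verts S = V 1 \<union> V 2 \<union> V 3" using assms(1) unfolding tileable_def by blast
  have meet: "s = t" if st: "s \<in> S" "t \<in> S" and x: "x \<in> s ` {1,2,3}" "x \<in> t ` {1,2,3}" for s t x
  proof -
    obtain i where i: "i \<in> {1,2,3}" "x = s i" using x(1) by blast
    obtain j where j: "j \<in> {1,2,3}" "x = t j" using x(2) by blast
    have "x \<in> V i" "x \<in> V j"
      using tileD(1)[OF tilingD(2)[OF S(1) st(1)] i(1)] tileD(1)[OF tilingD(2)[OF S(1) st(2)] j(1)] i j by auto
    then have "i = j" using disj[OF i(1) j(1)] by auto
    then show ?thesis using tiling_coord_eq[OF S(1) i(1) st] i j by simp
  qed
  let ?\<T> = "(\<lambda>t. t ` {1,2,3}) ` S"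
  have "inj_on (\<lambda>t. t ` {1,2,3}) S"
  proof (rule inj_onI)
    fix s t assume st: "s \<in> S" "t \<in> S" "s ` {1,2,3} = t ` {1,2,3}"
    show "s = t" by (rule meet[OF st(1,2), of "s 1"]) (use st(3) in auto)
  qed
  then have "card ?\<T> = card S" by (rule card_image)
  also have "\<dots> = card (V 1)"
    using card_cov[OF S(1), of 1] cov_verts[OF S(1), of 1] S(2) by (simp add: Int_absorb1 Un_assoc)
  finally have "card ?\<T> = N" using card_V[of 1] by simp
  moreover have "triangle E T" if T: "T \<in> ?\<T>" for T
  proof -
    obtain t where t: "t \<in> S" "T = t ` {1,2,3}" using T by blast
    have tt: "tile V adj t" using tilingD(2)[OF S(1) t(1)] .
    have ne: "t i \<noteq> t j" if "i \<in> {1,2,3}" "j \<in> {1,2,3}" "i \<noteq> j" for i j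
      using tileD(1)[OF tt that(1)] tileD(1)[OF tt that(2)] disj[OF that] by auto
    have "inj_on t {1,2,3}" using ne by (meson inj_onI)
    then have "card T = 3" unfolding t(2) by (simp add: card_image)
    moreover have "{x, y} \<in> E" if xy: "x \<in> T" "y \<in> T" "x \<noteq> y" for x y
    proof -
      obtain i where i: "i \<in> {1,2,3}" "x = t i" using xy(1) unfolding t(2) by blast
      obtain j where j: "j \<in> {1,2,3}" "y = t j" using xy(2) unfolding t(2) by blast
      show ?thesis using adj tileD(2)[OF tt i(1) j(1)] i(2) j(2) xy(3) by blast
    qed
    ultimately show ?thesis unfolding triangle_def by blast
  qed
  moreover have "disjoint ?\<T>"
  proof (rule disjointI)
    fix A B assume AB: "A \<in> ?\<T>" "B \<in> ?\<T>" "A \<noteq> B"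
    then obtain s t where st: "s \<in> S" "t \<in> S" "A = s ` {1,2,3}" "B = t ` {1,2,3}" by blast
    then show "A \<inter> B = {}" using meet[OF st(1,2)] AB(3) by blast
  qed
  moreover have "\<Union>?\<T> = V 1 \<union> V 2 \<union> V 3" using S(2) unfolding verts_def cov_def by auto
  ultimately show ?thesis by blast
qed

text \<open>The constant in \<open>\<epsilon>\<close> is generous: absorption at
  \<open>\<tau> = \<eta> / 20\<close> asks for
  \<open>12 * \<epsilon> \<le> \<eta> * \<eta> / 400\<close>, and almost covering the rest, with
  \<open>2 * \<epsilon>\<close> and \<open>\<eta> / 2\<close> as parameters, asks for
  \<open>120 * \<epsilon> \<le> \<eta> / 2\<close>.\<close>

lemma (in tripartite) tileable_all:
  assumes \<eta>: "0 < \<eta>" "\<eta> \<le> 1" "\<not> sparse \<eta>" and \<epsilon>: "\<epsilon> = \<eta> * \<eta> / 100000"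
    and m: "(9/10) ^ m * real N < 1" "real (12 * (9 * m + 18 * m ^ 3)) + 40 \<le> \<epsilon> * real N"
  shows "tb (V 1 \<union> V 2 \<union> V 3)"
proof -
  let ?N = "real N" and ?\<tau> = "\<eta> / 20"
  have \<eta>2: "\<eta> * \<eta> \<le> \<eta>" "0 < \<eta> * \<eta>" using \<eta> mult_left_mono[of \<eta> 1 \<eta>] by auto
  have \<tau>: "0 < ?\<tau>" "?\<tau> \<le> 1/20" "12 * \<epsilon> \<le> ?\<tau> * ?\<tau>" "\<not> sparse (20 * ?\<tau>)"
    using \<eta> \<eta>2 \<epsilon> by auto
  have "\<epsilon> * ?N \<le> ?\<tau> * ?\<tau> / 4 * ?N" using \<eta>2 \<epsilon> by (intro mult_right_mono) auto
  then have "real (12 * (9 * m + 18 * m ^ 3)) + 40 \<le> ?\<tau> * ?\<tau> / 4 * ?N" using m(2) by linarith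
  from absorbing_set[OF \<tau> m(1) refl this]
  obtain A where A: "card A \<le> 12 * (9 * m + 18 * m ^ 3)" "tb A" and absorb: "\<forall>L c. L \<subseteq> V 1 \<union> V 2 \<union> V 3 - A \<and> c \<le> 12
      \<and> (\<forall>i\<in>{1,2,3}. card (L \<inter> V i) = c) \<longrightarrow> tb (A \<union> L)"
    by (elim exE conjE)
  obtain TA where TA: "til TA" "verts TA = A" using A(2) unfolding tileable_def by blast
  define V' where "V' i = V i - A" for i
  define M where "M = N - card TA"
  \<comment> \<open>A tileable set has equally many vertices in each class, so the rest is again
    balanced.\<close>
  have cA: "card (V i \<inter> A) = card TA" if "i \<in> {1,2,3}" for i
    using card_cov[OF TA(1) that] cov_verts[OF TA(1) that] TA(2) by (simp add: Int_commute)
  have fA: "finite A" using tileable_finite[OF A(2)] .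
  have TA_le: "card TA \<le> N" using cA[of 1] card_sub[of 1 "V 1 \<inter> A"] by auto
  have TA_small: "real (card TA) + 40 \<le> \<epsilon> * ?N"
  proof -
    have "card TA \<le> card A" using cA[of 1] card_mono[OF fA, of "V 1 \<inter> A"] by auto
    then have "card TA \<le> 12 * (9 * m + 18 * m ^ 3)" using A(1) by (rule order_trans)
    then have "real (card TA) \<le> real (12 * (9 * m + 18 * m ^ 3))" by (rule of_nat_mono)
    then show ?thesis using m(2) by linarith
  qed
  have M: "real M = ?N - real (card TA)" using TA_le by (simp add: M_def)
  have M_ge: "(1 - \<epsilon>) * ?N \<le> real M" using TA_small M by (simp add: algebra_simps)
  have half: "1/2 * ?N \<le> (1 - \<epsilon>) * ?N" using eps by (intro mult_right_mono) auto
  have cV': "card (V' i) = M" if "i \<in> {1,2,3}" for i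
    unfolding V'_def M_def using card_Diff_subset_Int[of "V i" A] fA cA[OF that] card_V[OF that] by simp
  \<comment> \<open>Removing \<open>card TA\<close>, at most \<open>\<epsilon> * N\<close>, vertices
    from each class costs at most one more \<open>\<epsilon>\<close> in the degree ratio.\<close>
  interpret H: tripartite V' adj M "2 * \<epsilon>"
  proof
    fix i j v assume i: "i \<in> {1,2,3::nat}" and j: "j \<in> {1,2,3::nat}" "i \<noteq> j" and v: "v \<in> V' i"
    have vV: "v \<in> V i" using v by (simp add: V'_def)
    have "{u \<in> V j. adj v u} \<subseteq> {u \<in> V' j. adj v u} \<union> V j \<inter> A" by (auto simp: V'_def)
    then have "card {u \<in> V j. adj v u} \<le> card ({u \<in> V' j. adj v u} \<union> V j \<inter> A)"
      by (rule card_mono[rotated]) (use fin[OF j(1)] in \<open>simp add: V'_def\<close>)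
    also have "\<dots> \<le> card {u \<in> V' j. adj v u} + card TA"
      using card_Un_le[of "{u \<in> V' j. adj v u}" "V j \<inter> A"] cA[OF j(1)] by simp
    finally have "(2/3 - \<epsilon>) * ?N \<le> real (card {u \<in> V' j. adj v u}) + real (card TA)"
      using deg[OF i j vV] by linarith
    moreover have "(2/3 - 2 * \<epsilon>) * real M + real (card TA) \<le> (2/3 - \<epsilon>) * ?N"
    proof -
      have "0 \<le> \<epsilon> * real M" "0 \<le> real (card TA)" using eps by auto
      moreover have "(1/3 + 2 * \<epsilon>) * real (card TA) \<le> 1 * real (card TA)"
        using eps by (intro mult_right_mono) auto
      moreover have "(2/3 - 2 * \<epsilon>) * real M = (2/3 - 2 * \<epsilon>) * ?N - (2/3 - 2 * \<epsilon>) * real (card TA)"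
        by (simp only: M right_diff_distrib)
      ultimately show ?thesis using TA_small by (simp add: algebra_simps)
    qed
    ultimately show "(2/3 - 2 * \<epsilon>) * real M \<le> real (card {u \<in> V' j. adj v u})" by linarith
  next
    have "0 < 1/2 * ?N" using N_pos by simp
    then show "0 < M" using half M_ge by linarith
    show "0 < 2 * \<epsilon>" using eps by simp
    show "2 * \<epsilon> \<le> 1/1000" using \<epsilon> \<eta>2 \<eta> by linarith
  next
    fix i j assume "i \<in> {1,2,3::nat}" "j \<in> {1,2,3::nat}" "i \<noteq> j"
    then show "V' i \<inter> V' j = {}" using disj unfolding V'_def by blast
  qed (use fin cV' sym in \<open>auto simp: V'_def\<close>)
  \<comment> \<open>A sparse triple of the rest is one of the whole graph with twice the parameter,
    since \<open>M\<close> is at least \<open>(1 - \<epsilon>) N\<close>.\<close>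
  have "\<not> H.sparse (\<eta> / 2)"
  proof
    assume "H.sparse (\<eta> / 2)"
    then obtain X where X: "\<And>i. i \<in> {1,2,3} \<Longrightarrow> X i \<subseteq> V' i \<and> (1/3 - \<eta>/2) * real M \<le> real (card (X i))"
      and cnt: "\<And>i j. i \<in> {1,2,3} \<Longrightarrow> j \<in> {1,2,3} \<Longrightarrow> i \<noteq> j \<Longrightarrow>
        real (pair_count adj (X i) (X j)) \<le> \<eta>/2 * real M * real M"
      unfolding sparse_triple_def by metis
    have MN: "real M \<le> ?N" using M by simp
    have size: "(1/3 - \<eta>) * ?N \<le> (1/3 - \<eta>/2) * real M"
    proof -
      have "\<eta>/2 * real M \<le> \<eta>/2 * ?N" using MN \<eta> by (intro mult_left_mono) auto
      moreover have "1/3 * ((1 - \<epsilon>) * ?N) \<le> 1/3 * real M" using M_ge by (intro mult_left_mono) auto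
      moreover have "1/3 * (\<epsilon> * ?N) \<le> \<eta>/2 * ?N"
      proof -
        have "1/3 * \<epsilon> \<le> \<eta>/2" using \<epsilon> \<eta>2 by simp
        then have "1/3 * \<epsilon> * ?N \<le> \<eta>/2 * ?N" by (rule mult_right_mono) simp
        then show ?thesis by simp
      qed
      ultimately show ?thesis by (simp add: algebra_simps)
    qed
    have cnt': "\<eta>/2 * real M * real M \<le> \<eta> * ?N * ?N"
      using MN \<eta> by (intro mult_mono) auto
    have "sparse \<eta>" unfolding sparse_triple_def
    proof (intro exI[of _ X] conjI ballI impI)
      fix i assume i: "i \<in> {1,2,3::nat}"
      show "X i \<subseteq> V i" using X[OF i] by (auto simp: V'_def)
      show "(1/3 - \<eta>) * ?N \<le> real (card (X i))" using X[OF i] size by linarith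
    next
      fix i j assume "i \<in> {1,2,3::nat}" "j \<in> {1,2,3::nat}" "i \<noteq> j"
      from cnt[OF this] show "real (pair_count adj (X i) (X j)) \<le> \<eta> * ?N * ?N" using cnt' by linarith
    qed
    then show False using \<eta>(3) by simp
  qed
  moreover have "20 \<le> 2 * \<epsilon> * real M"
  proof -
    have "2 * \<epsilon> * (1/2 * ?N) \<le> 2 * \<epsilon> * real M" using half M_ge eps by (intro mult_left_mono) auto
    then show ?thesis using TA_small by simp
  qed
  moreover have "60 * (2 * \<epsilon>) \<le> \<eta> / 2" using \<epsilon> \<eta>2 by simp
  ultimately obtain T where T: "H.til T" "M \<le> card T + 12" using H.almost_cover by blast
  have T': "til T" using T(1) unfolding tiling_def tile_def by (auto simp: V'_def)
  define L where "L = (V 1 \<union> V 2 \<union> V 3) - A - verts T"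
  have LV: "card (L \<inter> V i) = M - card T" if i: "i \<in> {1,2,3}" for i
  proof -
    have "V i \<subseteq> V 1 \<union> V 2 \<union> V 3" using i by auto
    then have "L \<inter> V i = V' i - cov T i"
      using cov_verts[OF T' i] H.cov_verts[OF T(1) i] unfolding L_def V'_def by blast
    then show ?thesis
      using card_Diff_subset[OF _ cov_sub[OF T(1) i]] cV'[OF i] card_cov[OF T(1) i] tilingD(1)[OF T(1)]
      by (simp add: cov_def)
  qed
  have AL: "tb (A \<union> L)"
    by (rule absorb[rule_format, of L "M - card T"]) (use T(2) LV in \<open>auto simp: L_def\<close>)
  have tT: "tb (verts T)" using T' unfolding tileable_def by blast
  have TV: "verts T \<subseteq> V' 1 \<union> V' 2 \<union> V' 3"
    by (rule H.tileable_sub) (use T(1) in \<open>auto simp: tileable_def\<close>)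
  have "tb ((A \<union> L) \<union> verts T)"
    by (rule tileable_Un[OF AL tT]) (use TV in \<open>auto simp: L_def V'_def\<close>)
  moreover have "(A \<union> L) \<union> verts T = V 1 \<union> V 2 \<union> V 3"
    using TV tileable_sub[OF A(2)] unfolding L_def V'_def by blast
  ultimately show ?thesis by simp
qed

theorem theorem3:
  shows "\<exists>\<Delta>\<^sub>0::real. \<Delta>\<^sub>0 > 0 \<and>
    (\<forall>\<Delta>::real. 0 < \<Delta> \<and> \<Delta> < \<Delta>\<^sub>0 \<longrightarrow>
      (\<exists>\<epsilon>::real. \<epsilon> > 0 \<and>
        (\<exists>N\<^sub>0::nat. \<forall>N::nat. N \<ge> N\<^sub>0 \<and> 3 dvd N \<longrightarrow>
          (\<forall>(V :: nat \<Rightarrow> 'a set) (E :: 'a set set).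
            balanced_tripartite_graph N V E \<and>
            (\<forall>i\<in>{1,2,3}. \<forall>j\<in>{1,2,3}. i \<noteq> j \<longrightarrow>
               (\<forall>v\<in>V i. real (card (nbrs_in E v (V j))) \<ge> (2/3 - \<epsilon>) * real N)) \<longrightarrow>
            (\<exists>\<T> :: 'a set set.
               card \<T> = N \<and> (\<forall>T\<in>\<T>. triangle E T) \<and> disjoint \<T> \<and>
               \<Union>\<T> = V 1 \<union> V 2 \<union> V 3) \<or>
            (\<exists>X :: nat \<Rightarrow> 'a set.
               (\<forall>i\<in>{1,2,3}. X i \<subseteq> V i \<and> card (X i) = N div 3) \<and>
               (\<forall>i\<in>{1,2,3}. \<forall>j\<in>{1,2,3}. i \<noteq> j \<longrightarrow> density E (X i) (X j) \<le> \<Delta>))))))"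
proof (rule exI[of _ "1::real"], rule conjI[OF zero_less_one], intro allI impI)
  fix \<Delta> :: real assume \<Delta>: "0 < \<Delta> \<and> \<Delta> < 1"
  \<comment> \<open>The factor \<open>18\<close> is the loss in
    \<open>sparse_triple_density\<close>.\<close>
  define \<eta> where "\<eta> = \<Delta> / 18"
  define \<epsilon> where "\<epsilon> = \<eta> * \<eta> / 100000"
  have \<eta>: "0 < \<eta>" "\<eta> \<le> 1" using \<Delta> by (auto simp: \<eta>_def)
  have \<eta>2: "\<eta> * \<eta> \<le> 1" "0 < \<eta> * \<eta>" using \<eta> mult_mono[of \<eta> 1 \<eta> 1] by auto
  have \<epsilon>: "0 < \<epsilon>" "\<epsilon> \<le> 1/1000" using \<eta>2 by (auto simp: \<epsilon>_def)
  obtain N1 where N1: "\<And>N. N \<ge> N1 \<Longrightarrow>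
      \<exists>m::nat. (9/10) ^ m * real N < 1 \<and> real (12 * (9 * m + 18 * m ^ 3)) + 40 \<le> \<epsilon> * real N"
    using exists_family_size[OF \<epsilon>(1)] by blast
  show "\<exists>\<epsilon>::real. \<epsilon> > 0 \<and>
        (\<exists>N\<^sub>0::nat. \<forall>N::nat. N \<ge> N\<^sub>0 \<and> 3 dvd N \<longrightarrow>
          (\<forall>(V :: nat \<Rightarrow> 'a set) (E :: 'a set set).
            balanced_tripartite_graph N V E \<and>
            (\<forall>i\<in>{1,2,3}. \<forall>j\<in>{1,2,3}. i \<noteq> j \<longrightarrow>
               (\<forall>v\<in>V i. real (card (nbrs_in E v (V j))) \<ge> (2/3 - \<epsilon>) * real N)) \<longrightarrow>
            (\<exists>\<T> :: 'a set set.
               card \<T> = N \<and> (\<forall>T\<in>\<T>. triangle E T) \<and> disjoint \<T> \<and>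
               \<Union>\<T> = V 1 \<union> V 2 \<union> V 3) \<or>
            (\<exists>X :: nat \<Rightarrow> 'a set.
               (\<forall>i\<in>{1,2,3}. X i \<subseteq> V i \<and> card (X i) = N div 3) \<and>
               (\<forall>i\<in>{1,2,3}. \<forall>j\<in>{1,2,3}. i \<noteq> j \<longrightarrow> density E (X i) (X j) \<le> \<Delta>))))"
  \<comment> \<open>\<open>Suc\<close> makes \<open>N\<close> positive, as the locale
    demands.\<close>
  proof (rule exI[of _ \<epsilon>], rule conjI[OF \<epsilon>(1)], rule exI[of _ "Suc N1"], intro allI impI)
    fix N :: nat and V :: "nat \<Rightarrow> 'a set" and E :: "'a set set"
    assume N: "Suc N1 \<le> N \<and> 3 dvd N"
    assume G: "balanced_tripartite_graph N V E \<and>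
            (\<forall>i\<in>{1,2,3}. \<forall>j\<in>{1,2,3}. i \<noteq> j \<longrightarrow>
               (\<forall>v\<in>V i. (2/3 - \<epsilon>) * real N \<le> real (card (nbrs_in E v (V j)))))"
    have Vf: "finite (V i)" "card (V i) = N" if "i \<in> {1,2,3}" for i
      using G that unfolding balanced_tripartite_graph_def tripartite_graph_def by blast+
    interpret tripartite V "\<lambda>u v. {u, v} \<in> E" N \<epsilon>
    proof
      show "V i \<inter> V j = {}" if "i \<in> {1,2,3}" "j \<in> {1,2,3}" "i \<noteq> j" for i j
        using G that unfolding balanced_tripartite_graph_def tripartite_graph_def disjoint_family_on_def by blast
      show "{v, u} \<in> E" if "{u, v} \<in> E" for u v using that by (simp add: insert_commute)
      show "(2/3 - \<epsilon>) * real N \<le> real (card {u \<in> V j. {v, u} \<in> E})"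
        if "i \<in> {1,2,3}" "j \<in> {1,2,3}" "i \<noteq> j" "v \<in> V i" for i j v
        using G that unfolding nbrs_in_def by blast
    qed (use Vf \<epsilon> N in auto)
    show "(\<exists>\<T> :: 'a set set.
               card \<T> = N \<and> (\<forall>T\<in>\<T>. triangle E T) \<and> disjoint \<T> \<and>
               \<Union>\<T> = V 1 \<union> V 2 \<union> V 3) \<or>
            (\<exists>X :: nat \<Rightarrow> 'a set.
               (\<forall>i\<in>{1,2,3}. X i \<subseteq> V i \<and> card (X i) = N div 3) \<and>
               (\<forall>i\<in>{1,2,3}. \<forall>j\<in>{1,2,3}. i \<noteq> j \<longrightarrow> density E (X i) (X j) \<le> \<Delta>))"
    proof (cases "sparse \<eta>")
      case True
      have "18 * \<eta> = \<Delta>" by (simp add: \<eta>_def)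
      then show ?thesis
        using sparse_triple_density[OF True Vf, of] N N_pos \<eta>(1) by (intro disjI2) simp
    next
      case False
      obtain m where m: "(9/10) ^ m * real N < 1" "real (12 * (9 * m + 18 * m ^ 3)) + 40 \<le> \<epsilon> * real N"
        using N1[of N] N by auto
      have "tb (V 1 \<union> V 2 \<union> V 3)" by (rule tileable_all[OF \<eta> False \<epsilon>_def m])
      then show ?thesis by (intro disjI1 triangle_partition)
    qed
  qed
qed

end
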